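(* Let $G$ be an ADB-AC graph with a planar annular embedding having $x+y$ annuli, where the $x\ge 1$ innermost annuli $A_1,\dots,A_x$ are block annuli and the following $y\ge 1$ annuli $A_{x+1},\dots,A_{x+y}$ are ring annuli. Then $G$ is Hamiltonian.
   Context: A Barnette graph is a finite $3$-regular, $3$-connected, planar, bipartite graph. A Barnette graph $G$ is an ADB graph if it has a plane embedding (a planar annular embedding) with pairwise vertex-disjoint cycles $C_0,C_1,\dots,C_n$ of $G$, each $C_{k-1}$ lying in the bounded region of $C_k$, such that $C_0$ bounds a face, $C_n$ bounds the unbounded face, every vertex lies on some $C_k$, and every edge is either an edge of some $C_k$ or joins a vertex of $C_{k-1}$ to a vertex of $C_k$ for some $1\le k\le n$. The closed region between $C_{k-1}$ and $C_k$ is the $k$-th annulus $A_k$; edges joining $C_{k-1}$ to $C_k$ lie in the interior of $A_k$; the faces of $G$ inside $A_k$ are the faces of $A_k$; $A_n$ is the outer annulus. Suppressing degree-$2$ vertices means replacing each maximal path whose internal vertices have degree $2$ by a single edge (a cycle all of whose vertices have degree $2$ becomes a vertex-less closed curve). An ADB graph with $n>2$ annuli is annular connected (ADB-AC) if for every $k$, deleting the edges in the interior of $A_k$ and suppressing degree-$2$ vertices yields either two Barnette graphs or a Barnette graph and a vertex-less closed curve. For $1\le k<n$, the $k$-annular restriction $G_k$ is obtained from the subgraph consisting of $C_0,\dots,C_k$ and the edges in the interiors of $A_1,\dots,A_k$ by suppressing degree-$2$ vertices; its outer annulus $O(G_k)$ is its $k$-th annulus. The faces of an outer annulus are cyclically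 arranged, consecutive ones sharing an edge in the interior of the annulus; they split into two alternating classes of pairwise non-adjacent faces; for ADB-AC graphs one class consists only of $4$-cycles, called the $4$-cycle class. For $k\ge 3$, each edge in the interior of $A_k$ has its endpoint on $C_{k-1}$ lying on an edge of the outer boundary of $G_{k-1}$, belonging to a unique face of $O(G_{k-1})$; the edge is attached to that face. $A_k$ is a block annulus if the edges in its interior are attached to faces in the $4$-cycle class of $O(G_{k-1})$, and a ring annulus if they are attached to faces not in that class. By convention $A_1$ and $A_2$ are of the same type as $A_3$. *)

theory Defs
  imports "HOL-Analysis.Analysis"
begin

section \<open>Graphs\<close>

text \<open>Suppressing degree-2 vertices can create parallel edges, loops and vertex-less closed curves.
  Hence undirected multigraphs: an edge has two end vertices, or one (a loop), or none
  (a vertex-less closed curve).\<close>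

record ('v, 'e) mgraph =
  verts :: "'v set"
  edges :: "'e set"
  ends :: "'e \<Rightarrow> 'v set"

definition vdegree :: "('v, 'e) mgraph \<Rightarrow> 'v \<Rightarrow> nat" where
  "vdegree G v = card {e \<in> edges G. v \<in> ends G e} + card {e \<in> edges G. ends G e = {v}}"

definition adj :: "('v, 'e) mgraph \<Rightarrow> 'v \<Rightarrow> 'v \<Rightarrow> bool" where
  "adj G u v \<longleftrightarrow> (\<exists>e\<in>edges G. ends G e = {u, v})"

definition simple_graph :: "('v, 'e) mgraph \<Rightarrow> bool" where
  "simple_graph G \<longleftrightarrow>
     (\<forall>e\<in>edges G. ends G e \<subseteq> verts G \<and> card (ends G e) = 2) \<and> inj_on (ends G) (edges G)"

definition induced_connected :: "('v, 'e) mgraph \<Rightarrow> 'v set \<Rightarrow> bool" where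
  "induced_connected G U \<longleftrightarrow>
     (\<forall>u\<in>U. \<forall>v\<in>U. (u, v) \<in> {(a, b). a \<in> U \<and> b \<in> U \<and> adj G a b}\<^sup>*)"

definition three_connected :: "('v, 'e) mgraph \<Rightarrow> bool" where
  "three_connected G \<longleftrightarrow>
     card (verts G) > 3 \<and>
     (\<forall>S \<subseteq> verts G. card S < 3 \<longrightarrow> induced_connected G (verts G - S))"

definition bipartite :: "('v, 'e) mgraph \<Rightarrow> bool" where
  "bipartite G \<longleftrightarrow>
     (\<exists>A B. A \<union> B = verts G \<and> A \<inter> B = {} \<and>
        (\<forall>e\<in>edges G. \<exists>a\<in>A. \<exists>b\<in>B. ends G e = {a, b}))"

definition cycle :: "('v, 'e) mgraph \<Rightarrow> 'v list \<Rightarrow> bool" where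
  "cycle G vs \<longleftrightarrow>
     length vs \<ge> 3 \<and> distinct vs \<and> set vs \<subseteq> verts G \<and>
     (\<forall>i<length vs. adj G (vs ! i) (vs ! (Suc i mod length vs)))"

definition cycle_edges :: "('v, 'e) mgraph \<Rightarrow> 'v list \<Rightarrow> 'e set" where
  "cycle_edges G vs =
     {e \<in> edges G. \<exists>i<length vs. ends G e = {vs ! i, vs ! (Suc i mod length vs)}}"

definition hamiltonian :: "('v, 'e) mgraph \<Rightarrow> bool" where
  "hamiltonian G \<longleftrightarrow> (\<exists>vs. cycle G vs \<and> set vs = verts G)"


section \<open>Plane embeddings and Barnette graphs\<close>

text \<open>Only used for simple graphs, so every edge is drawn as an arc.\<close>

definition plane_embedding ::
  "('v, 'e) mgraph \<Rightarrow> ('v \<Rightarrow> complex) \<Rightarrow> ('e \<Rightarrow> real \<Rightarrow> complex) \<Rightarrow> bool" where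
  "plane_embedding G pos crv \<longleftrightarrow>
     inj_on pos (verts G) \<and>
     (\<forall>e\<in>edges G. arc (crv e) \<and>
        {pathstart (crv e), pathfinish (crv e)} = pos ` ends G e \<and>
        path_image (crv e) \<inter> pos ` verts G = pos ` ends G e) \<and>
     (\<forall>e\<in>edges G. \<forall>f\<in>edges G. e \<noteq> f \<longrightarrow>
        path_image (crv e) \<inter> path_image (crv f) \<subseteq> pos ` (ends G e \<inter> ends G f))"

definition planar :: "('v, 'e) mgraph \<Rightarrow> bool" where
  "planar G \<longleftrightarrow> (\<exists>pos crv. plane_embedding G pos crv)"

definition drawing :: "('e \<Rightarrow> real \<Rightarrow> complex) \<Rightarrow> 'e set \<Rightarrow> complex set" where
  "drawing crv F = (\<Union>e\<in>F. path_image (crv e))"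

definition faces :: "('e \<Rightarrow> real \<Rightarrow> complex) \<Rightarrow> 'e set \<Rightarrow> complex set set" where
  "faces crv F = components (- drawing crv F)"

definition barnette :: "('v, 'e) mgraph \<Rightarrow> bool" where
  "barnette G \<longleftrightarrow>
     finite (verts G) \<and> finite (edges G) \<and> simple_graph G \<and>
     (\<forall>v\<in>verts G. vdegree G v = 3) \<and>
     three_connected G \<and> planar G \<and> bipartite G"


section \<open>Suppressing degree-2 vertices\<close>

text \<open>A maximal path with internal vertices of degree 2 (or a cycle consisting of degree-2 vertices)
  is represented by its set of edges. These sets are the equivalence classes generated by
  sharing a degree-2 vertex.\<close>

definition in_series :: "('v, 'e) mgraph \<Rightarrow> ('e \<times> 'e) set" where
  "in_series G =
     {(e, f). e \<in> edges G \<and> f \<in> edges G \<and>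
        (\<exists>v\<in>verts G. vdegree G v = 2 \<and> v \<in> ends G e \<and> v \<in> ends G f)}"

definition suppress :: "('v, 'e) mgraph \<Rightarrow> ('v, 'e set) mgraph" where
  "suppress G =
     \<lparr>verts = {v \<in> verts G. vdegree G v \<noteq> 2},
      edges = edges G // (in_series G)\<^sup>*,
      ends = (\<lambda>P. {v \<in> verts G. vdegree G v \<noteq> 2 \<and> (\<exists>e\<in>P. v \<in> ends G e)})\<rparr>"

definition delete_edges :: "('v, 'e) mgraph \<Rightarrow> 'e set \<Rightarrow> ('v, 'e) mgraph" where
  "delete_edges G F = \<lparr>verts = verts G, edges = edges G - F, ends = ends G\<rparr>"

definition closed_curve :: "('v, 'e) mgraph \<Rightarrow> bool" where
  "closed_curve G \<longleftrightarrow> verts G = {} \<and> (\<exists>e. edges G = {e} \<and> ends G e = {})"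

definition disjoint_union ::
  "('v, 'e) mgraph \<Rightarrow> ('v, 'e) mgraph \<Rightarrow> ('v, 'e) mgraph \<Rightarrow> bool" where
  "disjoint_union H H1 H2 \<longleftrightarrow>
     verts H = verts H1 \<union> verts H2 \<and> verts H1 \<inter> verts H2 = {} \<and>
     edges H = edges H1 \<union> edges H2 \<and> edges H1 \<inter> edges H2 = {} \<and>
     ends H1 = ends H \<and> ends H2 = ends H"


section \<open>Annular embeddings\<close>

text \<open>The cycles are \<open>C 0, \<dots>, C n\<close>, each given by its cyclic list of vertices.\<close>

definition cycle_curve ::
  "('v, 'e) mgraph \<Rightarrow> ('e \<Rightarrow> real \<Rightarrow> complex) \<Rightarrow> 'v list \<Rightarrow> complex set" where
  "cycle_curve G crv vs = drawing crv (cycle_edges G vs)"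

text \<open>In an annular embedding the edges joining \<open>C (k - 1)\<close> to \<open>C k\<close> are the
  edges in the interior of the \<open>k\<close>-th annulus.\<close>

definition annulus_edges :: "('v, 'e) mgraph \<Rightarrow> (nat \<Rightarrow> 'v list) \<Rightarrow> nat \<Rightarrow> 'e set" where
  "annulus_edges G C k =
     {e \<in> edges G. \<exists>u\<in>set (C (k - 1)). \<exists>v\<in>set (C k). ends G e = {u, v}}"

definition annular_embedding ::
  "('v, 'e) mgraph \<Rightarrow> ('v \<Rightarrow> complex) \<Rightarrow> ('e \<Rightarrow> real \<Rightarrow> complex) \<Rightarrow>
   (nat \<Rightarrow> 'v list) \<Rightarrow> nat \<Rightarrow> bool" where
  "annular_embedding G pos crv C n \<longleftrightarrow>
     plane_embedding G pos crv \<and>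
     (\<forall>k\<le>n. cycle G (C k)) \<and>
     (\<forall>j\<le>n. \<forall>k\<le>n. j \<noteq> k \<longrightarrow> set (C j) \<inter> set (C k) = {}) \<and>
     (\<forall>k\<in>{1..n}. cycle_curve G crv (C (k - 1)) \<subseteq> inside (cycle_curve G crv (C k))) \<and>
     (\<exists>f\<in>faces crv (edges G). frontier f = cycle_curve G crv (C 0)) \<and>
     (\<exists>f\<in>faces crv (edges G). \<not> bounded f \<and> frontier f = cycle_curve G crv (C n)) \<and>
     verts G = (\<Union>k\<le>n. set (C k)) \<and>
     edges G = (\<Union>k\<le>n. cycle_edges G (C k)) \<union> (\<Union>k\<in>{1..n}. annulus_edges G C k)"

definition adb ::
  "('v, 'e) mgraph \<Rightarrow> ('v \<Rightarrow> complex) \<Rightarrow> ('e \<Rightarrow> real \<Rightarrow> complex) \<Rightarrow>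
   (nat \<Rightarrow> 'v list) \<Rightarrow> nat \<Rightarrow> bool" where
  "adb G pos crv C n \<longleftrightarrow> barnette G \<and> annular_embedding G pos crv C n"

definition adb_ac ::
  "('v, 'e) mgraph \<Rightarrow> ('v \<Rightarrow> complex) \<Rightarrow> ('e \<Rightarrow> real \<Rightarrow> complex) \<Rightarrow>
   (nat \<Rightarrow> 'v list) \<Rightarrow> nat \<Rightarrow> bool" where
  "adb_ac G pos crv C n \<longleftrightarrow>
     adb G pos crv C n \<and> n > 2 \<and>
     (\<forall>k\<in>{1..n}. \<exists>H1 H2.
        disjoint_union (suppress (delete_edges G (annulus_edges G C k))) H1 H2 \<and>
        barnette H1 \<and> (barnette H2 \<or> closed_curve H2))"


section \<open>Annular restrictions, block and ring annuli\<close>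

definition inner_part :: "('v, 'e) mgraph \<Rightarrow> (nat \<Rightarrow> 'v list) \<Rightarrow> nat \<Rightarrow> ('v, 'e) mgraph" where
  "inner_part G C k =
     \<lparr>verts = (\<Union>i\<le>k. set (C i)),
      edges = (\<Union>i\<le>k. cycle_edges G (C i)) \<union> (\<Union>i\<in>{1..k}. annulus_edges G C i),
      ends = ends G\<rparr>"

definition annular_restriction ::
  "('v, 'e) mgraph \<Rightarrow> (nat \<Rightarrow> 'v list) \<Rightarrow> nat \<Rightarrow> ('v, 'e set) mgraph" where
  "annular_restriction G C k = suppress (inner_part G C k)"

text \<open>The closed region between \<open>C (k - 1)\<close> and \<open>C k\<close>.\<close>

definition annulus ::
  "('v, 'e) mgraph \<Rightarrow> ('e \<Rightarrow> real \<Rightarrow> complex) \<Rightarrow> (nat \<Rightarrow> 'v list) \<Rightarrow> nat \<Rightarrow> complex set" where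
  "annulus G crv C k =
     (cycle_curve G crv (C k) \<union> inside (cycle_curve G crv (C k)))
       - inside (cycle_curve G crv (C (k - 1)))"

text \<open>The faces of the outer annulus of the \<open>k\<close>-annular restriction. Suppressing vertices does not
  change the point set of the drawing, hence does not change the faces as subsets of the plane; it
  does change the number of edges on their boundaries.\<close>

definition outer_faces ::
  "('v, 'e) mgraph \<Rightarrow> ('e \<Rightarrow> real \<Rightarrow> complex) \<Rightarrow> (nat \<Rightarrow> 'v list) \<Rightarrow> nat \<Rightarrow> complex set set" where
  "outer_faces G crv C k =
     {f \<in> faces crv (edges (inner_part G C k)). f \<subseteq> annulus G crv C k}"

definition adjacent_faces ::
  "('v, 'e) mgraph \<Rightarrow> ('e \<Rightarrow> real \<Rightarrow> complex) \<Rightarrow> (nat \<Rightarrow> 'v list) \<Rightarrow> nat \<Rightarrow>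
   complex set \<Rightarrow> complex set \<Rightarrow> bool" where
  "adjacent_faces G crv C k f g \<longleftrightarrow>
     f \<noteq> g \<and> (\<exists>e\<in>annulus_edges G C k. path_image (crv e) \<subseteq> frontier f \<inter> frontier g)"

text \<open>Boundary lengths are measured in the suppressed graph, whose edges are sets of edges of \<open>G\<close>.\<close>

definition four_cycle_face ::
  "('v, 'e) mgraph \<Rightarrow> ('e \<Rightarrow> real \<Rightarrow> complex) \<Rightarrow> (nat \<Rightarrow> 'v list) \<Rightarrow> nat \<Rightarrow> complex set \<Rightarrow> bool" where
  "four_cycle_face G crv C k f \<longleftrightarrow>
     (\<exists>vs. length vs = 4 \<and> cycle (annular_restriction G C k) vs \<and>
        frontier f = drawing crv (\<Union> (cycle_edges (annular_restriction G C k) vs)))"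

definition four_cycle_class ::
  "('v, 'e) mgraph \<Rightarrow> ('e \<Rightarrow> real \<Rightarrow> complex) \<Rightarrow> (nat \<Rightarrow> 'v list) \<Rightarrow> nat \<Rightarrow>
   complex set set \<Rightarrow> bool" where
  "four_cycle_class G crv C k S \<longleftrightarrow>
     S \<subseteq> outer_faces G crv C k \<and>
     (\<forall>f\<in>S. \<forall>g\<in>S. \<not> adjacent_faces G crv C k f g) \<and>
     (\<forall>f\<in>outer_faces G crv C k - S. \<forall>g\<in>outer_faces G crv C k - S.
        \<not> adjacent_faces G crv C k f g) \<and>
     (\<forall>f\<in>S. four_cycle_face G crv C k f)"

text \<open>An edge \<open>e\<close> in the interior of the \<open>k\<close>-th annulus is attached to a face \<open>f\<close> of the outer
  annulus of the \<open>(k - 1)\<close>-annular restriction: its end on \<open>C (k - 1)\<close> lies on an edge \<open>P\<close> of the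
  restriction that is part of the outer boundary \<open>C (k - 1)\<close> and belongs to \<open>f\<close>.\<close>

definition attached ::
  "('v, 'e) mgraph \<Rightarrow> ('e \<Rightarrow> real \<Rightarrow> complex) \<Rightarrow> (nat \<Rightarrow> 'v list) \<Rightarrow> nat \<Rightarrow>
   'e \<Rightarrow> complex set \<Rightarrow> bool" where
  "attached G crv C k e f \<longleftrightarrow>
     f \<in> outer_faces G crv C (k - 1) \<and>
     (\<exists>v P. v \<in> ends G e \<and> v \<in> set (C (k - 1)) \<and>
        P \<in> edges (annular_restriction G C (k - 1)) \<and> P \<subseteq> cycle_edges G (C (k - 1)) \<and>
        v \<in> \<Union> (ends G ` P) \<and> drawing crv P \<subseteq> frontier f)"

text \<open>By convention the first two annuli have the type of the third one, whence \<open>max k 3\<close>.\<close>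

definition block_annulus ::
  "('v, 'e) mgraph \<Rightarrow> ('e \<Rightarrow> real \<Rightarrow> complex) \<Rightarrow> (nat \<Rightarrow> 'v list) \<Rightarrow> nat \<Rightarrow> bool" where
  "block_annulus G crv C k \<longleftrightarrow>
     (let j = max k 3 in \<exists>S. four_cycle_class G crv C (j - 1) S \<and>
        (\<forall>e\<in>annulus_edges G C j. \<exists>f\<in>S. attached G crv C j e f))"

definition ring_annulus ::
  "('v, 'e) mgraph \<Rightarrow> ('e \<Rightarrow> real \<Rightarrow> complex) \<Rightarrow> (nat \<Rightarrow> 'v list) \<Rightarrow> nat \<Rightarrow> bool" where
  "ring_annulus G crv C k \<longleftrightarrow>
     (let j = max k 3 in \<exists>S. four_cycle_class G crv C (j - 1) S \<and>
        (\<forall>e\<in>annulus_edges G C j. \<exists>f. f \<notin> S \<and> attached G crv C j e f))"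

end

theory Submission
  imports Defs
begin

text \<open>Call an edge in the interior of an annulus a spoke. The Hamiltonian cycle is built from the inside
  out: a cycle through all vertices of \<open>C 0, \<dots>, C (k - 1)\<close> that contains every edge of
  \<open>C (k - 1)\<close> between two ends of spokes of the \<open>k\<close>-th annulus is extended by
  replacing such edges by paths of \<open>C k\<close> together with two spokes.
  While the next annulus is a block annulus, this is done at every face in the 4-cycle class: every
  other face of the annulus contains only one edge of \<open>C k\<close>, so that the inserted paths cover
  \<open>C k\<close>. From the last block annulus on, there is a 4-cycle of \<open>G\<close>
  in the annulus, and a single insertion of \<open>C k\<close> without one edge suffices.
  For the first and the last annulus the required faces come from parities: \<open>G\<close> and the suppressed
  graphs are bipartite, so that spoke ends occur in runs of even length.

  The topology of the embedding enters through the theta curve formed by \<open>C k\<close> and a chord that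
  consists of two spokes and an arc of \<open>C (k - 1)\<close>. It shows that the two ends of the spokes have the
  same cyclic order on both cycles and identifies the faces of the annulus.\<close>

section \<open>Paths and cyclic lists\<close>

text \<open>The type of an annulus is a statement about the faces of the annulus before it: whether
  annulus \<open>k + 1\<close> is a block or a ring annulus decides which faces of annulus
  \<open>k\<close> carry spoke ends on \<open>C k\<close>, and thereby how \<open>C k\<close> is
  inserted. This says nothing about annulus 1, since the first two types are mere conventions, nor
  about the last annulus, which has no successor. Parity replaces the missing information there.

  An insertion at annulus \<open>k + 1\<close> removes only edges of \<open>C k\<close> with spokes
  of annulus \<open>k + 1\<close> at both ends. The cycle built so far therefore has to contain
  these edges, and may treat all others freely.

  3-connectedness enters as the existence of three spokes in every annulus. For a face between two
  neighbouring spokes, the third spoke marks the other side of the chord: it shows where the rest of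
  \<open>C (k - 1)\<close> and all inner cycles lie, and that neighbouring faces are
  distinct.\<close>

definition ppairs :: "'v list \<Rightarrow> 'v set set" where
  "ppairs p = {{p ! i, p ! Suc i} |i. Suc i < length p}"

lemma ppairs_Nil [simp]: "ppairs [] = {}"
  by (simp add: ppairs_def)

lemma ppairs_single [simp]: "ppairs [a] = {}"
  by (simp add: ppairs_def)

lemma ppairs_Cons2 [simp]: "ppairs (a # b # p) = insert {a, b} (ppairs (b # p))"
proof -
  have "{{(a#b#p) ! i, (a#b#p) ! Suc i} |i. Suc i < length (a#b#p)} =
    insert {a,b} {{(b#p) ! i, (b#p) ! Suc i} |i. Suc i < length (b#p)}" (is "?L = ?R")
  proof
    show "?L \<subseteq> ?R"
    proof
      fix s assume "s \<in> ?L"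
      then obtain i where i: "Suc i < length (a#b#p)" "s = {(a#b#p) ! i, (a#b#p) ! Suc i}" by blast
      show "s \<in> ?R"
      proof (cases i)
        case 0 then show ?thesis using i by simp
      next
        case (Suc j)
        then have "Suc j < length (b#p)" "s = {(b#p) ! j, (b#p) ! Suc j}" using i by auto
        then show ?thesis by blast
      qed
    qed
    show "?R \<subseteq> ?L"
    proof
      fix s assume "s \<in> ?R"
      then consider "s = {a,b}" | i where "Suc i < length (b#p)" "s = {(b#p) ! i, (b#p) ! Suc i}" by blast
      then show "s \<in> ?L"
      proof cases
        case 1 then show ?thesis by (intro CollectI exI[of _ 0]) auto
      next
        case (2 i) then show ?thesis by (intro CollectI exI[of _ "Suc i"]) auto
      qed
    qed
  qed
  then show ?thesis unfolding ppairs_def .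
qed

lemma ppairs_append:
  "xs \<noteq> [] \<Longrightarrow> ys \<noteq> [] \<Longrightarrow> ppairs (xs @ ys) = ppairs xs \<union> ppairs ys \<union> {{last xs, hd ys}}"
proof (induction xs)
  case (Cons a xs)
  then show ?case
    by (cases xs; cases ys) auto
qed simp

lemma ppairs_rev [simp]: "ppairs (rev xs) = ppairs xs"
proof (induction xs)
  case (Cons a xs)
  then show ?case
    by (cases xs) (simp_all add: ppairs_append insert_commute del: append_assoc)
qed simp

lemma ppairs_subset_set: "s \<in> ppairs p \<Longrightarrow> s \<subseteq> set p"
  unfolding ppairs_def by auto

text \<open>Edges are recorded by their sets of ends. In a simple graph these determine the edge,
  and the direction in which a list is traversed becomes irrelevant.\<close>

definition cpairs :: "'v list \<Rightarrow> 'v set set" where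
  "cpairs vs = {{vs ! i, vs ! (Suc i mod length vs)} |i. i < length vs}"

lemma cpairs_eq:
  assumes "vs \<noteq> []"
  shows "cpairs vs = insert {last vs, hd vs} (ppairs vs)"
proof -
  let ?n = "length vs"
  have n: "?n > 0" using assms by simp
  have "cpairs vs = (\<lambda>i. {vs ! i, vs ! (Suc i mod ?n)}) ` {..<?n}"
    unfolding cpairs_def by auto
  also have "{..<?n} = insert (?n - 1) {..<?n - 1}" using n by auto
  also have "(\<lambda>i. {vs ! i, vs ! (Suc i mod ?n)}) ` \<dots> =
     insert {vs ! (?n-1), vs ! 0} ((\<lambda>i. {vs ! i, vs ! (Suc i mod ?n)}) ` {..<?n - 1})"
    using n by simp
  also have "(\<lambda>i. {vs ! i, vs ! (Suc i mod ?n)}) ` {..<?n - 1} = (\<lambda>i. {vs ! i, vs ! (Suc i)}) ` {..<?n - 1}"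
    by (intro image_cong) auto
  also have "\<dots> = ppairs vs" unfolding ppairs_def by auto
  finally show ?thesis using assms by (simp add: last_conv_nth hd_conv_nth)
qed

lemma cpairs_rotate1 [simp]: "cpairs (rotate1 vs) = cpairs vs"
proof (cases vs)
  case (Cons a xs)
  then show ?thesis
    by (cases xs) (auto simp: cpairs_eq ppairs_append insert_commute simp flip: append_Cons)
qed simp

lemma cpairs_rotate [simp]: "cpairs (rotate k vs) = cpairs vs"
  by (induction k) auto

lemma cpairs_rev: "cpairs (rev vs) = cpairs vs"
  by (cases "vs = []") (auto simp: cpairs_eq hd_rev last_rev insert_commute)

lemma adj_sym: "adj G u v \<longleftrightarrow> adj G v u"
  unfolding adj_def by (simp add: insert_commute)

lemma adj_ppairs_iff: "(\<forall>s\<in>ppairs p. \<exists>e\<in>edges G. ends G e = s) \<longleftrightarrow> successively (adj G) p"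
  unfolding successively_conv_nth ppairs_def adj_def by blast

lemma cycle_cpairs_iff:
  "cycle G vs \<longleftrightarrow> length vs \<ge> 3 \<and> distinct vs \<and> set vs \<subseteq> verts G \<and> (\<forall>s\<in>cpairs vs. \<exists>e\<in>edges G. ends G e = s)"
  unfolding cycle_def cpairs_def adj_def by blast

lemma cycle_rotate: "cycle G vs \<Longrightarrow> cycle G (rotate k vs)"
  unfolding cycle_cpairs_iff by simp

lemma cycle_rev: "cycle G vs \<Longrightarrow> cycle G (rev vs)"
  unfolding cycle_cpairs_iff by (simp add: cpairs_rev)

text \<open>Opens a cycle at a given edge, so that it becomes a path from \<open>w\<close> to
  \<open>z\<close>. A rotation brings the edge to the seam of the list; if its ends come out in the
  wrong order, the list is reversed.\<close>

lemma cycle_rotate_to: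
  assumes "cycle G H" "{z, w} \<in> cpairs H"
  obtains H' where "cycle G H'" "set H' = set H" "cpairs H' = cpairs H" "last H' = z" "hd H' = w"
proof -
  have *: "\<exists>H'. cycle G H' \<and> set H' = set H \<and> cpairs H' = cpairs H \<and> last H' = H!i \<and> hd H' = H ! (Suc i mod length H)"
    if "i < length H" for i
  proof (intro exI[of _ "rotate (Suc i) H"] conjI)
    have ne: "H \<noteq> []" using that by auto
    show "hd (rotate (Suc i) H) = H ! (Suc i mod length H)"
      using ne by (simp add: hd_rotate_conv_nth del: rotate_Suc)
    have "last (rotate (Suc i) H) = rotate (Suc i) H ! (length H - 1)"
      using ne by (simp add: last_conv_nth del: rotate_Suc)
    also have "\<dots> = H ! ((Suc i + (length H - 1)) mod length H)"
      using that by (subst nth_rotate) auto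
    also have "Suc i + (length H - 1) = i + length H" using that by simp
    also have "\<dots> mod length H = i" using that by simp
    finally show "last (rotate (Suc i) H) = H ! i" .
  qed (use assms(1) in \<open>simp_all add: cycle_rotate del: rotate_Suc\<close>)
  obtain i where i: "i < length H" "{z,w} = {H ! i, H ! (Suc i mod length H)}"
    using assms(2) unfolding cpairs_def by blast
  obtain H' where H': "cycle G H'" "set H' = set H" "cpairs H' = cpairs H" "last H' = H!i"
      "hd H' = H ! (Suc i mod length H)" using *[OF i(1)] by blast
  from i(2) consider "z = H ! i" "w = H ! (Suc i mod length H)" | "w = H ! i" "z = H ! (Suc i mod length H)"
    by (auto simp: doubleton_eq_iff)
  then show thesis
  proof cases
    case 1 then show ?thesis using H' that by blast
  next
    case 2
    show ?thesis
      by (rule that[of "rev H'"]) (use 2 H' in \<open>simp_all add: cycle_rev cpairs_rev last_rev hd_rev\<close>)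
  qed
qed

text \<open>Once the cycle is opened at \<open>{z, w}\<close>, the path is appended to the list.
  Only that one edge is lost, which is what lets several insertions be made one after the
  other.\<close>

lemma cycle_insert_path:
  assumes H: "cycle G H" "{z, w} \<in> cpairs H"
    and p: "p \<noteq> []" "distinct p" "successively (adj G) p" "set p \<subseteq> verts G" "set p \<inter> set H = {}"
    and zp: "adj G z (hd p)" and pw: "adj G (last p) w"
  obtains H' where "cycle G H'" "set H' = set H \<union> set p"
    "cpairs H - {{z, w}} \<subseteq> cpairs H'" "ppairs p \<subseteq> cpairs H'"
proof -
  obtain H1 where H1: "cycle G H1" "set H1 = set H" "cpairs H1 = cpairs H" "last H1 = z" "hd H1 = w"
    using cycle_rotate_to[OF H] by blast
  have ne: "H1 \<noteq> []" using H1(1) unfolding cycle_def by auto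
  have cp: "cpairs (H1 @ p) = ppairs H1 \<union> ppairs p \<union> {{z, hd p}, {last p, w}}"
    using ne p(1) H1 by (auto simp: cpairs_eq ppairs_append)
  have cH: "cpairs H = insert {z,w} (ppairs H1)"
    using ne H1 by (metis cpairs_eq)
  show thesis
  proof (rule that[of "H1 @ p"])
    show "cycle G (H1 @ p)"
      unfolding cycle_cpairs_iff cp
    proof (intro conjI ballI)
      fix s assume "s \<in> ppairs H1 \<union> ppairs p \<union> {{z, hd p}, {last p, w}}"
      then consider "s \<in> cpairs H" | "s \<in> ppairs p" | "s = {z, hd p}" | "s = {last p, w}"
        using cH by blast
      then show "\<exists>e\<in>edges G. ends G e = s"
      proof cases
        case 1 then show ?thesis using H(1) unfolding cycle_cpairs_iff by blast
      next
        case 2 then show ?thesis using p(3) unfolding adj_ppairs_iff[symmetric] by blast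
      next
        case 3 then show ?thesis using zp unfolding adj_def by blast
      next
        case 4 then show ?thesis using pw unfolding adj_def by blast
      qed
    qed (use H1 p in \<open>auto simp: cycle_def\<close>)
  qed (use H1 cp cH in auto)
qed

text \<open>Cyclic lists are handled as periodic sequences, so that no index has to be reduced.\<close>

definition cyc :: "'v list \<Rightarrow> nat \<Rightarrow> 'v" where
  "cyc vs i = vs ! (i mod length vs)"

text \<open>Both ends are included, and \<open>j\<close> may exceed the period:
  \<open>seg vs j (i + length vs)\<close> is the arc complementary to \<open>seg vs i j\<close>, and
  it ends in the vertex at \<open>i\<close>.\<close>

definition seg :: "'v list \<Rightarrow> nat \<Rightarrow> nat \<Rightarrow> 'v list" where
  "seg vs i j = map (cyc vs) [i..<Suc j]"

lemma cyc_add_length [simp]: "cyc vs (i + length vs) = cyc vs i"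
  by (simp add: cyc_def)

lemma cyc_in_set [simp]: "vs \<noteq> [] \<Longrightarrow> cyc vs i \<in> set vs"
  by (simp add: cyc_def)

lemma cyc_eq_iff: "distinct vs \<Longrightarrow> vs \<noteq> [] \<Longrightarrow> cyc vs i = cyc vs j \<longleftrightarrow> i mod length vs = j mod length vs"
  by (simp add: cyc_def nth_eq_iff_index_eq)

lemma cyc_inj:
  assumes "distinct vs" "cyc vs i = cyc vs j" "i \<le> j" "j < i + length vs"
  shows "i = j"
proof -
  have "vs \<noteq> []" using assms by auto
  then have "i mod length vs = j mod length vs" using assms cyc_eq_iff by blast
  then show ?thesis using assms(3,4)
    by (metis add_diff_inverse_nat dvd_imp_mod_0 mod_eq_dvd_iff_nat nat_add_left_cancel_less not_less
        nat_dvd_not_less zero_less_diff diff_is_0_eq' le_antisym bot_nat_0.not_eq_extremum)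
qed

text \<open>The start \<open>i\<close> of the window is free, so that a vertex can be located to the
  right of any given position.\<close>

lemma set_cyc_window: "vs \<noteq> [] \<Longrightarrow> v \<in> set vs \<Longrightarrow> \<exists>l\<ge>i. l < i + length vs \<and> cyc vs l = v"
proof -
  assume a: "vs \<noteq> []" "v \<in> set vs"
  then obtain k where k: "k < length vs" "v = vs ! k" by (metis in_set_conv_nth)
  let ?m = "length vs"
  define l where "l = i + (k + ?m - i mod ?m) mod ?m"
  have "l mod ?m = (i mod ?m + (k + ?m - i mod ?m)) mod ?m"
    unfolding l_def by (metis mod_add_left_eq mod_add_right_eq)
  also have "i mod ?m + (k + ?m - i mod ?m) = k + ?m"
    using mod_less_divisor[of ?m i] k by linarith
  finally have "l mod ?m = k" using k by simp
  moreover have "i \<le> l" "l < i + ?m" unfolding l_def using a by auto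
  ultimately show ?thesis using k unfolding cyc_def by blast
qed

lemma set_seg: "set (seg vs i j) = cyc vs ` {i..j}"
  by (auto simp: seg_def atLeastLessThanSuc_atLeastAtMost)

lemma length_seg [simp]: "length (seg vs i j) = Suc j - i"
  by (simp add: seg_def del: upt_Suc)

lemma nth_seg: "l < Suc j - i \<Longrightarrow> seg vs i j ! l = cyc vs (i + l)"
  by (simp add: seg_def del: upt_Suc)

lemma seg_ne [simp]: "i \<le> j \<Longrightarrow> seg vs i j \<noteq> []"
  by (simp add: seg_def)

lemma hd_seg [simp]: "i \<le> j \<Longrightarrow> hd (seg vs i j) = cyc vs i"
  by (simp add: hd_conv_nth nth_seg)

lemma last_seg [simp]: "i \<le> j \<Longrightarrow> last (seg vs i j) = cyc vs j"
  by (simp add: seg_def)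

lemma distinct_seg: "distinct vs \<Longrightarrow> j < i + length vs \<Longrightarrow> distinct (seg vs i j)"
  unfolding distinct_conv_nth
proof (intro allI impI)
  fix a b assume d: "\<forall>a<length vs. \<forall>b<length vs. a \<noteq> b \<longrightarrow> vs ! a \<noteq> vs ! b" and j: "j < i + length vs"
    and ab: "a < length (seg vs i j)" "b < length (seg vs i j)" "a \<noteq> b"
  have d: "distinct vs" using d unfolding distinct_conv_nth .
  have b: "i + a \<le> j" "i + b \<le> j" using ab by auto
  have "cyc vs (i + a) \<noteq> cyc vs (i + b)"
  proof
    assume e: "cyc vs (i + a) = cyc vs (i + b)"
    show False
    proof (cases "a \<le> b")
      case True
      then show False using cyc_inj[OF d e] ab(3) b j by linarith
    next
      case False
      then show False using cyc_inj[OF d e[symmetric]] ab(3) b j by linarith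
    qed
  qed
  then show "seg vs i j ! a \<noteq> seg vs i j ! b" using ab by (simp add: nth_seg)
qed

lemma ppairs_seg: "ppairs (seg vs i j) = {{cyc vs l, cyc vs (Suc l)} |l. i \<le> l \<and> l < j}"
proof -
  have "ppairs (seg vs i j) = {{seg vs i j ! l, seg vs i j ! Suc l} |l. i + l < j}"
    unfolding ppairs_def by (rule Collect_cong) (metis add.commute add_Suc_right length_seg less_diff_conv less_Suc_eq_le Suc_le_eq not_less_eq)
  also have "\<dots> = {{cyc vs (i+l), cyc vs (Suc (i+l))} |l. i + l < j}"
    by (intro Collect_cong ex_cong1) (auto simp: nth_seg)
  also have "\<dots> = {{cyc vs l, cyc vs (Suc l)} |l. i \<le> l \<and> l < j}"
    by (auto) (metis le_add_diff_inverse)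
  finally show ?thesis .
qed

lemma cpairs_cyc: "vs \<noteq> [] \<Longrightarrow> cpairs vs = {{cyc vs l, cyc vs (Suc l)} |l. True}"
proof -
  assume a: "vs \<noteq> []"
  have "{vs ! i, vs ! (Suc i mod length vs)} = {cyc vs i, cyc vs (Suc i)}" if "i < length vs" for i
    using that by (simp add: cyc_def)
  moreover have "{cyc vs l, cyc vs (Suc l)} = {vs ! (l mod length vs), vs ! (Suc (l mod length vs) mod length vs)}" for l
    by (simp add: cyc_def mod_Suc_eq)
  ultimately have *: "cpairs vs = {{cyc vs i, cyc vs (Suc i)} |i. i < length vs}"
    and **: "{cyc vs l, cyc vs (Suc l)} = {cyc vs (l mod length vs), cyc vs (Suc (l mod length vs))}" for l
    unfolding cpairs_def using a by (blast, simp add: cyc_def mod_Suc_eq)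
  show ?thesis unfolding *
  proof (intro Collect_cong iffI; elim exE conjE)
    fix s l assume "s = {cyc vs l, cyc vs (Suc l)}"
    with ** have "s = {cyc vs (l mod length vs), cyc vs (Suc (l mod length vs))}" by blast
    moreover have "l mod length vs < length vs" using a by simp
    ultimately show "\<exists>i. s = {cyc vs i, cyc vs (Suc i)} \<and> i < length vs" by blast
  qed blast
qed

lemma cyc_pair_in_cpairs: "vs \<noteq> [] \<Longrightarrow> {cyc vs l, cyc vs (Suc l)} \<in> cpairs vs"
  by (auto simp: cpairs_cyc)

lemma cyc_window:
  assumes "vs \<noteq> []"
  obtains l' where "i \<le> l'" "l' < i + length vs" "cyc vs l' = cyc vs l" "cyc vs (Suc l') = cyc vs (Suc l)"
proof -
  let ?m = "length vs"
  define l' where "l' = i + (l mod ?m + ?m - i mod ?m) mod ?m"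
  have m: "0 < ?m" using assms by simp
  have "l' mod ?m = (i mod ?m + (l mod ?m + ?m - i mod ?m)) mod ?m"
    unfolding l'_def by (metis mod_add_left_eq mod_add_right_eq)
  also have "i mod ?m + (l mod ?m + ?m - i mod ?m) = l mod ?m + ?m"
    using mod_less_divisor[OF m, of i] by linarith
  finally have e: "l' mod ?m = l mod ?m" by simp
  then have "Suc l' mod ?m = Suc l mod ?m" by (metis mod_Suc_eq)
  then show thesis
    by (intro that[of l']) (use m e in \<open>auto simp: l'_def cyc_def\<close>)
qed

lemma cpairs_split:
  assumes "vs \<noteq> []" "i \<le> j" "j \<le> i + length vs"
  shows "cpairs vs = ppairs (seg vs i j) \<union> ppairs (seg vs j (i + length vs))"
proof (intro equalityI subsetI)
  fix s assume "s \<in> cpairs vs"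
  then obtain l where l: "s = {cyc vs l, cyc vs (Suc l)}" using cpairs_cyc[OF assms(1)] by blast
  obtain l' where "i \<le> l'" "l' < i + length vs" "cyc vs l' = cyc vs l" "cyc vs (Suc l') = cyc vs (Suc l)"
    using cyc_window[OF assms(1)] by blast
  then have "s = {cyc vs l', cyc vs (Suc l')}" "i \<le> l' \<and> l' < j \<or> j \<le> l' \<and> l' < i + length vs"
    using l assms by auto
  then show "s \<in> ppairs (seg vs i j) \<union> ppairs (seg vs j (i + length vs))"
    unfolding ppairs_seg by blast
qed (auto simp: ppairs_seg cpairs_cyc[OF assms(1)])

lemma cycle_adj_cyc: "cycle G vs \<Longrightarrow> adj G (cyc vs l) (cyc vs (Suc l))"
proof -
  assume c: "cycle G vs"
  then have "vs \<noteq> []" by (auto simp: cycle_def)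
  then show ?thesis using c cyc_pair_in_cpairs[of vs l] unfolding cycle_cpairs_iff adj_def by blast
qed

lemma successively_seg: "cycle G vs \<Longrightarrow> successively (adj G) (seg vs i j)"
  unfolding successively_conv_nth by (auto simp: nth_seg cycle_adj_cyc)

section \<open>Curves of paths and theta graphs\<close>

text \<open>Serves to show that two paths with the same ends and no other common vertex share no
  edge: a shared edge would join the ends and be the whole of both paths.\<close>

lemma ppairs_hd_last:
  assumes "distinct p" "{hd p, last p} \<in> ppairs p" "p \<noteq> []"
  shows "length p = 2"
proof -
  obtain i where i: "Suc i < length p" "{hd p, last p} = {p ! i, p ! Suc i}"
    using assms(2) unfolding ppairs_def by blast
  have *: "hd p = p ! 0" "last p = p ! (length p - 1)" using assms(3) by (simp_all add: hd_conv_nth last_conv_nth)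
  have "p ! 0 = p ! i \<and> p ! (length p - 1) = p ! Suc i \<or> p ! 0 = p ! Suc i \<and> p ! (length p - 1) = p ! i"
    using i(2) unfolding * doubleton_eq_iff by metis
  then show ?thesis
  proof
    assume "p ! 0 = p ! i \<and> p ! (length p - 1) = p ! Suc i"
    then have "0 = i" "length p - 1 = Suc i"
      using nth_eq_iff_index_eq[OF assms(1), of 0 i] nth_eq_iff_index_eq[OF assms(1), of "length p - 1" "Suc i"] i(1) assms(3) by auto
    then show ?thesis by linarith
  next
    assume "p ! 0 = p ! Suc i \<and> p ! (length p - 1) = p ! i"
    then show ?thesis using nth_eq_iff_index_eq[OF assms(1), of 0 "Suc i"] i(1) assms(3) by auto
  qed
qed

section \<open>Drawings of paths as arcs\<close>

locale plane_graph =
  fixes G :: "('v, 'e) mgraph" and pos :: "'v \<Rightarrow> complex" and crv :: "'e \<Rightarrow> real \<Rightarrow> complex"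
  assumes simple: "simple_graph G"
    and embedding: "plane_embedding G pos crv"
begin

text \<open>A path with a single vertex has the empty drawing; hence the bound of two vertices
  wherever a drawing is to be an arc through its vertices.\<close>

definition pdraw :: "'v list \<Rightarrow> complex set" where
  "pdraw p = drawing crv {e \<in> edges G. ends G e \<in> ppairs p}"

definition gpath :: "'v list \<Rightarrow> bool" where
  "gpath p \<longleftrightarrow> distinct p \<and> successively (adj G) p \<and> set p \<subseteq> verts G"

lemma pos_inj: "inj_on pos (verts G)"
  using embedding unfolding plane_embedding_def by blast

lemma pos_eq_iff: "u \<in> verts G \<Longrightarrow> v \<in> verts G \<Longrightarrow> pos u = pos v \<longleftrightarrow> u = v"
  using pos_inj by (auto dest: inj_onD)

lemma ends_subset: "e \<in> edges G \<Longrightarrow> ends G e \<subseteq> verts G"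
  using simple unfolding simple_graph_def by blast

lemma card_ends: "e \<in> edges G \<Longrightarrow> card (ends G e) = 2"
  using simple unfolding simple_graph_def by blast

lemma edge_eqI: "e \<in> edges G \<Longrightarrow> f \<in> edges G \<Longrightarrow> ends G e = ends G f \<Longrightarrow> e = f"
  using simple unfolding simple_graph_def by (auto dest: inj_onD)

lemma adj_neq: "adj G u v \<Longrightarrow> u \<noteq> v"
  unfolding adj_def using card_ends by force

lemma adj_verts: "adj G u v \<Longrightarrow> u \<in> verts G \<and> v \<in> verts G"
  unfolding adj_def using ends_subset by blast

lemma arc_crv: "e \<in> edges G \<Longrightarrow> arc (crv e)"
  using embedding unfolding plane_embedding_def by blast

lemma crv_ends: "e \<in> edges G \<Longrightarrow> {pathstart (crv e), pathfinish (crv e)} = pos ` ends G e"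
  using embedding unfolding plane_embedding_def by blast

lemma pos_ends_in_crv: "e \<in> edges G \<Longrightarrow> v \<in> ends G e \<Longrightarrow> pos v \<in> path_image (crv e)"
proof -
  assume "e \<in> edges G" "v \<in> ends G e"
  then have "pos v \<in> {pathstart (crv e), pathfinish (crv e)}" using crv_ends by simp
  then show ?thesis by auto
qed

lemma pos_in_crv:
  assumes "e \<in> edges G" "v \<in> verts G" "pos v \<in> path_image (crv e)"
  shows "v \<in> ends G e"
proof -
  have "pos v \<in> pos ` ends G e" using embedding assms unfolding plane_embedding_def by blast
  then show ?thesis using pos_eq_iff ends_subset assms by auto
qed

lemma crv_Int: "e \<in> edges G \<Longrightarrow> f \<in> edges G \<Longrightarrow> e \<noteq> f \<Longrightarrow> path_image (crv e) \<inter> path_image (crv f) \<subseteq> pos ` (ends G e \<inter> ends G f)"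
  using embedding unfolding plane_embedding_def by blast

lemma gpath_rev: "gpath p \<Longrightarrow> gpath (rev p)"
  unfolding gpath_def by (simp flip: adj_ppairs_iff del: successively_rev)

lemma pdraw_rev [simp]: "pdraw (rev p) = pdraw p"
  unfolding pdraw_def by simp

lemma pdraw_Int:
  assumes "ppairs p \<inter> ppairs q = {}"
  shows "pdraw p \<inter> pdraw q \<subseteq> pos ` (set p \<inter> set q)"
proof
  fix x assume "x \<in> pdraw p \<inter> pdraw q"
  then obtain e f where e: "e \<in> edges G" "ends G e \<in> ppairs p" "x \<in> path_image (crv e)"
    and f: "f \<in> edges G" "ends G f \<in> ppairs q" "x \<in> path_image (crv f)"
    unfolding pdraw_def drawing_def by blast
  have "e \<noteq> f" using assms e f by blast
  then have "x \<in> pos ` (ends G e \<inter> ends G f)" using crv_Int e f by blast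
  then show "x \<in> pos ` (set p \<inter> set q)" using ppairs_subset_set e(2) f(2) by fast
qed

lemma pos_in_pdraw:
  assumes "v \<in> verts G" "pos v \<in> pdraw p"
  shows "v \<in> set p"
proof -
  obtain e where e: "e \<in> edges G" "ends G e \<in> ppairs p" "pos v \<in> path_image (crv e)"
    using assms unfolding pdraw_def drawing_def by blast
  then show ?thesis using pos_in_crv[OF e(1) assms(1) e(3)] ppairs_subset_set by fast
qed

lemma gpath_arc:
  assumes "gpath p" "length p \<ge> 2"
  obtains g where "arc g" "pathstart g = pos (hd p)" "pathfinish g = pos (last p)" "path_image g = pdraw p"
proof -
  have "\<exists>g. arc g \<and> pathstart g = pos (hd p) \<and> pathfinish g = pos (last p) \<and> path_image g = pdraw p"
    using assms
  proof (induction p)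
    case (Cons a p)
    then obtain b r where p: "p = b # r" by (cases p) auto
    have "adj G a b" using Cons.prems p unfolding gpath_def by simp
    then obtain e where e: "e \<in> edges G" "ends G e = {a, b}" unfolding adj_def by blast
    have "a \<noteq> b" using Cons.prems p unfolding gpath_def by auto
    obtain g1 where g1: "arc g1" "pathstart g1 = pos a" "pathfinish g1 = pos b" "path_image g1 = path_image (crv e)"
    proof (cases "pathstart (crv e) = pos a \<and> pathfinish (crv e) = pos b")
      case True then show ?thesis using that arc_crv[OF e(1)] by blast
    next
      case False
      then have "pathstart (crv e) = pos b \<and> pathfinish (crv e) = pos a"
        using crv_ends[OF e(1)] e(2) by (auto simp: doubleton_eq_iff)
      then show ?thesis using that[of "reversepath (crv e)"] arc_crv[OF e(1)] by (simp add: arc_reversepath)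
    qed
    have "{f \<in> edges G. ends G f = {a,b}} = {e}" using e edge_eqI by auto
    then have pd: "pdraw [a, b] = path_image (crv e)" unfolding pdraw_def drawing_def by auto
    show ?case
    proof (cases "r = []")
      case True
      then show ?thesis using g1 pd p by auto
    next
      case False
      then have "length p \<ge> 2" using p by (cases r) auto
      moreover have "gpath p" using Cons.prems(1) p unfolding gpath_def by simp
      ultimately obtain g2 where g2: "arc g2" "pathstart g2 = pos b" "pathfinish g2 = pos (last p)" "path_image g2 = pdraw p"
        using Cons.IH p by auto
      have "a \<notin> set p" using Cons.prems(1) unfolding gpath_def by simp
      then have "ppairs [a,b] \<inter> ppairs p = {}" using ppairs_subset_set[of "{a,b}" p] by auto
      then have "path_image g1 \<inter> path_image g2 \<subseteq> {pathstart g2}"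
        using pdraw_Int[of "[a,b]" p] g1 g2 pd \<open>a \<notin> set p\<close> by auto
      then have "arc (g1 +++ g2)" using arc_join g1 g2 by metis
      moreover have "path_image (g1 +++ g2) = pdraw (a # p)"
      proof -
        have "pdraw (a # p) = pdraw [a,b] \<union> pdraw p" unfolding pdraw_def drawing_def p by auto
        then show ?thesis using g1 g2 pd by (simp add: path_image_join)
      qed
      ultimately show ?thesis using g1 g2 p by (intro exI[of _ "g1 +++ g2"]) auto
    qed
  qed simp
  then show thesis using that by blast
qed

text \<open>The path without its ends is the image of the open unit interval under an arc. It is
  this part that lies on one side of a curve on which the ends themselves lie, and its closure gives
  the ends back.\<close>

lemma endless_pdraw:
  assumes "gpath p" "length p \<ge> 2"
  shows "connected (pdraw p - {pos (hd p), pos (last p)})"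
    and "pdraw p \<subseteq> closure (pdraw p - {pos (hd p), pos (last p)})"
    and "pos ` set p \<subseteq> pdraw p"
    and "compact (pdraw p)" "connected (pdraw p)"
proof -
  obtain g where g: "arc g" "pathstart g = pos (hd p)" "pathfinish g = pos (last p)" "path_image g = pdraw p"
    using gpath_arc assms by blast
  have sp: "simple_path g" using g(1) by (rule arc_imp_simple_path)
  show "connected (pdraw p - {pos (hd p), pos (last p)})"
    using connected_simple_path_endless[OF sp] g by simp
  have "g ` {0<..<1} = pdraw p - {pos (hd p), pos (last p)}" using simple_path_endless[OF sp] g by simp
  moreover have "g ` closure {0<..<1} \<subseteq> closure (g ` {0<..<1})"
    using g(1) by (intro image_closure_subset closure_subset) (auto simp: arc_def path_def)
  ultimately show "pdraw p \<subseteq> closure (pdraw p - {pos (hd p), pos (last p)})"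
    using g(4) by (simp add: path_image_def)
  show "compact (pdraw p)" "connected (pdraw p)" using g by (metis compact_arc_image, metis connected_arc_image)
  show "pos ` set p \<subseteq> pdraw p"
  proof
    fix x assume "x \<in> pos ` set p"
    then obtain i where i: "i < length p" "x = pos (p ! i)" by (auto simp: in_set_conv_nth)
    obtain j where j: "Suc j < length p" "i = j \<or> i = Suc j"
    proof (cases i)
      case 0
      then show ?thesis using that[of 0] assms(2) by simp
    next
      case (Suc k)
      then show ?thesis using that[of k] i(1) by simp
    qed
    then have "adj G (p ! j) (p ! Suc j)" using assms(1) unfolding gpath_def successively_conv_nth by blast
    then obtain e where e: "e \<in> edges G" "ends G e = {p ! j, p ! Suc j}" unfolding adj_def by blast
    then have "pos (p ! i) \<in> path_image (crv e)" using j(2) pos_ends_in_crv by blast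
    moreover have "ends G e \<in> ppairs p" using e j unfolding ppairs_def by blast
    ultimately show "x \<in> pdraw p" unfolding pdraw_def drawing_def using e i by blast
  qed
qed

text \<open>Distinct edges meet only in common vertices, and a common edge would join
  \<open>a\<close> to \<open>b\<close> and be the whole of both paths. The bound 5 excludes exactly
  the case that both paths are single edges.\<close>

lemma two_common:
  assumes "gpath r" "gpath r'" "set r \<inter> set r' = {a, b}" "hd r = a" "hd r' = a" "last r = b" "last r' = b"
    and "length r \<ge> 2" "length r' \<ge> 2" "length r + length r' \<ge> 5"
  shows "pdraw r \<inter> pdraw r' = {pos a, pos b}"
proof
  have "ppairs r \<inter> ppairs r' = {}"
  proof (rule ccontr)
    assume "ppairs r \<inter> ppairs r' \<noteq> {}"
    then obtain s where s: "s \<in> ppairs r" "s \<in> ppairs r'" by blast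
    then have "s \<subseteq> {a, b}" using ppairs_subset_set assms(3) by fast
    moreover obtain e where "e \<in> edges G" "ends G e = s"
      using s(1) assms(1) unfolding gpath_def adj_ppairs_iff[symmetric] by blast
    then obtain x y where "s = {x, y}" "x \<noteq> y" using card_ends card_2_iff by metis
    ultimately have "s = {a, b}" by auto
    then have "length r = 2" "length r' = 2" using ppairs_hd_last[of r] ppairs_hd_last[of r'] s assms unfolding gpath_def by fastforce+
    then show False using assms by linarith
  qed
  then show "pdraw r \<inter> pdraw r' \<subseteq> {pos a, pos b}" using pdraw_Int[of r r'] assms(3) by auto
  show "{pos a, pos b} \<subseteq> pdraw r \<inter> pdraw r'"
    using endless_pdraw(3)[of r] endless_pdraw(3)[of r'] assms by blast
qed

lemma Jordan_pair:
  assumes "gpath r" "gpath r'" "set r \<inter> set r' = {a, b}" "hd r = a" "hd r' = a" "last r = b" "last r' = b"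
    and "length r \<ge> 2" "length r' \<ge> 2" "length r + length r' \<ge> 5"
  obtains g where "simple_path g" "pathfinish g = pathstart g" "path_image g = pdraw r \<union> pdraw r'"
proof -
  obtain g1 where g1: "arc g1" "pathstart g1 = pos a" "pathfinish g1 = pos b" "path_image g1 = pdraw r"
    using gpath_arc assms by metis
  obtain g2 where g2: "arc g2" "pathstart g2 = pos a" "pathfinish g2 = pos b" "path_image g2 = pdraw r'"
    using gpath_arc assms by metis
  have "simple_path (g1 +++ reversepath g2)"
    using g1 g2 two_common[OF assms] by (intro simple_path_join_loop) (auto simp: arc_reversepath)
  then show thesis
    by (rule that) (use g1 g2 in \<open>auto simp: path_image_join\<close>)
qed

end

text \<open>\<open>p1\<close> and \<open>p2\<close> form a closed curve and \<open>q\<close> is a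
  chord. The bound 5 keeps \<open>p1\<close> and \<open>p2\<close> from being one and the same edge.
  A single common point with the inside suffices to place the whole chord there.\<close>

locale theta = plane_graph G pos crv
  for G :: "('v, 'e) mgraph" and pos :: "'v \<Rightarrow> complex" and crv :: "'e \<Rightarrow> real \<Rightarrow> complex" +
  fixes p1 p2 q :: "'v list" and a b :: 'v
  assumes gp: "gpath p1" "gpath p2" "gpath q"
    and hds: "hd p1 = a" "hd p2 = a" "hd q = a"
    and lasts: "last p1 = b" "last p2 = b" "last q = b"
    and len: "length p1 \<ge> 2" "length p2 \<ge> 2" "length q \<ge> 3" "length p1 + length p2 \<ge> 5"
    and ints: "set p1 \<inter> set p2 = {a, b}" "set p1 \<inter> set q = {a, b}" "set p2 \<inter> set q = {a, b}"
    and q_inside: "pdraw q \<inter> inside (pdraw p1 \<union> pdraw p2) \<noteq> {}"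
begin

lemma a_neq_b: "a \<noteq> b"
proof
  assume "a = b"
  then have "hd p1 = last p1" "distinct p1" using hds lasts gp unfolding gpath_def by auto
  then show False using len(1) by (cases p1) (auto split: if_splits)
qed

lemma pos_ab: "pos a \<noteq> pos b"
proof -
  have "a \<in> verts G" "b \<in> verts G" using ints(1) gp(1) unfolding gpath_def by auto
  then show ?thesis using pos_eq_iff a_neq_b by blast
qed

abbreviation "A \<equiv> inside (pdraw p1 \<union> pdraw q)"
abbreviation "B \<equiv> inside (pdraw p2 \<union> pdraw q)"
abbreviation "AB \<equiv> inside (pdraw p1 \<union> pdraw p2)"

text \<open>The Jordan curve theorem is applied to each of the three closed curves, and
  \<open>split_inside_simple_closed_curve\<close> to the chord.\<close>

lemma regions:
  shows "A \<noteq> {}" "open A" "connected A" "frontier A = pdraw p1 \<union> pdraw q"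
    and "B \<noteq> {}" "open B" "connected B" "frontier B = pdraw p2 \<union> pdraw q"
    and "open AB" "connected AB" "frontier AB = pdraw p1 \<union> pdraw p2"
    and "A \<inter> B = {}" and "A \<union> B \<union> (pdraw q - {pos a, pos b}) = AB"
proof -
  have l: "length p1 + length q \<ge> 5" "length p2 + length q \<ge> 5" using len by auto
  obtain g where "simple_path g" "pathfinish g = pathstart g" "path_image g = pdraw p1 \<union> pdraw q"
    using Jordan_pair[of p1 q] gp hds lasts len ints l by auto
  then show "A \<noteq> {}" "open A" "connected A" "frontier A = pdraw p1 \<union> pdraw q"
    using Jordan_inside_outside by metis+
  obtain g where "simple_path g" "pathfinish g = pathstart g" "path_image g = pdraw p2 \<union> pdraw q"
    using Jordan_pair[of p2 q] gp hds lasts len ints l by auto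
  then show "B \<noteq> {}" "open B" "connected B" "frontier B = pdraw p2 \<union> pdraw q"
    using Jordan_inside_outside by metis+
  obtain g where "simple_path g" "pathfinish g = pathstart g" "path_image g = pdraw p1 \<union> pdraw p2"
    using Jordan_pair[of p1 p2] gp hds lasts len ints by auto
  then show "open AB" "connected AB" "frontier AB = pdraw p1 \<union> pdraw p2"
    using Jordan_inside_outside by metis+
  obtain g1 where g1: "arc g1" "pathstart g1 = pos a" "pathfinish g1 = pos b" "path_image g1 = pdraw p1"
    using gpath_arc gp hds lasts len by metis
  obtain g2 where g2: "arc g2" "pathstart g2 = pos a" "pathfinish g2 = pos b" "path_image g2 = pdraw p2"
    using gpath_arc gp hds lasts len by metis
  have "length q \<ge> 2" using len by simp
  then obtain g3 where g3: "arc g3" "pathstart g3 = pos a" "pathfinish g3 = pos b" "path_image g3 = pdraw q"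
    using gpath_arc gp hds lasts by metis
  have c: "pdraw p1 \<inter> pdraw p2 = {pos a, pos b}" "pdraw p1 \<inter> pdraw q = {pos a, pos b}" "pdraw p2 \<inter> pdraw q = {pos a, pos b}"
    using two_common[of p1 p2] two_common[of p1 q] two_common[of p2 q] gp hds lasts len ints l by auto
  have "A \<inter> B = {} \<and> A \<union> B \<union> (pdraw q - {pos a, pos b}) = AB"
    by (rule split_inside_simple_closed_curve[of g1 "pos a" "pos b" g2 g3])
      (use g1 g2 g3 c q_inside pos_ab in \<open>auto simp: arc_imp_simple_path\<close>)
  then show "A \<inter> B = {}" "A \<union> B \<union> (pdraw q - {pos a, pos b}) = AB" by auto
qed

lemma pdraw_ints: "pdraw p1 \<inter> pdraw p2 = {pos a, pos b}" "pdraw p1 \<inter> pdraw q = {pos a, pos b}" "pdraw p2 \<inter> pdraw q = {pos a, pos b}"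
  using two_common[of p1 p2] two_common[of p1 q] two_common[of p2 q] gp hds lasts len ints by auto

lemma closure_A: "closure A = A \<union> (pdraw p1 \<union> pdraw q)"
  using regions(2,4) by (metis closure_Un_frontier)

lemma closure_B: "closure B = B \<union> (pdraw p2 \<union> pdraw q)"
  using regions(6,8) by (metis closure_Un_frontier)

lemma side:
  assumes X: "connected X" "X \<subseteq> AB - pdraw q"
  shows "X \<subseteq> A \<or> X \<subseteq> B"
proof -
  have "X \<subseteq> A \<union> B" using X(2) regions(13) by blast
  moreover have "A \<inter> B \<inter> X = {}" using regions(12) by blast
  ultimately have "A \<inter> X = {} \<or> B \<inter> X = {}"
    using connectedD[OF X(1) regions(2,6)] by blast
  then show ?thesis using \<open>X \<subseteq> A \<union> B\<close> by blast
qed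

text \<open>The set lies on one side of the chord. If this were \<open>B\<close>, the point
  \<open>x\<close> would be in the closure of \<open>B\<close>, that is in \<open>B\<close> or on
  \<open>p2\<close> or \<open>q\<close>; but \<open>x\<close> is on the boundary of the open region
  \<open>AB\<close>, and \<open>p1\<close> meets the other two paths only in the ends.\<close>

lemma side_A:
  assumes X: "connected X" "X \<subseteq> AB - pdraw q" and x: "x \<in> closure X" "x \<in> pdraw p1" "x \<noteq> pos a" "x \<noteq> pos b"
  shows "X \<subseteq> A"
proof (rule ccontr)
  assume "\<not> X \<subseteq> A"
  then have "closure X \<subseteq> closure B" using side[OF X] closure_mono by blast
  then have "x \<in> B \<union> (pdraw p2 \<union> pdraw q)" using x closure_B by blast
  moreover have "x \<notin> B" using x(2) regions(9,11,13) frontier_disjoint_eq by blast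
  ultimately show False using x pdraw_ints by blast
qed

lemma side_B:
  assumes X: "connected X" "X \<subseteq> AB - pdraw q" and x: "x \<in> closure X" "x \<in> pdraw p2" "x \<noteq> pos a" "x \<noteq> pos b"
  shows "X \<subseteq> B"
proof (rule ccontr)
  assume "\<not> X \<subseteq> B"
  then have "closure X \<subseteq> closure A" using side[OF X] closure_mono by blast
  then have "x \<in> A \<union> (pdraw p1 \<union> pdraw q)" using x closure_A by blast
  moreover have "x \<notin> A" using x(2) regions(9,11,13) frontier_disjoint_eq by blast
  ultimately show False using x pdraw_ints by blast
qed

text \<open>For sets that need not reach the outer curve but touch something already known to lie in
  the open region \<open>B\<close>.\<close>

lemma side_B':
  assumes X: "connected X" "X \<subseteq> AB - pdraw q" and x: "x \<in> closure X" "x \<in> B"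
  shows "X \<subseteq> B"
proof -
  have "X \<inter> B \<noteq> {}" using x regions(6) by (metis disjoint_iff open_Int_closure_eq_empty)
  then show ?thesis using side[OF X] regions(12) by blast
qed

end

section \<open>The combinatorial structure of the annuli\<close>

lemma cycle_edges_eq: "cycle_edges G vs = {e \<in> edges G. ends G e \<in> cpairs vs}"
  unfolding cycle_edges_def cpairs_def by blast

lemma cycle_curve_eq: "cycle_curve G crv vs = drawing crv {e \<in> edges G. ends G e \<in> cpairs vs}"
  unfolding cycle_curve_def cycle_edges_eq ..

text \<open>The predecessor has index \<open>l + length vs - 1\<close> because \<open>l\<close> may
  be 0. It differs from the successor since the list has at least three entries.\<close>

lemma cpairs_nbrs:
  assumes "distinct vs" "length vs \<ge> 3"
  shows "{w. {cyc vs l, w} \<in> cpairs vs} = {cyc vs (Suc l), cyc vs (l + length vs - 1)}"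
    and "cyc vs (Suc l) \<noteq> cyc vs (l + length vs - 1)"
proof -
  have ne: "vs \<noteq> []" using assms(2) by auto
  let ?m = "length vs"
  have "Suc (l + ?m - 1) = l + ?m" using assms(2) by simp
  then have bk: "cyc vs (Suc (l + ?m - 1)) = cyc vs l" by simp
  show "cyc vs (Suc l) \<noteq> cyc vs (l + ?m - 1)"
  proof
    assume e: "cyc vs (Suc l) = cyc vs (l + ?m - 1)"
    have "Suc l = l + ?m - 1" by (rule cyc_inj[OF assms(1) e]) (use assms(2) in linarith)+
    then show False using assms(2) by simp
  qed
  have key: "cyc vs (Suc i) = cyc vs (Suc l)" "cyc vs (i + ?m - 1) = cyc vs (l + ?m - 1)" if "cyc vs i = cyc vs l" for i l
  proof -
    have e: "i mod ?m = l mod ?m" using that cyc_eq_iff assms(1) ne by blast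
    then show "cyc vs (Suc i) = cyc vs (Suc l)" by (metis cyc_def mod_Suc_eq)
    have "(i + (?m - 1)) mod ?m = (l + (?m - 1)) mod ?m" using e by (metis mod_add_left_eq)
    then show "cyc vs (i + ?m - 1) = cyc vs (l + ?m - 1)" using assms(2) by (simp add: cyc_def)
  qed
  show "{w. {cyc vs l, w} \<in> cpairs vs} = {cyc vs (Suc l), cyc vs (l + ?m - 1)}"
  proof (intro equalityI subsetI)
    fix w assume "w \<in> {w. {cyc vs l, w} \<in> cpairs vs}"
    then obtain i where i: "{cyc vs l, w} = {cyc vs i, cyc vs (Suc i)}" by (auto simp: cpairs_cyc[OF ne])
    then consider "cyc vs i = cyc vs l" "w = cyc vs (Suc i)" | "cyc vs (Suc i) = cyc vs l" "w = cyc vs i"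
      unfolding doubleton_eq_iff by metis
    then show "w \<in> {cyc vs (Suc l), cyc vs (l + ?m - 1)}"
    proof cases
      case 1 then show ?thesis using key(1)[OF 1(1)] by simp
    next
      case 2
      have "cyc vs i = cyc vs (Suc i + ?m - 1)" by simp
      then show ?thesis using key(2)[OF 2(1)] 2(2) by simp
    qed
  next
    fix w assume "w \<in> {cyc vs (Suc l), cyc vs (l + ?m - 1)}"
    then show "w \<in> {w. {cyc vs l, w} \<in> cpairs vs}"
      using cyc_pair_in_cpairs[OF ne, of l] cyc_pair_in_cpairs[OF ne, of "l + ?m - 1"] bk by (auto simp: insert_commute)
  qed
qed

section \<open>Consecutive positions at which a predicate holds\<close>

definition consec :: "(nat \<Rightarrow> bool) \<Rightarrow> nat \<Rightarrow> nat \<Rightarrow> bool" where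
  "consec P i j \<longleftrightarrow> i < j \<and> P i \<and> P j \<and> (\<forall>l. i < l \<and> l < j \<longrightarrow> \<not> P l)"

lemma consec_next:
  assumes "P i" "P l" "i < l"
  obtains j where "consec P i j" "j \<le> l"
proof -
  define j where "j = (LEAST j. i < j \<and> P j)"
  have "i < j \<and> P j" unfolding j_def by (rule LeastI[of _ l]) (use assms in blast)
  moreover have "j \<le> l" unfolding j_def by (rule Least_le) (use assms in blast)
  moreover have "\<not> P x" if "i < x" "x < j" for x using not_less_Least[of x "\<lambda>j. i < j \<and> P j"] that unfolding j_def by blast
  ultimately show thesis using that assms unfolding consec_def by blast
qed

lemma consec_prev:
  assumes "P i" "P l" "i < l"
  obtains j where "consec P j l" "i \<le> j"
proof -
  define j where "j = (GREATEST j. j < l \<and> P j)"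
  have "j < l \<and> P j" unfolding j_def by (rule GreatestI_nat[of _ i l]) (use assms in auto)
  moreover have "i \<le> j" unfolding j_def by (rule Greatest_le_nat[of _ i l]) (use assms in auto)
  moreover have "\<not> P x" if "j < x" "x < l" for x using Greatest_le_nat[of "\<lambda>j. j < l \<and> P j" x l] that unfolding j_def by auto
  ultimately show thesis using that assms unfolding consec_def by blast
qed

lemma consec_around:
  assumes "P i" "P i'" "i \<le> l" "l < i'"
  obtains j j' where "consec P j j'" "i \<le> j" "j \<le> l" "l < j'" "j' \<le> i'"
proof (cases "P l")
  case True
  obtain j' where "consec P l j'" "j' \<le> i'" using consec_next[of P l i'] True assms by blast
  then show thesis using that[of l j'] assms unfolding consec_def by simp
next
  case False
  \<comment> \<open>With \<open>l\<close> added to the positions, the wanted pair consists of the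
    predecessor and the successor of \<open>l\<close>.\<close>
  define Q where "Q = (\<lambda>x. P x \<or> x = l)"
  have Q: "Q i" "Q l" "Q i'" using assms Q_def by auto
  have il: "i < l" using False assms by (cases "i = l") auto
  obtain j where j: "consec Q j l" "i \<le> j" using consec_prev[OF Q(1,2) il] by blast
  obtain j' where j': "consec Q l j'" "j' \<le> i'" using consec_next[OF Q(2,3)] assms by blast
  have "\<not> P x" if "j < x" "x < j'" for x
  proof (cases x l rule: linorder_cases)
    case less then show ?thesis using j that unfolding consec_def Q_def by blast
  next
    case equal then show ?thesis using False by simp
  next
    case greater then show ?thesis using j' that unfolding consec_def Q_def by blast
  qed
  then have "consec P j j'" using j j' unfolding consec_def Q_def by auto
  then show thesis using that j j' unfolding consec_def by simp
qed

lemma consec_unique: "consec P i j \<Longrightarrow> consec P i j' \<Longrightarrow> j = j'"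
  unfolding consec_def by (meson linorder_neqE_nat)

lemma consec_shift:
  assumes "\<And>l. P (l + m) = P l"
  shows "consec P (i + m) (j + m) = consec P i j"
proof -
  have "(\<forall>l. i + m < l \<and> l < j + m \<longrightarrow> \<not> P l) = (\<forall>l. i < l \<and> l < j \<longrightarrow> \<not> P l)"
  proof (intro iffI allI impI)
    fix l assume a: "\<forall>l. i + m < l \<and> l < j + m \<longrightarrow> \<not> P l" "i < l \<and> l < j"
    then show "\<not> P l" using assms[of l] spec[OF a(1), of "l + m"] by simp
  next
    fix l assume a: "\<forall>l. i < l \<and> l < j \<longrightarrow> \<not> P l" "i + m < l \<and> l < j + m"
    then have "i < l - m \<and> l - m < j" by linarith
    then have "\<not> P (l - m)" using a(1) by blast
    then show "\<not> P l" using assms[of "l - m"] a by simp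
  qed
  then show ?thesis unfolding consec_def using assms by simp
qed

section \<open>Neighbours of a vertex and spokes of an annulus\<close>

locale annular =
  fixes G :: "('v, 'e) mgraph" and pos :: "'v \<Rightarrow> complex" and crv :: "'e \<Rightarrow> real \<Rightarrow> complex"
    and C :: "nat \<Rightarrow> 'v list" and n :: nat
  assumes adb: "adb G pos crv C n"

sublocale annular \<subseteq> plane_graph G pos crv
  using adb unfolding adb_def annular_embedding_def barnette_def by unfold_locales auto

context annular
begin

abbreviation c :: "nat \<Rightarrow> nat \<Rightarrow> 'v" where "c k \<equiv> cyc (C k)"
abbreviation m :: "nat \<Rightarrow> nat" where "m k \<equiv> length (C k)"

lemma barnette: "barnette G" and annular: "annular_embedding G pos crv C n"
  using adb unfolding adb_def by auto

lemma annular_parts: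
  "\<forall>k\<le>n. cycle G (C k)"
  "\<forall>j\<le>n. \<forall>k\<le>n. j \<noteq> k \<longrightarrow> set (C j) \<inter> set (C k) = {}"
  "\<forall>k\<in>{1..n}. cycle_curve G crv (C (k - 1)) \<subseteq> inside (cycle_curve G crv (C k))"
  "verts G = (\<Union>k\<le>n. set (C k))"
  "edges G = (\<Union>k\<le>n. cycle_edges G (C k)) \<union> (\<Union>k\<in>{1..n}. annulus_edges G C k)"
  by (insert annular, unfold annular_embedding_def, (elim conjE, assumption)+)

lemma cycleC: "k \<le> n \<Longrightarrow> cycle G (C k)"
  using annular_parts(1) by blast

lemma mC: "k \<le> n \<Longrightarrow> m k \<ge> 3" and distinctC: "k \<le> n \<Longrightarrow> distinct (C k)"
  and vertsC: "k \<le> n \<Longrightarrow> set (C k) \<subseteq> verts G"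
  using cycleC unfolding cycle_def by auto

lemma neC: "k \<le> n \<Longrightarrow> C k \<noteq> []"
  using mC by fastforce

lemma disjC: "j \<le> n \<Longrightarrow> k \<le> n \<Longrightarrow> v \<in> set (C j) \<Longrightarrow> v \<in> set (C k) \<Longrightarrow> j = k"
  using annular_parts(2) by blast

lemma disjC_pred: "1 \<le> k \<Longrightarrow> k \<le> n \<Longrightarrow> v \<in> set (C (k - 1)) \<Longrightarrow> v \<notin> set (C k)"
  using disjC[of "k - 1" k v] by linarith

lemma verts_eq: "verts G = (\<Union>k\<le>n. set (C k))"
  by (rule annular_parts(4))

lemma adj_cpairs: "k \<le> n \<Longrightarrow> {u, v} \<in> cpairs (C k) \<Longrightarrow> adj G u v"
  using cycleC[of k] unfolding cycle_cpairs_iff adj_def by blast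

lemma cpairs_sub: "s \<in> cpairs vs \<Longrightarrow> s \<subseteq> set vs"
  unfolding cpairs_def using mod_less_divisor[of "length vs"] by (auto intro!: nth_mem mod_less_divisor)

lemma edge_cases:
  assumes "e \<in> edges G"
  obtains (cyc) k where "k \<le> n" "ends G e \<in> cpairs (C k)"
  | (spoke) k u v where "1 \<le> k" "k \<le> n" "u \<in> set (C (k - 1))" "v \<in> set (C k)" "ends G e = {u, v}"
proof -
  from annular_parts(5) consider k where "k \<le> n" "e \<in> cycle_edges G (C k)" | k where "k \<in> {1..n}" "e \<in> annulus_edges G C k"
    using assms by blast
  then show thesis
    by cases (use cyc spoke in \<open>auto simp: cycle_edges_eq annulus_edges_def\<close>)
qed

lemma adj_cases:
  assumes "adj G u v" "u \<in> set (C k)" "k \<le> n"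
  obtains "v \<in> set (C k)" "{u, v} \<in> cpairs (C k)"
  | "1 \<le> k" "v \<in> set (C (k - 1))" | "k < n" "v \<in> set (C (Suc k))"
proof -
  obtain e where e: "e \<in> edges G" "ends G e = {u, v}" using assms unfolding adj_def by blast
  from e(1) show thesis
  proof (cases rule: edge_cases)
    case (cyc j)
    then have "{u, v} \<subseteq> set (C j)" using cpairs_sub e by metis
    then have "j = k" using disjC[of j k u] cyc assms by auto
    then show ?thesis using that(1) cyc e \<open>{u, v} \<subseteq> set (C j)\<close> by auto
  next
    case (spoke j a b)
    then consider "u = a" "v = b" | "u = b" "v = a" using e by (auto simp: doubleton_eq_iff)
    then show ?thesis
    proof cases
      case 1
      then have "j - 1 = k" using disjC[of "j - 1" k u] spoke assms by auto
      then show ?thesis using that(3) spoke 1 by auto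
    next
      case 2
      then have "j = k" using disjC[of j k u] spoke assms by auto
      then show ?thesis using that(2) spoke 2 by auto
    qed
  qed
qed

lemma vdegree_eq: "vdegree G v = card {w. adj G v w}"
proof -
  have "ends G e \<noteq> {v}" if "e \<in> edges G" for e using card_ends[OF that] by auto
  then have "card {e \<in> edges G. ends G e = {v}} = 0" by (metis (mono_tags, lifting) card.empty empty_Collect_eq)
  moreover have "card {e \<in> edges G. v \<in> ends G e} = card (ends G ` {e \<in> edges G. v \<in> ends G e})"
  proof (rule card_image[symmetric], rule inj_on_subset)
    show "inj_on (ends G) (edges G)" using simple unfolding simple_graph_def by blast
  qed blast
  moreover have "ends G ` {e \<in> edges G. v \<in> ends G e} = (\<lambda>w. {v, w}) ` {w. adj G v w}"
  proof (intro equalityI subsetI)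
    fix s assume "s \<in> ends G ` {e \<in> edges G. v \<in> ends G e}"
    then obtain e where e: "e \<in> edges G" "v \<in> ends G e" "s = ends G e" by blast
    obtain x y where "ends G e = {x, y}" using card_ends[OF e(1)] by (auto simp: card_2_iff)
    then obtain w where "s = {v, w}" using e by (auto simp: insert_commute)
    then show "s \<in> (\<lambda>w. {v, w}) ` {w. adj G v w}" using e unfolding adj_def by auto
  qed (auto simp: adj_def)
  moreover have "inj_on (\<lambda>w. {v, w}) {w. adj G v w}" by (auto simp: inj_on_def doubleton_eq_iff)
  ultimately show ?thesis unfolding vdegree_def by (simp add: card_image)
qed

lemma deg3: "v \<in> verts G \<Longrightarrow> card {w. adj G v w} = 3"
  using barnette vdegree_eq unfolding barnette_def by metis

text \<open>Two of the three neighbours stand next to \<open>v\<close> on its cycle. Every edge with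
  both ends on \<open>C k\<close> is an edge of that cycle, so exactly one neighbour
  remains.\<close>

lemma third_neighbour:
  assumes "k \<le> n" "v \<in> set (C k)"
  shows "\<exists>!w. adj G v w \<and> w \<notin> set (C k)"
proof -
  obtain l where l: "v = c k l" using set_cyc_window[OF neC[OF assms(1)] assms(2)] by metis
  let ?N = "{w. {v, w} \<in> cpairs (C k)}"
  have N: "card ?N = 2"
    using cpairs_nbrs[OF distinctC[OF assms(1)] mC[OF assms(1)], of l] unfolding l by simp
  have sub: "?N \<subseteq> {w. adj G v w}" using adj_cpairs assms by blast
  have eq: "?N = {w. adj G v w \<and> w \<in> set (C k)}"
  proof (intro equalityI subsetI CollectI conjI)
    fix w assume "w \<in> {w. adj G v w \<and> w \<in> set (C k)}"
    then have w: "adj G v w" "w \<in> set (C k)" by auto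
    show "{v, w} \<in> cpairs (C k)"
    proof (rule adj_cases[OF w(1) assms(2,1)])
      assume "1 \<le> k" "w \<in> set (C (k - 1))"
      then show ?thesis using disjC_pred w(2) assms(1) by blast
    next
      assume "k < n" "w \<in> set (C (Suc k))"
      then show ?thesis using disjC[of k "Suc k" w] w(2) assms(1) by simp
    qed
  qed (use sub cpairs_sub in \<open>blast+\<close>)
  have "v \<in> verts G" using vertsC assms by blast
  then have "card {w. adj G v w} = 3" by (rule deg3)
  moreover have "{w. adj G v w} - ?N = {w. adj G v w \<and> w \<notin> set (C k)}" unfolding eq by blast
  moreover have "finite {w. adj G v w}" using calculation(1) card.infinite by fastforce
  ultimately have "card {w. adj G v w \<and> w \<notin> set (C k)} = 1"
    using N sub card_Diff_subset[of ?N "{w. adj G v w}"] finite_subset[of ?N "{w. adj G v w}"] by simp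
  then obtain w where "{w. adj G v w \<and> w \<notin> set (C k)} = {w}" by (auto simp: card_1_singleton_iff)
  then show ?thesis by (intro ex1I[of _ w]) blast+
qed

text \<open>The end on the outer cycle comes first. A vertex of \<open>C k\<close> is called
  \<open>inn\<close> if its third edge goes inward, into annulus \<open>k\<close>, and
  \<open>out\<close> if it goes outward, into annulus \<open>k + 1\<close>.\<close>

definition spoke :: "nat \<Rightarrow> 'v \<Rightarrow> 'v \<Rightarrow> bool" where
  "spoke k u z \<longleftrightarrow> 1 \<le> k \<and> k \<le> n \<and> u \<in> set (C k) \<and> z \<in> set (C (k - 1)) \<and> adj G u z"

definition inn :: "nat \<Rightarrow> 'v \<Rightarrow> bool" where
  "inn k u \<longleftrightarrow> (\<exists>z. spoke k u z)"

definition out :: "nat \<Rightarrow> 'v \<Rightarrow> bool" where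
  "out k z \<longleftrightarrow> (\<exists>u. spoke (Suc k) u z)"

lemma spokeD:
  assumes "spoke k u z"
  shows "1 \<le> k" "k \<le> n" "u \<in> set (C k)" "z \<in> set (C (k - 1))" "adj G u z" "adj G z u" "u \<notin> set (C (k - 1))" "z \<notin> set (C k)"
proof -
  show *: "1 \<le> k" "k \<le> n" "u \<in> set (C k)" "z \<in> set (C (k - 1))" "adj G u z" using assms unfolding spoke_def by auto
  show "adj G z u" using * adj_sym by metis
  show "u \<notin> set (C (k - 1))" "z \<notin> set (C k)" using disjC_pred * by blast+
qed

lemma spoke_fun1: "spoke k u z \<Longrightarrow> spoke k u z' \<Longrightarrow> z = z'"
proof -
  assume a: "spoke k u z" "spoke k u z'"
  then show ?thesis using third_neighbour[of k u] spokeD[OF a(1)] spokeD[OF a(2)] by blast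
qed

lemma spoke_fun2: "spoke k u z \<Longrightarrow> spoke k u' z \<Longrightarrow> u = u'"
proof -
  assume a: "spoke k u z" "spoke k u' z"
  have "k - 1 \<le> n" using spokeD(2)[OF a(1)] by simp
  then show ?thesis using third_neighbour[of "k - 1" z] spokeD[OF a(1)] spokeD[OF a(2)] by blast
qed

text \<open>The unique third neighbour lies on exactly one of the two adjacent cycles.\<close>

lemma inn_iff_not_out:
  assumes "k \<le> n" "v \<in> set (C k)"
  shows "inn k v \<longleftrightarrow> \<not> out k v"
proof -
  obtain w where w: "adj G v w" "w \<notin> set (C k)" "\<And>w'. adj G v w' \<and> w' \<notin> set (C k) \<Longrightarrow> w' = w"
    using third_neighbour[OF assms] by blast
  show ?thesis
  proof (rule adj_cases[OF w(1) assms(2,1)])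
    assume a: "1 \<le> k" "w \<in> set (C (k - 1))"
    have "inn k v" unfolding inn_def spoke_def using a w assms by blast
    moreover have "\<not> out k v"
    proof
      assume "out k v"
      then obtain u where u: "spoke (Suc k) u v" unfolding out_def by blast
      then have "u = w" using w(3)[of u] spokeD[OF u] by (simp)
      then show False using disjC[of "Suc k" "k - 1" u] spokeD(2,3)[OF u] a by (cases k) auto
    qed
    ultimately show ?thesis by blast
  next
    assume a: "k < n" "w \<in> set (C (Suc k))"
    have "out k v" unfolding out_def spoke_def using a w assms adj_sym by (metis Suc_le_eq diff_Suc_1 le_add1 plus_1_eq_Suc)
    moreover have "\<not> inn k v"
    proof
      assume "inn k v"
      then obtain u where u: "spoke k v u" unfolding inn_def by blast
      then have "u = w" using w(3)[of u] spokeD[OF u] by (simp)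
      then show False using disjC[of "Suc k" "k - 1" u] spokeD(1,2,4)[OF u] a by (cases k) auto
    qed
    ultimately show ?thesis by blast
  qed (use w in blast)
qed

lemma innD: "inn k u \<Longrightarrow> 1 \<le> k \<and> k \<le> n \<and> u \<in> set (C k)"
  unfolding inn_def spoke_def by blast

lemma outD: "out k z \<Longrightarrow> k < n \<and> z \<in> set (C k)"
  unfolding out_def spoke_def by auto

text \<open>The \<open>inn\<close> vertices of \<open>C k\<close> separate \<open>C 0\<close> to
  \<open>C (k - 1)\<close> from the rest of the graph. If there were fewer than three, some vertex
  of \<open>C k\<close> would remain outside this set and, by 3-connectedness, be reachable from the
  inner cycles; but no path leaves them without using an \<open>inn\<close> vertex.\<close>

lemma inn_card:
  assumes "1 \<le> k" "k \<le> n"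
  shows "card {u. inn k u} \<ge> 3"
proof (rule ccontr)
  let ?S = "{u. inn k u}"
  assume "\<not> card ?S \<ge> 3"
  moreover have "?S \<subseteq> verts G" using innD vertsC by blast
  ultimately have ic: "induced_connected G (verts G - ?S)"
    using barnette unfolding barnette_def three_connected_def by auto
  let ?L = "\<Union>j<k. set (C j)"
  have "C (k - 1) \<noteq> []" using neC assms by simp
  then obtain a where a: "a \<in> set (C (k - 1))" using hd_in_set by blast
  have "\<not> set (C k) \<subseteq> ?S"
  proof
    assume "set (C k) \<subseteq> ?S"
    then have "set (C k) = ?S" using innD by blast
    moreover have "card (set (C k)) \<ge> 3" using mC[of k] distinct_card[OF distinctC[of k]] assms by simp
    ultimately show False using \<open>\<not> card ?S \<ge> 3\<close> by simp
  qed
  then obtain b where b: "b \<in> set (C k)" "b \<notin> ?S" by blast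
  have "k - 1 \<le> n" using assms by simp
  then have av: "a \<in> verts G - ?S" using a vertsC innD[of k a] disjC_pred assms by blast
  have bv: "b \<in> verts G - ?S" using b vertsC assms by auto
  let ?R = "{(x, y). x \<in> verts G - ?S \<and> y \<in> verts G - ?S \<and> adj G x y}"
  have "(a, b) \<in> ?R\<^sup>*" using ic av bv unfolding induced_connected_def by blast
  then have "b \<in> ?L"
  proof (induction rule: rtrancl_induct)
    case base show ?case using a assms by (auto intro!: bexI[of _ "k-1"])
  next
    case (step x y)
    then obtain j where j: "j < k" "x \<in> set (C j)" by blast
    have xy: "adj G x y" "y \<notin> ?S" using step.hyps by auto
    have "j \<le> n" using j assms by simp
    show ?case
    proof (rule adj_cases[OF xy(1) j(2) \<open>j \<le> n\<close>])
      assume *: "j < n" "y \<in> set (C (Suc j))"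
      show ?thesis
      proof (cases "Suc j = k")
        case True
        then have "spoke k y x" unfolding spoke_def using * j xy assms adj_sym[of G x y] by auto
        then show ?thesis using xy(2) unfolding inn_def by blast
      next
        case False
        then have "Suc j < k" using j by simp
        then show ?thesis using * by blast
      qed
    next
      assume "1 \<le> j" "y \<in> set (C (j - 1))"
      moreover from this have "j - 1 < k" using j by simp
      ultimately show ?thesis by blast
    qed (use j in blast)
  qed
  then obtain j where "j < k" "b \<in> set (C j)" by blast
  then show False using b disjC[of j k b] assms by simp
qed

end

section \<open>Crossing chords\<close>

context plane_graph
begin

lemma pdraw_Cons: "p \<noteq> [] \<Longrightarrow> pdraw (a # p) = pdraw [a, hd p] \<union> pdraw p"
  unfolding pdraw_def drawing_def by (cases p) auto

lemma pdraw_snoc: "p \<noteq> [] \<Longrightarrow> pdraw (p @ [b]) = pdraw p \<union> pdraw [last p, b]"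
  unfolding pdraw_def drawing_def by (auto simp: ppairs_append)

lemma pdraw_edge:
  assumes "e \<in> edges G" "ends G e = {a, b}"
  shows "pdraw [a, b] = path_image (crv e)"
proof -
  have "{f \<in> edges G. ends G f = {a,b}} = {e}" using assms edge_eqI by auto
  then show ?thesis unfolding pdraw_def drawing_def by auto
qed

lemma pdraw_disjoint:
  assumes "gpath p" "set p \<inter> set q = {}"
  shows "pdraw p \<inter> pdraw q = {}"
proof -
  have "s \<noteq> {}" if "s \<in> ppairs p" for s using that unfolding ppairs_def by blast
  then have "ppairs p \<inter> ppairs q = {}" using ppairs_subset_set assms(2) by fast
  then show ?thesis using pdraw_Int assms(2) by fastforce
qed

end

context annular
begin

abbreviation "crvC k \<equiv> cycle_curve G crv (C k)"

lemma gpath_seg: "k \<le> n \<Longrightarrow> j < i + m k \<Longrightarrow> gpath (seg (C k) i j)"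
proof -
  assume a: "k \<le> n" "j < i + m k"
  have "set (seg (C k) i j) \<subseteq> verts G" using vertsC[OF a(1)] neC[OF a(1)] by (auto simp: set_seg)
  then show ?thesis unfolding gpath_def
    using distinct_seg[OF distinctC[OF a(1)] a(2)] successively_seg[OF cycleC[OF a(1)]] by blast
qed

lemma set_seg_C: "k \<le> n \<Longrightarrow> set (seg (C k) i j) \<subseteq> set (C k)"
  using neC by (auto simp: set_seg)

lemma crvC_split:
  assumes "k \<le> n" "i \<le> j" "j \<le> i + m k"
  shows "crvC k = pdraw (seg (C k) i j) \<union> pdraw (seg (C k) j (i + m k))"
  unfolding cycle_curve_eq pdraw_def drawing_def cpairs_split[OF neC[OF assms(1)] assms(2,3)] by blast

lemma crvC_Jordan:
  assumes "k \<le> n"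
  shows "open (inside (crvC k))" "connected (inside (crvC k))" "frontier (inside (crvC k)) = crvC k"
    "compact (crvC k)" "connected (crvC k)"
proof -
  let ?p = "seg (C k) 0 1" let ?q = "rev (seg (C k) 1 (0 + m k))"
  have m3: "m k \<ge> 3" using mC assms by blast
  have s: "set ?p \<inter> set ?q = {c k 0, c k 1}"
  proof
    show "set ?p \<inter> set ?q \<subseteq> {c k 0, c k 1}" by (auto simp: set_seg atLeastAtMost_insertL le_Suc_eq)
    have "c k 0 = c k (m k)" using cyc_add_length[of "C k" 0] by simp
    then have "c k 0 \<in> c k ` {1..m k}" using m3 by auto
    then show "{c k 0, c k 1} \<subseteq> set ?p \<inter> set ?q" using m3 by (auto simp: set_seg)
  qed
  have l: "last ?q = c k 1" "hd ?q = c k 0" using m3 cyc_add_length[of "C k" 0] by (auto simp: last_rev hd_rev)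
  obtain g where g: "simple_path g" "pathfinish g = pathstart g" "path_image g = pdraw ?p \<union> pdraw ?q"
    using Jordan_pair[of ?p ?q "c k 0" "c k 1"] gpath_seg gpath_rev assms m3 s l by auto
  have e: "path_image g = crvC k" using g(3) crvC_split[of k 0 1] assms m3 by simp
  show "open (inside (crvC k))" "connected (inside (crvC k))" "frontier (inside (crvC k)) = crvC k"
    using Jordan_inside_outside[OF g(1,2)] unfolding e by auto
  show "compact (crvC k)" "connected (crvC k)"
    using g(1) compact_simple_path_image connected_simple_path_image unfolding e[symmetric] by auto
qed

lemma crvC_inside: "1 \<le> k \<Longrightarrow> k \<le> n \<Longrightarrow> crvC (k - 1) \<subseteq> inside (crvC k)"
  using annular_parts(3) by simp

lemma inside_crvC_disjoint: "inside (crvC k) \<inter> crvC k = {}"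
  using inside_no_overlap by blast

lemma inside_subset_inside:
  assumes "1 \<le> k" "k \<le> n" shows "inside (crvC (k - 1)) \<subseteq> inside (crvC k)"
proof (rule inside_inside_compact_connected)
  have "k - 1 \<le> n" using assms by simp
  then show "closed (crvC (k - 1))" using crvC_Jordan compact_imp_closed by blast
  show "compact (crvC k)" "connected (crvC k)" using crvC_Jordan assms by blast+
  show "crvC (k - 1) \<subseteq> inside (crvC k)" using crvC_inside assms by blast
qed

lemma pos_in_crvC: "k \<le> n \<Longrightarrow> v \<in> set (C k) \<Longrightarrow> pos v \<in> crvC k"
proof -
  assume k: "k \<le> n" and v: "v \<in> set (C k)"
  obtain l where l: "v = c k l" using set_cyc_window[OF neC[OF k] v] by metis
  have "gpath (seg (C k) l (Suc l))" using gpath_seg k mC[OF k] by simp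
  then have "pos v \<in> pdraw (seg (C k) l (Suc l))" using endless_pdraw(3)[of "seg (C k) l (Suc l)"] by (auto simp: l set_seg)
  then show ?thesis using crvC_split[of k l "Suc l"] k mC[OF k] by auto
qed

lemma spoke_edge:
  assumes "spoke k u z"
  obtains e where "e \<in> edges G" "ends G e = {u, z}" "pdraw [u, z] = path_image (crv e)" "e \<in> annulus_edges G C k"
proof -
  obtain e where e: "e \<in> edges G" "ends G e = {u, z}" using spokeD(5)[OF assms] unfolding adj_def by blast
  moreover have "e \<in> annulus_edges G C k" unfolding annulus_edges_def using e spokeD[OF assms] by (auto simp: insert_commute)
  ultimately show thesis using that pdraw_edge by blast
qed

lemma spoke_gpath: "spoke k u z \<Longrightarrow> gpath [u, z]"
proof -
  assume "spoke k u z"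
  then have "adj G u z" by (rule spokeD(5))
  then show ?thesis unfolding gpath_def using adj_neq adj_verts by auto
qed

lemma spoke_Int_crvC:
  assumes "spoke k u z"
  shows "pdraw [u, z] \<inter> crvC k \<subseteq> {pos u}" "pdraw [u, z] \<inter> crvC (k - 1) \<subseteq> {pos z}"
proof -
  obtain e where e: "e \<in> edges G" "ends G e = {u, z}" "pdraw [u, z] = path_image (crv e)"
    using spoke_edge[OF assms] by metis
  have *: "pdraw [u, z] \<inter> crvC j \<subseteq> pos ` (set (C j) \<inter> {u, z})" if "u \<notin> set (C j) \<or> z \<notin> set (C j)" for j
  proof
    fix x assume x: "x \<in> pdraw [u, z] \<inter> crvC j"
    then obtain f where f: "f \<in> edges G" "ends G f \<in> cpairs (C j)" "x \<in> path_image (crv f)"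
      unfolding cycle_curve_eq drawing_def by blast
    then have s: "ends G f \<subseteq> set (C j)" using cpairs_sub by blast
    then have "e \<noteq> f" using e that by auto
    then have "x \<in> pos ` (ends G e \<inter> ends G f)" using crv_Int[OF e(1) f(1)] x f e by blast
    then show "x \<in> pos ` (set (C j) \<inter> {u, z})" using s e by blast
  qed
  show "pdraw [u, z] \<inter> crvC k \<subseteq> {pos u}" using *[of k] spokeD[OF assms] by blast
  show "pdraw [u, z] \<inter> crvC (k - 1) \<subseteq> {pos z}" using *[of "k - 1"] spokeD[OF assms] by blast
qed

text \<open>Covers the removal of one end as well as of both, since a set between a connected set
  and its closure is connected.\<close>

lemma endless_plus:
  assumes "gpath p" "length p \<ge> 2" "pdraw p - {pos (hd p), pos (last p)} \<subseteq> X" "X \<subseteq> pdraw p"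
  shows "connected X" "pdraw p \<subseteq> closure X"
proof -
  have X: "X \<subseteq> closure (pdraw p - {pos (hd p), pos (last p)})" using assms(4) endless_pdraw(2)[OF assms(1,2)] by blast
  show "connected X"
    using connected_intermediate_closure[OF endless_pdraw(1)[OF assms(1,2)] assms(3) X] .
  show "pdraw p \<subseteq> closure X"
    using closure_mono[OF assms(3)] endless_pdraw(2)[OF assms(1,2)] by blast
qed

lemma pos_vs_inside:
  assumes "spoke k u z"
  shows "pos z \<in> inside (crvC k)" "pos u \<notin> inside (crvC k)" "pos u \<notin> inside (crvC (k - 1))"
proof -
  note s = spokeD[OF assms]
  have "k - 1 \<le> n" using s by simp
  then have "pos z \<in> crvC (k - 1)" using pos_in_crvC s by blast
  then show "pos z \<in> inside (crvC k)" using crvC_inside s by blast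
  show "pos u \<notin> inside (crvC k)" using pos_in_crvC[of k u] s inside_crvC_disjoint by blast
  then show "pos u \<notin> inside (crvC (k - 1))" using inside_subset_inside s by blast
qed

text \<open>The inner end is inside \<open>C k\<close>. From there the spoke cannot leave without
  meeting \<open>C k\<close>, which it does only in \<open>u\<close>.\<close>

lemma spoke_inside:
  assumes "spoke k u z"
  shows "pdraw [u, z] - {pos u} \<subseteq> inside (crvC k)"
proof (rule ccontr)
  note s = spokeD[OF assms]
  let ?X = "pdraw [u, z] - {pos u}"
  assume "\<not> ?X \<subseteq> inside (crvC k)"
  moreover have "connected ?X" using endless_plus(1)[OF spoke_gpath[OF assms], of ?X] by auto
  moreover have "pos z \<in> ?X \<inter> inside (crvC k)"
    using endless_pdraw(3)[OF spoke_gpath[OF assms]] pos_vs_inside[OF assms] by auto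
  ultimately have "?X \<inter> frontier (inside (crvC k)) \<noteq> {}" using connected_Int_frontier by blast
  then show False using crvC_Jordan(3)[of k] s spoke_Int_crvC(1)[OF assms] by blast
qed

text \<open>The same argument from the other end: \<open>u\<close> is outside
  \<open>C (k - 1)\<close>, and the spoke meets that curve only in \<open>z\<close>.\<close>

lemma spoke_not_inner:
  assumes "spoke k u z"
  shows "pdraw [u, z] \<inter> inside (crvC (k - 1)) = {}"
proof (rule ccontr)
  note s = spokeD[OF assms]
  let ?X = "pdraw [u, z] - {pos z}"
  have k: "k - 1 \<le> n" using s by simp
  assume "pdraw [u, z] \<inter> inside (crvC (k - 1)) \<noteq> {}"
  moreover have "pos z \<notin> inside (crvC (k - 1))" using pos_in_crvC[OF k] s inside_crvC_disjoint by blast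
  ultimately have "?X \<inter> inside (crvC (k - 1)) \<noteq> {}" by blast
  moreover have "connected ?X" using endless_plus(1)[OF spoke_gpath[OF assms], of ?X] by auto
  moreover have "pos u \<in> ?X"
    using endless_pdraw(3)[OF spoke_gpath[OF assms]] s(5) pos_eq_iff adj_verts adj_neq by fastforce
  ultimately have "?X \<inter> frontier (inside (crvC (k - 1))) \<noteq> {}"
    using connected_Int_frontier[of ?X "inside (crvC (k - 1))"] pos_vs_inside(3)[OF assms] by blast
  then show False using crvC_Jordan(3)[OF k] spoke_Int_crvC(2)[OF assms] by blast
qed

section \<open>Chords of \<open>C k\<close> made of two spokes and an arc of the previous
  cycle\<close>

definition arcin :: "nat \<Rightarrow> 'v list \<Rightarrow> bool" where
  "arcin k q \<longleftrightarrow> k \<le> n \<and> q \<noteq> [] \<and> gpath q \<and> set q \<subseteq> set (C k) \<and> ppairs q \<subseteq> cpairs (C k)"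

lemma arcin_seg: "k \<le> n \<Longrightarrow> i \<le> j \<Longrightarrow> j < i + m k \<Longrightarrow> arcin k (seg (C k) i j)"
  unfolding arcin_def using gpath_seg set_seg_C cpairs_cyc[OF neC] by (auto simp: ppairs_seg)

lemma arcin_rev: "arcin k q \<Longrightarrow> arcin k (rev q)"
  unfolding arcin_def using gpath_rev by auto

lemma arcin_crvC: "arcin k q \<Longrightarrow> pdraw q \<subseteq> crvC k"
  unfolding arcin_def cycle_curve_eq pdraw_def drawing_def by blast

lemma chord_gpath:
  assumes "arcin (k - 1) q" "spoke k u (hd q)" "spoke k v (last q)" "u \<noteq> v"
  shows "gpath (u # q @ [v])"
proof -
  have "u \<notin> set q" "v \<notin> set q" using spokeD(7)[OF assms(2)] spokeD(7)[OF assms(3)] assms(1) unfolding arcin_def by auto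
  moreover have "adj G u (hd q)" "adj G (last q) v" using spokeD(5)[OF assms(2)] spokeD(6)[OF assms(3)] by auto
  ultimately show ?thesis using assms(1,4) adj_verts unfolding gpath_def arcin_def
    by (auto simp: successively_append_iff successively_Cons)
qed

lemma chord_pdraw:
  assumes "arcin (k - 1) q"
  shows "pdraw (u # q @ [v]) = pdraw [u, hd q] \<union> pdraw q \<union> pdraw [v, last q]"
proof -
  have "pdraw [v, last q] = pdraw [last q, v]" using pdraw_rev[of "[v, last q]"] by simp
  moreover have q: "q \<noteq> []" using assms unfolding arcin_def by blast
  ultimately show ?thesis using pdraw_Cons[of "q @ [v]" u] pdraw_snoc[OF q, of v] by (simp add: Un_assoc)
qed

lemma chord_inside:
  assumes "arcin (k - 1) q" "spoke k u (hd q)" "spoke k v (last q)"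
  shows "pdraw (u # q @ [v]) - {pos u, pos v} \<subseteq> inside (crvC k)"
proof -
  have "pdraw q \<subseteq> inside (crvC k)" using arcin_crvC[OF assms(1)] crvC_inside[of k] spokeD[OF assms(2)] by blast
  then show ?thesis unfolding chord_pdraw[OF assms(1)] using spoke_inside[OF assms(2)] spoke_inside[OF assms(3)] by blast
qed

text \<open>The second side goes from \<open>j\<close> to the next copy \<open>i + m k\<close> of
  \<open>i\<close>; it is reversed because the three paths of a theta graph have to start at the
  same end.\<close>

lemma chord_theta:
  assumes "arcin (k - 1) q" "spoke k (c k i) (hd q)" "spoke k (c k j) (last q)" "i < j" "j < i + m k"
  shows "theta G pos crv (seg (C k) i j) (rev (seg (C k) j (i + m k))) (c k i # q @ [c k j]) (c k i) (c k j)"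
    and "inside (pdraw (seg (C k) i j) \<union> pdraw (rev (seg (C k) j (i + m k)))) = inside (crvC k)"
proof -
  note s = spokeD[OF assms(2)]
  have ne: "c k i \<noteq> c k j" using cyc_inj[OF distinctC[OF s(2)], of i j] assms by auto
  have qC: "set q \<inter> set (C k) = {}" using assms(1) disjC_pred[of k] s unfolding arcin_def by auto
  show e: "inside (pdraw (seg (C k) i j) \<union> pdraw (rev (seg (C k) j (i + m k)))) = inside (crvC k)"
    using crvC_split[of k i j] s assms by simp
  have sets: "set (seg (C k) i j) \<inter> set (rev (seg (C k) j (i + m k))) = {c k i, c k j}"
  proof
    show "set (seg (C k) i j) \<inter> set (rev (seg (C k) j (i + m k))) \<subseteq> {c k i, c k j}"
    proof
      fix x assume "x \<in> set (seg (C k) i j) \<inter> set (rev (seg (C k) j (i + m k)))"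
      then obtain l l' where l: "x = c k l" "i \<le> l" "l \<le> j" and l': "x = c k l'" "j \<le> l'" "l' \<le> i + m k"
        unfolding set_rev set_seg by (meson IntE atLeastAtMost_iff imageE)
      show "x \<in> {c k i, c k j}"
      proof (cases "l' < l + m k")
        case True
        then have "l = l'" using cyc_inj[OF distinctC[OF s(2)], of l l'] l l' by auto
        then show ?thesis using l l' by auto
      next
        case False
        then have "l = i" using l l' by linarith
        then show ?thesis using l by auto
      qed
    qed
    have "c k (i + m k) \<in> c k ` {j..i + m k}" using assms(5) by (intro imageI) auto
    then have "c k i \<in> c k ` {j..i + m k}" by simp
    then show "{c k i, c k j} \<subseteq> set (seg (C k) i j) \<inter> set (rev (seg (C k) j (i + m k)))"
      using assms(4,5) by (auto simp: set_seg)
  qed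
  show "theta G pos crv (seg (C k) i j) (rev (seg (C k) j (i + m k))) (c k i # q @ [c k j]) (c k i) (c k j)"
  proof
    show "gpath (seg (C k) i j)" using gpath_seg s assms by blast
    show "gpath (rev (seg (C k) j (i + m k)))" using gpath_seg[of k "i + m k" j] gpath_rev s(2) assms(4) by simp
    show "gpath (c k i # q @ [c k j])" using chord_gpath[OF assms(1-3) ne] .
    show "set (seg (C k) i j) \<inter> set (rev (seg (C k) j (i + m k))) = {c k i, c k j}" by (rule sets)
    have "c k i \<in> set (seg (C k) i j)" "c k j \<in> set (seg (C k) i j)" using sets by blast+
    then show "set (seg (C k) i j) \<inter> set (c k i # q @ [c k j]) = {c k i, c k j}"
      using qC set_seg_C[OF s(2), of i j] by auto
    have "c k i \<in> set (rev (seg (C k) j (i + m k)))" "c k j \<in> set (rev (seg (C k) j (i + m k)))" using sets by blast+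
    then show "set (rev (seg (C k) j (i + m k))) \<inter> set (c k i # q @ [c k j]) = {c k i, c k j}"
      using qC set_seg_C[OF s(2), of j "i + m k"] by auto
    have "pos (hd q) \<in> pdraw (c k i # q @ [c k j])"
      unfolding chord_pdraw[OF assms(1)] using endless_pdraw(3)[OF spoke_gpath[OF assms(2)]] by auto
    then show "pdraw (c k i # q @ [c k j]) \<inter> inside (pdraw (seg (C k) i j) \<union> pdraw (rev (seg (C k) j (i + m k)))) \<noteq> {}"
      unfolding e using pos_vs_inside(1)[OF assms(2)] by blast
  qed (use assms mC[OF s(2)] in \<open>auto simp: hd_rev last_rev arcin_def Suc_le_eq\<close>)
qed

text \<open>The chord from \<open>i1\<close> to \<open>i3\<close> splits the inside of
  \<open>C k\<close>. The second chord is disjoint from it, so that without its ends it is on one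
  side; but its ends at \<open>i2\<close> and \<open>i4\<close> put it on both.\<close>

lemma crossing:
  assumes "1 \<le> k" "k \<le> n" "i1 < i2" "i2 < i3" "i3 < i4" "i4 < i1 + m k"
    and q: "arcin (k - 1) q" "spoke k (c k i1) (hd q)" "spoke k (c k i3) (last q)"
    and q': "arcin (k - 1) q'" "spoke k (c k i2) (hd q')" "spoke k (c k i4) (last q')"
    and dis: "set q \<inter> set q' = {}"
  shows False
proof -
  have i13: "i1 < i3" "i3 < i1 + m k" using assms by auto
  interpret th: theta G pos crv "seg (C k) i1 i3" "rev (seg (C k) i3 (i1 + m k))" "c k i1 # q @ [c k i3]" "c k i1" "c k i3"
    using chord_theta(1)[OF q i13] .
  have d: "c k i \<noteq> c k j" if "i < j" "j < i + m k" for i j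
    using cyc_inj[OF distinctC[OF assms(2)], of i j] that by auto
  have ds: "c k i1 \<noteq> c k i2" "c k i1 \<noteq> c k i3" "c k i1 \<noteq> c k i4" "c k i2 \<noteq> c k i3" "c k i2 \<noteq> c k i4" "c k i3 \<noteq> c k i4"
    using d[of i1 i2] d[of i1 i3] d[of i1 i4] d[of i2 i3] d[of i2 i4] d[of i3 i4] assms(3-6) by linarith+
  let ?r = "c k i2 # q' @ [c k i4]"
  let ?X = "pdraw ?r - {pos (c k i2), pos (c k i4)}"
  have gr: "gpath ?r" using chord_gpath[OF q' ds(5)] .
  have X: "connected ?X" "pdraw ?r \<subseteq> closure ?X" using endless_plus[OF gr, of ?X] by auto
  have "set (c k i1 # q @ [c k i3]) \<inter> set ?r = {}"
    using dis ds spokeD(7)[OF q(2)] spokeD(7)[OF q(3)] spokeD(7)[OF q'(2)] spokeD(7)[OF q'(3)] q(1) q'(1) unfolding arcin_def by auto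
  then have "pdraw (c k i1 # q @ [c k i3]) \<inter> pdraw ?r = {}" using pdraw_disjoint th.gp(3) by blast
  then have sub: "?X \<subseteq> th.AB - pdraw (c k i1 # q @ [c k i3])"
    unfolding chord_theta(2)[OF q i13] using chord_inside[OF q'] by blast
  have v: "c k l \<in> verts G" for l using vertsC neC assms by (meson cyc_in_set subsetD)
  have r: "pos (c k i2) \<in> closure ?X" "pos (c k i4) \<in> closure ?X"
    using X(2) endless_pdraw(3)[OF gr] by auto
  have "pos (c k i2) \<in> pdraw (seg (C k) i1 i3)"
    using endless_pdraw(3)[OF th.gp(1) th.len(1)] assms by (auto simp: set_seg)
  then have "?X \<subseteq> th.A" using th.side_A[OF X(1) sub r(1)] pos_eq_iff v ds by metis
  moreover have "pos (c k i4) \<in> pdraw (rev (seg (C k) i3 (i1 + m k)))"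
    using endless_pdraw(3)[OF th.gp(2) th.len(2)] assms by (auto simp: set_seg)
  then have "?X \<subseteq> th.B" using th.side_B[OF X(1) sub r(2)] pos_eq_iff v ds by metis
  ultimately have "?X = {}" using th.regions(12) by blast
  then show False using r(1) by (metis closure_empty empty_iff)
qed

end

section \<open>Cyclic orders of the spokes\<close>

context annular
begin

abbreviation innP :: "nat \<Rightarrow> nat \<Rightarrow> bool" where "innP k \<equiv> (\<lambda>l. inn k (c k l))"
abbreviation outP :: "nat \<Rightarrow> nat \<Rightarrow> bool" where "outP k \<equiv> (\<lambda>l. out k (c k l))"

lemma third_inn:
  assumes "1 \<le> k" "k \<le> n"
  obtains x where "inn k x" "x \<noteq> u" "x \<noteq> v"
proof -
  have "\<not> {x. inn k x} \<subseteq> {u, v}"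
  proof
    assume "{x. inn k x} \<subseteq> {u, v}"
    then have "card {x. inn k x} \<le> card {u, v}" by (intro card_mono) auto
    also have "\<dots> \<le> 2" by (simp add: card_insert_if)
    finally show False using inn_card[OF assms] by simp
  qed
  then show thesis using that by blast
qed

lemma third_out:
  assumes "k < n"
  obtains z where "out k z" "z \<noteq> u" "z \<noteq> v"
proof -
  have "\<exists>x. inn (Suc k) x \<and> \<not> spoke (Suc k) x u \<and> \<not> spoke (Suc k) x v"
  proof -
    \<comment> \<open>If no spoke ends in \<open>u\<close> or in \<open>v\<close>, the corresponding
      choice is arbitrary and merely excludes one more vertex.\<close>
    obtain x where x: "inn (Suc k) x" "x \<noteq> (SOME y. spoke (Suc k) y u)" "x \<noteq> (SOME y. spoke (Suc k) y v)"
      using third_inn[of "Suc k"] assms by auto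
    then show ?thesis using spoke_fun2 by (metis someI_ex)
  qed
  then show thesis using that unfolding inn_def out_def by metis
qed

lemma inn_index:
  assumes "inn k v"
  obtains l where "i \<le> l" "l < i + m k" "c k l = v"
  using set_cyc_window[of "C k" v i] innD[OF assms] neC by blast

lemma out_index:
  assumes "out k v"
  obtains l where "i \<le> l" "l < i + m k" "c k l = v"
  using set_cyc_window[of "C k" v i] outD[OF assms] neC[of k] by (meson less_imp_le_nat)

lemma c_neq: "k \<le> n \<Longrightarrow> i < j \<Longrightarrow> j < i + m k \<Longrightarrow> c k i \<noteq> c k j"
  using cyc_inj[OF distinctC, of k i j] by auto

text \<open>Since there are at least three spokes, two consecutive positions span less than a full
  turn. The additional position beyond \<open>j\<close> is the reference point for the far side of
  the face.\<close>

lemma consec_inn: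
  assumes "consec (innP k) i j"
  shows "1 \<le> k" "k \<le> n" "i < j" "inn k (c k i)" "inn k (c k j)" "j < i + m k" "c k i \<noteq> c k j"
    and "\<exists>l. j < l \<and> l < i + m k \<and> inn k (c k l)"
proof -
  show ij: "i < j" "inn k (c k i)" "inn k (c k j)" using assms unfolding consec_def by auto
  then show k: "1 \<le> k" "k \<le> n" using innD by blast+
  show *: "\<exists>l. j < l \<and> l < i + m k \<and> inn k (c k l)"
  proof -
    obtain x where x: "inn k x" "x \<noteq> c k i" "x \<noteq> c k j" using third_inn[OF k] by metis
    obtain l where l: "i \<le> l" "l < i + m k" "c k l = x" using inn_index[OF x(1)] by metis
    have "i \<noteq> l" "l \<noteq> j" using l x by auto
    then have "j < l" using assms l x(1) unfolding consec_def by (metis linorder_neqE_nat nat_less_le)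
    then show ?thesis using l x(1) by blast
  qed
  then show "j < i + m k" by auto
  then show "c k i \<noteq> c k j" using c_neq[of k i j] ij k by blast
qed

lemma consec_out:
  assumes "consec (outP k) i j"
  shows "k < n" "i < j" "out k (c k i)" "out k (c k j)" "j < i + m k" "c k i \<noteq> c k j"
    and "\<exists>l. j < l \<and> l < i + m k \<and> out k (c k l)"
proof -
  show ij: "i < j" "out k (c k i)" "out k (c k j)" using assms unfolding consec_def by auto
  then show k: "k < n" using outD by blast+
  show *: "\<exists>l. j < l \<and> l < i + m k \<and> out k (c k l)"
  proof -
    obtain x where x: "out k x" "x \<noteq> c k i" "x \<noteq> c k j" using third_out[OF k] by metis
    obtain l where l: "i \<le> l" "l < i + m k" "c k l = x" using out_index[OF x(1)] by metis
    have "i \<noteq> l" "l \<noteq> j" using l x by auto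
    then have "j < l" using assms l x(1) unfolding consec_def by (metis linorder_neqE_nat nat_less_le)
    then show ?thesis using l x(1) by blast
  qed
  then show "j < i + m k" by auto
  then show "c k i \<noteq> c k j" using c_neq[of k i j] ij k by simp
qed

text \<open>Both orientations of the arc \<open>q\<close> are allowed, since the lists \<open>C (k - 1)\<close> and \<open>C k\<close> may
  run in opposite directions.\<close>

definition face :: "nat \<Rightarrow> nat \<Rightarrow> nat \<Rightarrow> 'v list \<Rightarrow> bool" where
  "face k i j q \<longleftrightarrow> consec (innP k) i j \<and> spoke k (c k i) (hd q) \<and> spoke k (c k j) (last q) \<and>
     (\<exists>a b. consec (outP (k - 1)) a b \<and> (q = seg (C (k - 1)) a b \<or> q = rev (seg (C (k - 1)) a b)))"

lemma out_of_spoke: "spoke k u z \<Longrightarrow> out (k - 1) z"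
  unfolding out_def using spokeD(1) by (metis Suc_pred' gr0I not_one_le_zero)

lemma arcin_between:
  assumes "k \<le> n" "s \<le> a" "a \<noteq> b" "s \<le> b" "a < s + m k" "b < s + m k"
  obtains q where "arcin k q" "hd q = c k a" "last q = c k b" "set q = c k ` {min a b..max a b}"
proof (cases "a < b")
  case True
  then show thesis
    using that[of "seg (C k) a b"] arcin_seg[of k a b] assms by (auto simp: set_seg min_def max_def)
next
  case False
  then have "b < a" using assms by simp
  then show thesis
    using that[of "rev (seg (C k) b a)"] arcin_rev[OF arcin_seg[of k b a]] assms
    by (auto simp: set_seg min_def max_def hd_rev last_rev)
qed

lemma images_disjoint:
  assumes "k \<le> n" "X \<subseteq> {s..<s + m k}" "Y \<subseteq> {s..<s + m k}" "X \<inter> Y = {}"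
  shows "c k ` X \<inter> c k ` Y = {}"
proof (rule ccontr)
  assume "c k ` X \<inter> c k ` Y \<noteq> {}"
  then obtain x y where xy: "x \<in> X" "y \<in> Y" "c k x = c k y" by auto
  then have "x \<noteq> y" "s \<le> x" "s \<le> y" "x < s + m k" "y < s + m k" using assms by auto
  then show False using xy(3) c_neq[OF assms(1), of x y] c_neq[OF assms(1), of y x] by (metis linorder_neqE_nat add_le_mono1 order_less_le_trans)
qed

text \<open>Let \<open>z\<close> and \<open>w\<close> be the inner ends of the two spokes. If both
  arcs of \<open>C (k - 1)\<close> between them contained another \<open>out\<close> vertex, the
  spokes at these two vertices could be combined with those at \<open>z\<close> and \<open>w\<close>
  into two disjoint crossing chords. So one of the arcs is free of \<open>out\<close> vertices
  inside and belongs to the face.\<close>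

lemma face_exists:
  assumes "consec (innP k) i j"
  obtains q where "face k i j q"
proof -
  note ij = consec_inn[OF assms]
  let ?d = "c (k - 1)" let ?m = "m (k - 1)"
  have k1: "k - 1 \<le> n" using ij by simp
  obtain z w where z: "spoke k (c k i) z" and w: "spoke k (c k j) w" using ij unfolding inn_def by blast
  have "z \<noteq> w" using spoke_fun2 z w ij(7) by blast
  obtain a where a: "?d a = z" using out_index[OF out_of_spoke[OF z]] by metis
  obtain b where b: "a \<le> b" "b < a + ?m" "?d b = w" using out_index[OF out_of_spoke[OF w]] by metis
  have ab: "a < b" using a b \<open>z \<noteq> w\<close> by (metis le_neq_implies_less)
  \<comment> \<open>As \<open>i\<close> and \<open>j\<close> are consecutive, any further spoke has
    its outer end strictly between \<open>j\<close> and the next copy of \<open>i\<close>.\<close>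
  have sk: "\<exists>l. spoke k (c k l) (?d g) \<and> j < l \<and> l < i + m k"
    if og: "out (k - 1) (?d g)" "a < g" "g < a + ?m" "g \<noteq> b" for g
  proof -
    obtain u where u: "spoke k u (?d g)" using og(1) ij(1) unfolding out_def by auto
    have "inn k u" using u unfolding inn_def by blast
    then obtain l where l: "i \<le> l" "l < i + m k" "c k l = u" using inn_index by metis
    have "?d g \<noteq> z" using c_neq[OF k1, of a g] that a by auto
    then have "l \<noteq> i" using l u z spoke_fun1 by blast
    have "?d g \<noteq> w"
    proof (cases "g < b")
      case True then show ?thesis using c_neq[OF k1, of g b] b that by auto
    next
      case False then show ?thesis using c_neq[OF k1, of b g] b ab that by auto
    qed
    then have "l \<noteq> j" using l u w spoke_fun1 by blast
    have "j < l" using assms l \<open>l \<noteq> i\<close> \<open>l \<noteq> j\<close> \<open>inn k u\<close> unfolding consec_def by (metis linorder_neqE_nat nat_less_le)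
    then show ?thesis using l u by blast
  qed
  have oa: "outP (k - 1) a" "outP (k - 1) b" "outP (k - 1) (a + ?m)" using out_of_spoke[OF z] out_of_spoke[OF w] a b by auto
  consider "consec (outP (k - 1)) a b" | "consec (outP (k - 1)) b (a + ?m)"
    | g h where "a < g" "g < b" "b < h" "h < a + ?m" "outP (k - 1) g" "outP (k - 1) h"
    using oa ab b unfolding consec_def by blast
  then show thesis
  proof cases
    case 1
    then have "face k i j (seg (C (k - 1)) a b)"
      unfolding face_def using assms z w a b ab by auto
    then show ?thesis by (rule that)
  next
    case 2
    then have "face k i j (rev (seg (C (k - 1)) b (a + ?m)))"
      unfolding face_def using assms z w a b ab by (auto simp: hd_rev last_rev)
    then show ?thesis by (rule that)
  next
    case (3 g h)
    obtain l3 where l3: "spoke k (c k l3) (?d g)" "j < l3" "l3 < i + m k" using sk[of g] 3 by auto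
    obtain l4 where l4: "spoke k (c k l4) (?d h)" "j < l4" "l4 < i + m k" using sk[of h] 3 ab by auto
    have "?d g \<noteq> ?d h" using c_neq[OF k1, of g h] 3 by auto
    then have "l3 \<noteq> l4" using l3 l4 spoke_fun1 by blast
    then consider "l3 < l4" | "l4 < l3" by linarith
    then have False
    proof cases
      case 1
      \<comment> \<open>On \<open>C (k - 1)\<close> the order is \<open>z\<close>, \<open>g\<close>,
        \<open>w\<close>, \<open>h\<close>. The forward arcs from \<open>z\<close> to
        \<open>g\<close> and from \<open>w\<close> to \<open>h\<close> are disjoint; if
        \<open>l4\<close> precedes \<open>l3\<close>, the backward arcs from \<open>z\<close> to
        \<open>h\<close> and from \<open>w\<close> to \<open>g\<close> are used instead.\<close>
      let ?q = "seg (C (k - 1)) a g" and ?q' = "seg (C (k - 1)) b h"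
      have "arcin (k - 1) ?q" "arcin (k - 1) ?q'" using arcin_seg[OF k1] 3 b by auto
      moreover have "set ?q \<inter> set ?q' = {}"
        unfolding set_seg by (rule images_disjoint[OF k1, of _ a]) (use 3 b in auto)
      moreover have "hd ?q = z" "last ?q = ?d g" "hd ?q' = w" "last ?q' = ?d h" using a b 3 by auto
      ultimately show False using crossing[of k i j l3 l4 ?q ?q'] ij l3 l4 1 z w by simp
    next
      case 2
      let ?q = "rev (seg (C (k - 1)) h (a + ?m))" and ?q' = "rev (seg (C (k - 1)) g b)"
      have "arcin (k - 1) ?q" "arcin (k - 1) ?q'" using arcin_seg[OF k1] 3 b by (auto intro!: arcin_rev)
      moreover have "set ?q \<inter> set ?q' = {}"
        unfolding set_seg set_rev by (rule images_disjoint[OF k1, of _ "a + 1"]) (use 3 b in auto)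
      moreover have "hd ?q = z" "last ?q = ?d h" "hd ?q' = w" "last ?q' = ?d g" using a b 3 by (auto simp: hd_rev last_rev)
      ultimately show False using crossing[of k i j l4 l3 ?q ?q'] ij l3 l4 2 z w by simp
    qed
    then show ?thesis ..
  qed
qed

text \<open>The counterpart of \<open>face_exists\<close>, starting from the inner cycle. If both
  arcs of the outer cycle contained further \<open>inn\<close> vertices \<open>x\<close> and
  \<open>y\<close>, their spokes would end beyond \<open>b\<close> on \<open>C k\<close>, and the
  arc between those ends that avoids the positions from \<open>a\<close> to \<open>b\<close> would
  give a chord crossing the given one.\<close>

lemma face_exists_out:
  assumes "consec (outP k) a b"
  obtains i j q where "face (Suc k) i j q" "q = seg (C k) a b \<or> q = rev (seg (C k) a b)"
proof -
  note ab = consec_out[OF assms]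
  let ?k = "Suc k"
  have kn: "?k \<le> n" "1 \<le> ?k" "k \<le> n" using ab(1) by auto
  obtain u v where u: "spoke ?k u (c k a)" and v: "spoke ?k v (c k b)" using ab unfolding out_def by blast
  have uv: "u \<noteq> v" using spoke_fun1 u v ab(6) by blast
  have "inn ?k u" "inn ?k v" using u v unfolding inn_def by auto
  obtain i where i: "c ?k i = u" using inn_index[OF \<open>inn ?k u\<close>] by metis
  obtain j where j: "i \<le> j" "j < i + m ?k" "c ?k j = v" using inn_index[OF \<open>inn ?k v\<close>] by metis
  have ij: "i < j" using i j uv by (metis le_neq_implies_less)
  have oa: "innP ?k i" "innP ?k j" "innP ?k (i + m ?k)" using \<open>inn ?k u\<close> \<open>inn ?k v\<close> i j by auto
  consider "consec (innP ?k) i j" | "consec (innP ?k) j (i + m ?k)"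
    | x y where "i < x" "x < j" "j < y" "y < i + m ?k" "innP ?k x" "innP ?k y"
    using oa ij j unfolding consec_def by blast
  then show thesis
  proof cases
    case 1
    then have "face ?k i j (seg (C k) a b)"
      unfolding face_def using assms u v i j ab by auto
    then show ?thesis using that by blast
  next
    case 2
    then have "face ?k j (i + m ?k) (rev (seg (C k) a b))"
      unfolding face_def using assms u v i j ab by (auto simp: hd_rev last_rev)
    then show ?thesis using that by blast
  next
    case (3 x y)
    have sk: "\<exists>g. b < g \<and> g < a + m k \<and> spoke ?k (c ?k l) (c k g)" if il: "innP ?k l" "c ?k l \<noteq> u" "c ?k l \<noteq> v" for l
    proof -
      obtain t where t: "spoke ?k (c ?k l) t" using il(1) unfolding inn_def by blast
      have ot: "out k t" using out_of_spoke[OF t] by simp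
      then obtain g where g: "a \<le> g" "g < a + m k" "c k g = t" using out_index by metis
      have "g \<noteq> a" "g \<noteq> b" using g t u v that spoke_fun2 by blast+
      then have "b < g" using assms g ot unfolding consec_def by (metis linorder_neqE_nat nat_less_le)
      then show ?thesis using g t by blast
    qed
    have "c ?k x \<noteq> u" "c ?k x \<noteq> v" "c ?k y \<noteq> u" "c ?k y \<noteq> v" "c ?k x \<noteq> c ?k y"
      using c_neq[OF kn(1), of i x] c_neq[OF kn(1), of x j] c_neq[OF kn(1), of i y] c_neq[OF kn(1), of j y]
        c_neq[OF kn(1), of x y] 3 i j by auto
    then obtain g h where g: "b < g" "g < a + m k" "spoke ?k (c ?k x) (c k g)"
      and h: "b < h" "h < a + m k" "spoke ?k (c ?k y) (c k h)" and "g \<noteq> h"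
      using sk[of x] sk[of y] 3 spoke_fun2 by metis
    have c: "b \<le> g" "b \<le> h" "g < b + m k" "h < b + m k" using g h ab by auto
    obtain q' where q': "arcin k q'" "hd q' = c k g" "last q' = c k h" "set q' = c k ` {min g h..max g h}"
      by (rule arcin_between[OF kn(3) c(1) \<open>g \<noteq> h\<close> c(2-4)])
    have "set (seg (C k) a b) \<inter> set q' = {}"
      unfolding set_seg q'(4) by (rule images_disjoint[OF kn(3), of _ a]) (use g h ab in auto)
    moreover have "arcin k (seg (C k) a b)" using arcin_seg[OF kn(3)] ab by auto
    ultimately have False
      using crossing[of ?k i x j y "seg (C k) a b" q'] 3 kn u v i j g h q' ab by simp
    then show ?thesis ..
  qed
qed

end

section \<open>The faces of an annulus\<close>

context annular
begin

lemma faceD: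
  assumes "face k i j q"
  shows "consec (innP k) i j" "spoke k (c k i) (hd q)" "spoke k (c k j) (last q)" "arcin (k - 1) q"
    "i < j" "j < i + m k" "1 \<le> k" "k \<le> n" "length q \<ge> 2"
proof -
  show *: "consec (innP k) i j" "spoke k (c k i) (hd q)" "spoke k (c k j) (last q)" using assms unfolding face_def by auto
  show "i < j" "j < i + m k" "1 \<le> k" "k \<le> n" using consec_inn[OF *(1)] by auto
  obtain a b where ab: "consec (outP (k - 1)) a b" "q = seg (C (k - 1)) a b \<or> q = rev (seg (C (k - 1)) a b)"
    using assms unfolding face_def by blast
  have "arcin (k - 1) (seg (C (k - 1)) a b)" using arcin_seg consec_out[OF ab(1)] by simp
  then show "arcin (k - 1) q" using ab(2) arcin_rev by auto
  show "length q \<ge> 2" using ab consec_out(2)[OF ab(1)] by auto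
qed

definition region :: "nat \<Rightarrow> nat \<Rightarrow> nat \<Rightarrow> 'v list \<Rightarrow> complex set" where
  "region k i j q = inside (pdraw (seg (C k) i j) \<union> pdraw (c k i # q @ [c k j]))"

lemma face_theta:
  assumes "face k i j q"
  shows "theta G pos crv (seg (C k) i j) (rev (seg (C k) j (i + m k))) (c k i # q @ [c k j]) (c k i) (c k j)"
    and "inside (pdraw (seg (C k) i j) \<union> pdraw (rev (seg (C k) j (i + m k)))) = inside (crvC k)"
  using chord_theta faceD[OF assms] by blast+

lemma nested:
  assumes "t \<le> k" "k \<le> n"
  shows "crvC t \<union> inside (crvC t) \<subseteq> crvC k \<union> inside (crvC k)"
  using assms
proof (induction k rule: dec_induct)
  case (step j)
  then have "crvC j \<union> inside (crvC j) \<subseteq> inside (crvC (Suc j))"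
    using crvC_inside[of "Suc j"] inside_subset_inside[of "Suc j"] by simp
  then show ?case using step by simp blast
qed simp

lemma spoke_curve_nested:
  assumes "spoke t u z" "t \<le> k" "k \<le> n"
  shows "pdraw [u, z] \<subseteq> crvC k \<union> inside (crvC k)"
proof -
  have "pos u \<in> crvC t" using pos_in_crvC spokeD[OF assms(1)] by blast
  then have "pdraw [u, z] \<subseteq> crvC t \<union> inside (crvC t)" using spoke_inside[OF assms(1)] by blast
  then show ?thesis using nested[OF assms(2,3)] by blast
qed

lemma annulus_edge_spoke:
  assumes "e \<in> annulus_edges G C k" "1 \<le> k" "k \<le> n"
  obtains u z where "spoke k u z" "ends G e = {u, z}" "path_image (crv e) = pdraw [u, z]" "e \<in> edges G"
proof -
  obtain z u where e: "e \<in> edges G" "z \<in> set (C (k - 1))" "u \<in> set (C k)" "ends G e = {u, z}"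
    using assms(1) unfolding annulus_edges_def by (auto simp: insert_commute)
  then have "adj G u z" unfolding adj_def by blast
  then have "spoke k u z" unfolding spoke_def using e assms by blast
  then show thesis using that e pdraw_edge[OF e(1,4)] by auto
qed

text \<open>The chord splits the inside of \<open>C k\<close> into the region of the face and its
  complement \<open>th.B\<close>. Every part of the drawing that is neither on \<open>C k\<close>
  nor on the chord is shown to be in \<open>th.B\<close>: the other spokes, the rest of
  \<open>C (k - 1)\<close>, and everything inside \<open>C (k - 1)\<close>.\<close>

lemma region_avoids_drawing:
  assumes "face k i j q"
  shows "region k i j q \<inter> drawing crv (edges (inner_part G C k)) = {}"
    and "region k i j q \<inter> inside (crvC (k - 1)) = {}"
proof -
  note f = faceD[OF assms]
  let ?p1 = "seg (C k) i j" and ?p2 = "rev (seg (C k) j (i + m k))" and ?q = "c k i # q @ [c k j]"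
  interpret th: theta G pos crv ?p1 ?p2 ?q "c k i" "c k j" using face_theta(1)[OF assms] .
  note AB = face_theta(2)[OF assms]
  have R: "region k i j q = th.A" unfolding region_def ..
  have k1: "k - 1 \<le> n" using f by simp
  have v: "c k l \<in> verts G" for l using vertsC[OF f(8)] neC[OF f(8)] by (meson cyc_in_set subsetD)
  have qd: "pdraw ?q = pdraw [c k i, hd q] \<union> pdraw q \<union> pdraw [c k j, last q]" using chord_pdraw[OF f(4)] .
  \<comment> \<open>The outer end of such a spoke is beyond \<open>j\<close>, on the second side of
    the theta graph. Its inner end is not on \<open>q\<close>: inside \<open>q\<close> there is no
    \<open>out\<close> vertex, and each end of \<open>q\<close> has its own spoke.\<close>
  have other: "pdraw [u, z] - {pos u} \<subseteq> th.B \<and> z \<notin> set q" if uz: "spoke k u z" "u \<noteq> c k i" "u \<noteq> c k j" for u z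
  proof -
    note s = spokeD[OF uz(1)]
    have "inn k u" using uz unfolding inn_def by blast
    obtain l where l: "i \<le> l" "l < i + m k" "c k l = u" using inn_index[OF \<open>inn k u\<close>] by metis
    have "l \<noteq> i" "l \<noteq> j" using l uz by auto
    then have jl: "j < l" using f(1) l \<open>inn k u\<close> unfolding consec_def by (metis linorder_neqE_nat nat_less_le)
    have zq: "z \<notin> set q"
    proof
      assume "z \<in> set q"
      obtain a b where ab: "consec (outP (k - 1)) a b" "q = seg (C (k - 1)) a b \<or> q = rev (seg (C (k - 1)) a b)"
        using assms unfolding face_def by blast
      then obtain g where g: "a \<le> g" "g \<le> b" "z = c (k - 1) g" using \<open>z \<in> set q\<close> by (auto simp: set_seg)
      have "out (k - 1) z" using out_of_spoke[OF uz(1)] .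
      then have "g = a \<or> g = b" using ab(1) g unfolding consec_def by (metis le_neq_implies_less)
      moreover have "{hd q, last q} = {c (k - 1) a, c (k - 1) b}" using ab(2) consec_out(2)[OF ab(1)] by (auto simp: hd_rev last_rev)
      ultimately have "z = hd q \<or> z = last q" using g by blast
      then show False using spoke_fun2 uz f(2,3) by blast
    qed
    have gs: "gpath [u, z]" using spoke_gpath[OF uz(1)] .
    let ?X = "pdraw [u, z] - {pos u}"
    have X: "connected ?X" "pdraw [u, z] \<subseteq> closure ?X" using endless_plus[OF gs, of ?X] by auto
    have uq: "u \<notin> set q" using spokeD(7)[OF uz(1)] f(4) unfolding arcin_def by blast
    have zc: "z \<noteq> c k i" "z \<noteq> c k j" using s(8) neC[OF f(8)] by auto
    have "set [u, z] \<inter> set ?q = {}" using uq zq uz zc by auto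
    then have "pdraw [u, z] \<inter> pdraw ?q = {}" using pdraw_disjoint[OF gs] by blast
    then have sub: "?X \<subseteq> th.AB - pdraw ?q" unfolding AB using spoke_inside[OF uz(1)] by blast
    have "pos u \<in> closure ?X" using X(2) endless_pdraw(3)[OF gs] by auto
    moreover have "u \<in> set ?p2" using l jl by (auto simp: set_seg)
    then have "pos u \<in> pdraw ?p2" using endless_pdraw(3)[OF th.gp(2) th.len(2)] by blast
    moreover have "pos u \<noteq> pos (c k i)" "pos u \<noteq> pos (c k j)" using uz l v pos_eq_iff by metis+
    ultimately have "?X \<subseteq> th.B" using th.side_B[OF X(1) sub] by blast
    then show ?thesis using zq by blast
  qed
  \<comment> \<open>The third spoke. Its inner end \<open>zl\<close> is a point of
    \<open>C (k - 1)\<close> known to be in \<open>th.B\<close>.\<close>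
  obtain l where l: "j < l" "l < i + m k" "inn k (c k l)" using consec_inn(8)[OF f(1)] by blast
  then obtain zl where zl: "spoke k (c k l) zl" unfolding inn_def by blast
  have ln: "c k l \<noteq> c k i" "c k l \<noteq> c k j" using c_neq[OF f(8), of i l] c_neq[OF f(8), of j l] l f by auto
  have zlB: "pos zl \<in> th.B" and zlq: "zl \<notin> set q"
  proof -
    have "pos zl \<in> pdraw [c k l, zl]" using endless_pdraw(3)[OF spoke_gpath[OF zl]] by auto
    moreover have "pos zl \<noteq> pos (c k l)" using pos_vs_inside[OF zl] by metis
    ultimately show "pos zl \<in> th.B" "zl \<notin> set q" using other[OF zl ln] by blast+
  qed
  have zlC: "pos zl \<in> crvC (k - 1)" using pos_in_crvC[OF k1] spokeD[OF zl] by blast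
  obtain a b where ab: "consec (outP (k - 1)) a b" "q = seg (C (k - 1)) a b \<or> q = rev (seg (C (k - 1)) a b)"
    using assms unfolding face_def by blast
  note ab' = consec_out[OF ab(1)]
  have pq: "pdraw q = pdraw (seg (C (k - 1)) a b)" using ab(2) by auto
  let ?Q = "seg (C (k - 1)) b (a + m (k - 1))"
  have Qg: "gpath ?Q" "length ?Q \<ge> 2" using gpath_seg[OF k1, of "a + m (k - 1)" b] ab' by auto
  have split: "crvC (k - 1) = pdraw q \<union> pdraw ?Q" using crvC_split[OF k1, of a b] ab' pq by simp
  have hl: "{hd q, last q} = {c (k - 1) a, c (k - 1) b}" using ab(2) ab'(2) by (auto simp: hd_rev last_rev)
  have crv_sub: "crvC (k - 1) \<subseteq> inside (crvC k)" using crvC_inside f by blast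
  have sp0: "crvC (k - 1) \<inter> pdraw ?q \<subseteq> pdraw q"
  proof -
    have "pos (hd q) \<in> pdraw q" "pos (last q) \<in> pdraw q"
      using endless_pdraw(3)[of q] f(4,9) unfolding arcin_def by auto
    then show ?thesis unfolding qd using spoke_Int_crvC(2)[OF f(2)] spoke_Int_crvC(2)[OF f(3)] by blast
  qed
  \<comment> \<open>The rest of \<open>C (k - 1)\<close> without the ends of \<open>q\<close> is
    connected, avoids the chord and has \<open>zl\<close> in its closure, so it follows
    \<open>zl\<close> into \<open>th.B\<close>.\<close>
  have Y: "pdraw ?Q - {pos (hd q), pos (last q)} \<subseteq> th.B"
  proof -
    let ?Y = "pdraw ?Q - {pos (c (k - 1) b), pos (c (k - 1) a)}"
    have eq: "{hd ?Q, last ?Q} = {c (k - 1) b, c (k - 1) a}" using ab' by (auto)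
    then have ends: "{pos (hd ?Q), pos (last ?Q)} = {pos (c (k - 1) b), pos (c (k - 1) a)}" by (metis image_empty image_insert)
    have Yc: "connected ?Y" "pdraw ?Q \<subseteq> closure ?Y" using endless_plus[OF Qg, of ?Y] unfolding ends by auto
    have "set ?Q \<inter> set q \<subseteq> {c (k - 1) a, c (k - 1) b}"
    proof
      fix x assume x: "x \<in> set ?Q \<inter> set q"
      then obtain g h where g: "a \<le> g" "g \<le> b" "x = c (k - 1) g" and h: "b \<le> h" "h \<le> a + m (k - 1)" "x = c (k - 1) h"
        using ab(2) unfolding set_seg by (auto simp: set_seg)
      show "x \<in> {c (k - 1) a, c (k - 1) b}"
      proof (cases "h < g + m (k - 1)")
        case True
        then have "g = h" using cyc_inj[OF distinctC[OF k1], of g h] g h by auto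
        then show ?thesis using g h by auto
      next
        case False
        then have "g = a" using g h by linarith
        then show ?thesis using g by auto
      qed
    qed
    moreover have "ppairs ?Q \<inter> ppairs q = {}"
    proof (rule ccontr)
      assume "ppairs ?Q \<inter> ppairs q \<noteq> {}"
      then obtain s where s: "s \<in> ppairs ?Q" "s \<in> ppairs q" by blast
      have "ppairs q = ppairs (seg (C (k - 1)) a b)" using ab(2) by auto
      then obtain g h where g: "a \<le> g" "g < b" "s = {c (k - 1) g, c (k - 1) (Suc g)}"
        and h: "b \<le> h" "h < a + m (k - 1)" "s = {c (k - 1) h, c (k - 1) (Suc h)}"
        using s unfolding ppairs_seg by blast
      have "c (k - 1) g \<noteq> c (k - 1) h" using c_neq[OF k1, of g h] g h by auto
      then have *: "c (k - 1) g = c (k - 1) (Suc h)" "c (k - 1) (Suc g) = c (k - 1) h"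
        using g h by (metis doubleton_eq_iff)+
      have "Suc g = h" using cyc_inj[OF distinctC[OF k1] *(2)] g h by auto
      then have "c (k - 1) g = c (k - 1) (g + 2)" using *(1) by simp
      moreover have "g < g + 2" "g + 2 < g + m (k - 1)" using mC[OF k1] by auto
      ultimately show False using c_neq[OF k1] by blast
    qed
    ultimately have "pdraw ?Q \<inter> pdraw q \<subseteq> {pos (c (k - 1) b), pos (c (k - 1) a)}" using pdraw_Int by fast
    then have sub: "?Y \<subseteq> th.AB - pdraw ?q" unfolding AB using split crv_sub sp0 by blast
    have "zl \<in> set (C (k - 1))" using spokeD[OF zl] by blast
    have "pos zl \<notin> pdraw q" using zlq pos_in_pdraw vertsC[OF k1] \<open>zl \<in> set (C (k - 1))\<close> by blast
    then have "pos zl \<in> pdraw ?Q" using zlC split by blast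
    then have "?Y \<subseteq> th.B" using th.side_B'[OF Yc(1) sub _ zlB] Yc(2) by blast
    moreover have "{pos (hd q), pos (last q)} = {pos (c (k - 1) b), pos (c (k - 1) a)}"
      using arg_cong[OF hl, of "\<lambda>X. pos ` X"] by (simp add: insert_commute)
    ultimately show ?thesis by simp
  qed
  \<comment> \<open>The inside of \<open>C (k - 1)\<close> is connected as well, and
    \<open>zl\<close> is on its boundary.\<close>
  have Z: "inside (crvC (k - 1)) \<subseteq> th.B"
  proof -
    let ?Z = "inside (crvC (k - 1))"
    have "?Z \<inter> pdraw ?q = {}" unfolding qd
      using spoke_not_inner[OF f(2)] spoke_not_inner[OF f(3)] inside_crvC_disjoint[of "k - 1"] split by blast
    then have sub: "?Z \<subseteq> th.AB - pdraw ?q" unfolding AB using inside_subset_inside[of k] f by blast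
    have "pos zl \<in> closure ?Z" using zlC crvC_Jordan(1,3)[OF k1] by (metis closure_Un_frontier UnI2)
    then show ?thesis using th.side_B'[OF crvC_Jordan(2)[OF k1] sub _ zlB] by blast
  qed
  show "region k i j q \<inter> inside (crvC (k - 1)) = {}" unfolding R using Z th.regions(12) by blast
  have Ain: "th.A \<subseteq> inside (crvC k)" using th.regions(13) AB by blast
  have Afr: "th.A \<inter> (pdraw ?p1 \<union> pdraw ?q) = {}" using th.regions(2,4) by (metis frontier_disjoint_eq inf_commute)
  have inner: "th.A \<inter> (crvC (k - 1) \<union> inside (crvC (k - 1))) = {}"
  proof -
    have "pdraw q \<subseteq> pdraw ?q" using qd by blast
    moreover have "{pos (hd q), pos (last q)} \<subseteq> pdraw q"
      using endless_pdraw(3)[of q] f(4,9) unfolding arcin_def by auto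
    ultimately show ?thesis using split Y Z Afr th.regions(12) by blast
  qed
  show "region k i j q \<inter> drawing crv (edges (inner_part G C k)) = {}"
  proof (rule ccontr)
    assume "region k i j q \<inter> drawing crv (edges (inner_part G C k)) \<noteq> {}"
    then obtain x e where x: "x \<in> th.A" "x \<in> path_image (crv e)" "e \<in> edges (inner_part G C k)"
      unfolding R drawing_def by blast
    from x(3) consider (cyc) t where "t \<le> k" "e \<in> cycle_edges G (C t)"
      | (ann) t where "1 \<le> t" "t \<le> k" "e \<in> annulus_edges G C t"
      unfolding inner_part_def by auto
    then show False
    proof cases
      case cyc
      then have xc: "x \<in> crvC t" using x unfolding cycle_curve_def drawing_def by blast
      show False
      proof (cases "t = k")
        case True
        then show ?thesis using xc x Ain inside_crvC_disjoint by blast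
      next
        case False
        then have "t \<le> k - 1" using cyc by simp
        then show ?thesis using nested[OF _ k1] xc x inner by blast
      qed
    next
      case ann
      then have "t \<le> n" using f by simp
      obtain u z where uz: "spoke t u z" "path_image (crv e) = pdraw [u, z]"
        using annulus_edge_spoke[OF ann(3,1) \<open>t \<le> n\<close>] by metis
      show False
      proof (cases "t = k")
        case True
        have "pdraw [u, z] \<subseteq> crvC k \<union> pdraw ?q \<union> th.B"
        proof (cases "u = c k i \<or> u = c k j")
          case True
          then have "z = hd q \<and> u = c k i \<or> z = last q \<and> u = c k j" using uz f(2,3) spoke_fun1 \<open>t = k\<close> by blast
          then show ?thesis unfolding qd by blast
        next
          case False
          moreover have "pos u \<in> crvC k" using pos_in_crvC spokeD[OF uz(1)] \<open>t = k\<close> by blast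
          ultimately show ?thesis using other[of u z] uz \<open>t = k\<close> by blast
        qed
        then show False using x uz Ain inside_crvC_disjoint[of k] Afr th.regions(12) by blast
      next
        case False
        then have "t \<le> k - 1" using ann by simp
        then show ?thesis using spoke_curve_nested[OF uz(1) _ k1] x uz inner by blast
      qed
    qed
  qed
qed

lemma frontier_region:
  assumes "face k i j q"
  shows "frontier (region k i j q) = pdraw (seg (C k) i j) \<union> pdraw (c k i # q @ [c k j])"
proof -
  interpret th: theta G pos crv "seg (C k) i j" "rev (seg (C k) j (i + m k))" "c k i # q @ [c k j]" "c k i" "c k j"
    using face_theta(1)[OF assms] .
  show ?thesis unfolding region_def using th.regions(4) .
qed

lemma drawing_mono: "E \<subseteq> F \<Longrightarrow> drawing crv E \<subseteq> drawing crv F"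
  unfolding drawing_def by blast

lemma crvC_in_drawing: "t \<le> k \<Longrightarrow> crvC t \<subseteq> drawing crv (edges (inner_part G C k))"
  unfolding cycle_curve_def by (rule drawing_mono) (auto simp: inner_part_def)

lemma spoke_in_drawing: "spoke k u z \<Longrightarrow> pdraw [u, z] \<subseteq> drawing crv (edges (inner_part G C k))"
proof -
  assume s: "spoke k u z"
  then obtain e where e: "pdraw [u, z] = path_image (crv e)" "e \<in> annulus_edges G C k" using spoke_edge by metis
  then have "e \<in> edges (inner_part G C k)" using spokeD(1)[OF s] by (force simp: inner_part_def)
  then show ?thesis using e unfolding drawing_def by blast
qed

lemma chord_in_drawing:
  assumes "face k i j q"
  shows "pdraw (c k i # q @ [c k j]) \<subseteq> drawing crv (edges (inner_part G C k))"
proof -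
  note f = faceD[OF assms]
  have "pdraw q \<subseteq> drawing crv (edges (inner_part G C k))"
    using arcin_crvC[OF f(4)] crvC_in_drawing[of "k - 1" k] by auto
  then show ?thesis unfolding chord_pdraw[OF f(4)] using spoke_in_drawing f(2,3) by blast
qed

text \<open>A nonempty connected set that avoids the drawing and has its frontier in the drawing is
  a component of the complement: a larger connected set would meet that frontier.\<close>

lemma region_outer_face:
  assumes "face k i j q"
  shows "region k i j q \<in> outer_faces G crv C k"
proof -
  note f = faceD[OF assms]
  interpret th: theta G pos crv "seg (C k) i j" "rev (seg (C k) j (i + m k))" "c k i # q @ [c k j]" "c k i" "c k j"
    using face_theta(1)[OF assms] .
  let ?R = "region k i j q" let ?D = "drawing crv (edges (inner_part G C k))"
  note R = region_def
  have "frontier ?R \<subseteq> ?D"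
    unfolding frontier_region[OF assms] using chord_in_drawing[OF assms] crvC_split[of k i j] crvC_in_drawing[of k k] f by auto
  moreover have "?R \<subseteq> - ?D" using region_avoids_drawing(1)[OF assms] by blast
  moreover have "connected ?R" "?R \<noteq> {}" unfolding R using th.regions by auto
  ultimately have "?R \<in> components (- ?D)"
    unfolding in_components_maximal
  proof (intro conjI allI impI)
    fix E assume E: "E \<noteq> {} \<and> ?R \<subseteq> E \<and> E \<subseteq> - ?D \<and> connected E"
      and "frontier ?R \<subseteq> ?D" "?R \<noteq> {}"
    then have "E - ?R = {}" using connected_Int_frontier[of E ?R] by blast
    then show "E = ?R" using E by blast
  qed
  moreover have "?R \<subseteq> inside (crvC k)" unfolding R using th.regions(13) face_theta(2)[OF assms] by blast
  ultimately show ?thesis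
    using region_avoids_drawing(2)[OF assms] unfolding outer_faces_def faces_def annulus_def by blast
qed

text \<open>The vertex is an interior vertex of the segment, so a face of the annulus that touches
  it must be on the side of the segment. The strict inequalities matter, as the vertices at
  \<open>i\<close> and \<open>j\<close> also belong to the neighbouring faces.\<close>

lemma face_unique:
  assumes "face k i j q" "F \<in> outer_faces G crv C k" "pos (c k l) \<in> frontier F" "i < l" "l < j"
  shows "F = region k i j q"
proof -
  note f = faceD[OF assms(1)]
  let ?q = "c k i # q @ [c k j]"
  interpret th: theta G pos crv "seg (C k) i j" "rev (seg (C k) j (i + m k))" ?q "c k i" "c k j"
    using face_theta(1)[OF assms(1)] .
  let ?D = "drawing crv (edges (inner_part G C k))"
  have F: "F \<in> components (- ?D)" "F \<subseteq> annulus G crv C k" using assms(2) unfolding outer_faces_def faces_def by auto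
  have cF: "connected F" "F \<noteq> {}" "F \<inter> ?D = {}"
    using F in_components_connected in_components_nonempty in_components_subset by blast+
  have "F \<subseteq> inside (crvC k)" using F(2) cF(3) crvC_in_drawing[of k k] unfolding annulus_def by blast
  then have sub: "F \<subseteq> th.AB - pdraw ?q" unfolding face_theta(2)[OF assms(1)] using cF(3) chord_in_drawing[OF assms(1)] by blast
  have cl: "pos (c k l) \<in> closure F" using assms(3) unfolding frontier_def by blast
  have v: "c k l \<in> verts G" for l using vertsC[OF f(8)] neC[OF f(8)] by (meson cyc_in_set subsetD)
  have "pos (c k l) \<in> pdraw (seg (C k) i j)" using endless_pdraw(3)[OF th.gp(1) th.len(1)] assms(4,5) by (auto simp: set_seg)
  moreover have "c k l \<noteq> c k i" "c k l \<noteq> c k j" using c_neq[OF f(8), of i l] c_neq[OF f(8), of l j] assms(4,5) f by auto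
  then have "pos (c k l) \<noteq> pos (c k i)" "pos (c k l) \<noteq> pos (c k j)" using v pos_eq_iff by auto
  ultimately have "F \<subseteq> th.A" using th.side_A[OF cF(1) sub cl] by blast
  then have "F \<inter> region k i j q \<noteq> {}" using cF(2) unfolding region_def by blast
  moreover have "region k i j q \<in> components (- ?D)" using region_outer_face[OF assms(1)] unfolding outer_faces_def faces_def by blast
  ultimately show ?thesis using components_eq[OF F(1)] by blast
qed

text \<open>The spoke at \<open>c k j\<close> is on both frontiers. The regions differ because
  \<open>c k i\<close> is on the first frontier only: otherwise the segment from \<open>j\<close> to
  \<open>j'\<close> would reach a copy of \<open>i\<close>, passing the third spoke.\<close>

lemma adjacent_regions:
  assumes "face k i j q" "face k j j' q'"
  shows "adjacent_faces G crv C k (region k i j q) (region k j j' q')"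
proof -
  note f = faceD[OF assms(1)] and f' = faceD[OF assms(2)]
  obtain e where e: "pdraw [c k j, last q] = path_image (crv e)" "e \<in> annulus_edges G C k" using spoke_edge[OF f(3)] by metis
  have "last q = hd q'" using spoke_fun1 f(3) f'(2) by blast
  then have "path_image (crv e) \<subseteq> frontier (region k i j q) \<inter> frontier (region k j j' q')"
    unfolding frontier_region[OF assms(1)] frontier_region[OF assms(2)] chord_pdraw[OF f(4)] chord_pdraw[OF f'(4)] e(1)[symmetric] by auto
  moreover have "region k i j q \<noteq> region k j j' q'"
  proof
    assume "region k i j q = region k j j' q'"
    then have "frontier (region k i j q) = frontier (region k j j' q')" by simp
    moreover have "pos (c k i) \<in> pdraw (seg (C k) i j)"
    proof -
      have "pos ` set (seg (C k) i j) \<subseteq> pdraw (seg (C k) i j)"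
        using endless_pdraw(3)[OF gpath_seg[OF f(8,6)]] f(5) by simp
      then show ?thesis using f(5) by (auto simp: set_seg)
    qed
    ultimately have "pos (c k i) \<in> pdraw (seg (C k) j j') \<union> pdraw (c k j # q' @ [c k j'])"
      unfolding frontier_region[OF assms(1)] frontier_region[OF assms(2)] by blast
    moreover have "c k i \<in> verts G" using vertsC[OF f(8)] neC[OF f(8)] by (meson cyc_in_set subsetD)
    ultimately have "c k i \<in> set (seg (C k) j j') \<union> set (c k j # q' @ [c k j'])" using pos_in_pdraw by blast
    moreover have "c k i \<notin> set q'" using spokeD(7)[OF f(2)] f'(4) unfolding arcin_def by blast
    moreover have "c k j \<in> set (seg (C k) j j')" "c k j' \<in> set (seg (C k) j j')" using f'(5) by (auto simp: set_seg)
    ultimately have "c k i \<in> set (seg (C k) j j')" by auto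
    then obtain l where l: "j \<le> l" "l \<le> j'" "c k i = c k l" by (auto simp: set_seg)
    obtain x where x: "j < x" "x < i + m k" "inn k (c k x)" using consec_inn(8)[OF f(1)] by blast
    have "j' \<le> x" using f'(1) x unfolding consec_def by (meson not_le)
    then show False using c_neq[OF f(8), of i l] l x f by auto
  qed
  ultimately show ?thesis using e(2) unfolding adjacent_faces_def by blast
qed

lemma class_alternates:
  assumes "four_cycle_class G crv C k S" "face k i j q" "face k j j' q'"
  shows "region k i j q \<in> S \<longleftrightarrow> region k j j' q' \<notin> S"
  using assms(1) adjacent_regions[OF assms(2,3)] region_outer_face[OF assms(2)] region_outer_face[OF assms(3)]
  unfolding four_cycle_class_def by blast

end

section \<open>Four-cycle faces and parity\<close>

lemma successively_parity:
  assumes "successively R p" "p \<noteq> []" "\<And>u v. R u v \<Longrightarrow> P u \<longleftrightarrow> \<not> P v"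
  shows "(P (hd p) \<longleftrightarrow> P (last p)) \<longleftrightarrow> odd (length p)"
  using assms(1,2)
proof (induction p)
  case (Cons a p)
  show ?case
  proof (cases p)
    case (Cons b r)
    then show ?thesis using Cons.IH Cons.prems assms(3)[of a b] by auto
  qed simp
qed simp

lemma in_series_class:
  assumes "(e, f) \<in> (in_series H)\<^sup>*" "e \<in> edges H"
  shows "f \<in> edges H"
  using assms by (induction rule: rtrancl_induct) (auto simp: in_series_def)

context annular
begin

section \<open>Degrees after cutting off the outer annuli\<close>

lemma inner_part_edges: "edges (inner_part G C k) \<subseteq> edges G"
  unfolding inner_part_def cycle_edges_def annulus_edges_def by auto

lemma edge_not_next_annulus:
  assumes "v \<in> ends G e" "v \<in> set (C t)" "t < k \<or> t = k \<and> inn k v" "k < n"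
  shows "e \<notin> annulus_edges G C (Suc k)"
proof
  assume e: "e \<in> annulus_edges G C (Suc k)"
  have "1 \<le> Suc k" "Suc k \<le> n" using assms(4) by auto
  then obtain u z where uz: "spoke (Suc k) u z" "ends G e = {u, z}" using annulus_edge_spoke[OF e] by metis
  then consider "v = u" | "v = z" using assms by auto
  then show False
  proof cases
    case 1
    then have "t = Suc k" using disjC[of t "Suc k" v] spokeD[OF uz(1)] assms by auto
    then show ?thesis using assms by auto
  next
    case 2
    then have "t = k" using disjC[of t k v] spokeD[OF uz(1)] assms by auto
    moreover have "out k v" using uz 2 unfolding out_def by blast
    ultimately show ?thesis using inn_iff_not_out[of k v] assms by auto
  qed
qed

lemma edge_in_inner_part:
  assumes "e \<in> edges G" "v \<in> ends G e" "v \<in> set (C t)" "t < k \<or> t = k \<and> inn k v" "k \<le> n"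
  shows "e \<in> edges (inner_part G C k)"
proof -
  have t: "t \<le> n" using assms by auto
  from assms(1) show ?thesis
  proof (cases rule: edge_cases)
    case (cyc k')
    then have sub: "ends G e \<subseteq> set (C k')" using cpairs_sub by blast
    then have "t = k'" using disjC[of t k' v] assms t cyc by blast
    then show ?thesis
      using assms cyc unfolding inner_part_def cycle_edges_eq by auto
  next
    case (spoke k' x y)
    have "k' \<le> k"
    proof (cases "v = y")
      case True
      then have "t = k'" using disjC[of t k' v] spoke t assms by auto
      then show ?thesis using assms by auto
    next
      case False
      then have vx: "v = x" using assms spoke by auto
      then have tk: "t = k' - 1" using disjC[of t "k' - 1" v] spoke t assms by auto
      show ?thesis
      proof (rule ccontr)
        assume "\<not> k' \<le> k"
        then have k': "k' = Suc k" "t = k" using tk assms spoke by auto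
        have "adj G y x" unfolding adj_def using spoke assms(1) by (auto simp: insert_commute)
        then have "out k v" unfolding out_def spoke_def using k' vx spoke by auto
        then show False using inn_iff_not_out[of k v] assms k' by auto
      qed
    qed
    then have "k' \<in> {1..k}" using spoke by simp
    moreover have "e \<in> annulus_edges G C k'" using spoke assms(1) unfolding annulus_edges_def by blast
    ultimately show ?thesis unfolding inner_part_def by auto
  qed
qed

lemma vdegree_inner_part:
  assumes "v \<in> set (C t)" "t < k \<or> t = k \<and> inn k v" "k \<le> n"
  shows "vdegree (inner_part G C k) v = 3"
proof -
  have v: "v \<in> verts G" using vertsC[of t] assms by auto
  have e: "ends (inner_part G C k) = ends G" by (simp add: inner_part_def)
  have "{e \<in> edges (inner_part G C k). v \<in> ends G e} = {e \<in> edges G. v \<in> ends G e}"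
    using edge_in_inner_part[OF _ _ assms] inner_part_edges by blast
  moreover have "{e \<in> edges (inner_part G C k). ends G e = {v}} = {e \<in> edges G. ends G e = {v}}"
    using edge_in_inner_part[OF _ _ assms] inner_part_edges by blast
  moreover have "vdegree G v = 3" using v barnette unfolding barnette_def by blast
  ultimately show ?thesis unfolding vdegree_def e by simp
qed

text \<open>The vertices of the chord have degree 3 in the inner part, so none of them is suppressed
  and all are among the four vertices of the cycle. The chord has two vertices more than
  \<open>q\<close>, and \<open>q\<close> has at least two.\<close>

lemma four_cycle_length:
  assumes "face k i j q" "four_cycle_face G crv C k (region k i j q)"
  shows "length q = 2"
proof -
  note f = faceD[OF assms(1)]
  let ?H = "inner_part G C k"
  obtain vs where vs: "length vs = 4"
    and fr: "frontier (region k i j q) = drawing crv (\<Union> (cycle_edges (suppress ?H) vs))"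
    using assms(2) unfolding four_cycle_face_def annular_restriction_def by blast
  interpret th: theta G pos crv "seg (C k) i j" "rev (seg (C k) j (i + m k))" "c k i # q @ [c k j]" "c k i" "c k j"
    using face_theta(1)[OF assms(1)] .
  let ?T = "set (c k i # q @ [c k j])"
  have "v \<in> set vs" if v: "v \<in> ?T" for v
  proof -
    have vv: "v \<in> verts G" using th.gp(3) v unfolding gpath_def by blast
    have lq: "length (c k i # q @ [c k j]) \<ge> 2" by simp
    have "pos v \<in> frontier (region k i j q)"
      unfolding frontier_region[OF assms(1)] using endless_pdraw(3)[OF th.gp(3) lq] v by blast
    then obtain P e where P: "P \<in> cycle_edges (suppress ?H) vs" "e \<in> P" "pos v \<in> path_image (crv e)"
      unfolding fr drawing_def by blast
    obtain t where t: "v \<in> set (C t)" "t < k \<or> t = k \<and> inn k v"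
    proof (cases "v \<in> set q")
      case True
      then show ?thesis using that[of "k - 1"] f unfolding arcin_def by auto
    next
      case False
      then have "v = c k i \<or> v = c k j" using v by auto
      then show ?thesis using that[of k] consec_inn(4,5)[OF f(1)] neC[OF f(8)] by auto
    qed
    have d: "vdegree ?H v \<noteq> 2" using vdegree_inner_part[OF t f(8)] by simp
    have vH: "v \<in> verts ?H" using t unfolding inner_part_def by auto
    have "P \<in> edges ?H // (in_series ?H)\<^sup>*" using P(1) unfolding cycle_edges_def suppress_def by simp
    then have "e \<in> edges ?H" using P(2) in_series_class unfolding quotient_def by fastforce
    then have "e \<in> edges G" using inner_part_edges by blast
    then have "v \<in> ends ?H e" using pos_in_crv[OF _ vv P(3)] by (simp add: inner_part_def)
    then have "v \<in> ends (suppress ?H) P" using d vH P(2) unfolding suppress_def by auto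
    moreover obtain s where "s < length vs" "ends (suppress ?H) P = {vs ! s, vs ! (Suc s mod length vs)}"
      using P(1) unfolding cycle_edges_def by blast
    moreover have "Suc s mod length vs < length vs" using vs by simp
    ultimately show ?thesis by auto
  qed
  then have "card ?T \<le> card (set vs)" by (intro card_mono) auto
  also have "\<dots> \<le> 4" using card_length[of vs] vs by simp
  finally have "card ?T \<le> 4" .
  moreover have "card ?T = length (c k i # q @ [c k j])" using th.gp(3) unfolding gpath_def by (intro distinct_card) blast
  ultimately show ?thesis using f(9) by simp
qed

lemma class_length:
  "four_cycle_class G crv C k S \<Longrightarrow> face k i j q \<Longrightarrow> region k i j q \<in> S \<Longrightarrow> length q = 2"
  using four_cycle_length unfolding four_cycle_class_def by blast

lemma coloring:
  obtains A where "\<And>u v. adj G u v \<Longrightarrow> u \<in> A \<longleftrightarrow> v \<notin> A"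
proof -
  obtain A B where AB: "A \<inter> B = {}" "\<forall>e\<in>edges G. \<exists>a\<in>A. \<exists>b\<in>B. ends G e = {a, b}"
    using barnette unfolding barnette_def bipartite_def by blast
  have "u \<in> A \<longleftrightarrow> v \<notin> A" if "adj G u v" for u v
  proof -
    obtain e where "e \<in> edges G" "ends G e = {u, v}" using \<open>adj G u v\<close> unfolding adj_def by blast
    then obtain a b where "a \<in> A" "b \<in> B" "{u, v} = {a, b}" using AB by metis
    then show ?thesis using AB(1) unfolding doubleton_eq_iff by blast
  qed
  then show thesis using that by blast
qed

lemma vdegree_delete_outer:
  assumes "k < n" "v \<in> set (C t)" "t \<le> k"
  shows "vdegree (delete_edges G (annulus_edges G C (Suc k))) v = (if t = k \<and> out k v then 2 else 3)"
proof -
  let ?N = "annulus_edges G C (Suc k)"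
  have v: "v \<in> verts G" using vertsC[of t] assms by auto
  have d: "vdegree G v = 3" using v barnette unfolding barnette_def by blast
  have nl: "{e \<in> edges G. ends G e = {v}} = {}" using card_ends by (metis (mono_tags, lifting) One_nat_def Suc_1 card.empty card.insert empty_Collect_eq empty_iff finite.emptyI n_not_Suc_n)
  then have nl': "{e \<in> edges G - ?N. ends G e = {v}} = {}" by blast
  have c3: "card {e \<in> edges G. v \<in> ends G e} = 3" using d unfolding vdegree_def nl by simp
  have dd: "vdegree (delete_edges G ?N) v = card {e \<in> edges G - ?N. v \<in> ends G e}"
    unfolding vdegree_def delete_edges_def mgraph.select_convs nl' by simp
  show ?thesis
  proof (cases "t = k \<and> out k v")
    case True
    then obtain u where u: "spoke (Suc k) u v" unfolding out_def by blast
    obtain e where e: "e \<in> edges G" "ends G e = {u, v}" "e \<in> ?N" using spoke_edge[OF u] by metis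
    have "e' = e" if e': "e' \<in> edges G" "e' \<in> ?N" "v \<in> ends G e'" for e'
    proof -
      obtain u' z where u': "spoke (Suc k) u' z" "ends G e' = {u', z}"
        using annulus_edge_spoke[OF e'(2)] assms(1) by (metis Suc_leI le_add1 plus_1_eq_Suc)
      have "v \<noteq> u'" using spokeD(7)[OF u'(1)] assms True by auto
      then have "z = v" using u' e' by auto
      then have "u' = u" using u u' spoke_fun2 by blast
      then show ?thesis using edge_eqI e e' u' \<open>z = v\<close> by simp
    qed
    then have "{e \<in> edges G - ?N. v \<in> ends G e} = {e \<in> edges G. v \<in> ends G e} - {e}" using e by blast
    moreover have "card ({e \<in> edges G. v \<in> ends G e} - {e}) = 2" using c3 e by simp
    ultimately show ?thesis using True dd by simp
  next
    case False
    then have "t < k \<or> t = k \<and> inn k v" using assms inn_iff_not_out[of k v] by auto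
    then have "{e \<in> edges G - ?N. v \<in> ends G e} = {e \<in> edges G. v \<in> ends G e}"
      using edge_not_next_annulus assms by blast
    then show ?thesis using False dd c3 by simp
  qed
qed

end

section \<open>Parity from the bipartite suppressed graphs\<close>

locale annular_ac = annular +
  assumes ac: "adb_ac G pos crv C n"
begin

text \<open>The colourings of the two components are combined. Speaking of two distinct ends of an
  edge makes the claim vacuous for the vertex-less closed curve.\<close>

lemma suppressed_coloring:
  assumes "k < n"
  obtains A where "\<And>P s t. P \<in> edges (suppress (delete_edges G (annulus_edges G C (Suc k)))) \<Longrightarrow>
     s \<in> ends (suppress (delete_edges G (annulus_edges G C (Suc k)))) P \<Longrightarrow>
     t \<in> ends (suppress (delete_edges G (annulus_edges G C (Suc k)))) P \<Longrightarrow> s \<noteq> t \<Longrightarrow> s \<in> A \<longleftrightarrow> t \<notin> A"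
proof -
  let ?H = "suppress (delete_edges G (annulus_edges G C (Suc k)))"
  have "Suc k \<in> {1..n}" using assms by simp
  then obtain H1 H2 where H: "disjoint_union ?H H1 H2" "barnette H1" "barnette H2 \<or> closed_curve H2"
    using ac unfolding adb_ac_def by blast
  obtain A1 B1 where 1: "A1 \<union> B1 = verts H1" "A1 \<inter> B1 = {}" "\<forall>e\<in>edges H1. \<exists>a\<in>A1. \<exists>b\<in>B1. ends H1 e = {a, b}"
    using H(2) unfolding barnette_def bipartite_def by blast
  have "\<exists>A2 B2. A2 \<union> B2 = verts H2 \<and> A2 \<inter> B2 = {} \<and>
     (\<forall>e\<in>edges H2. ends H2 e = {} \<or> (\<exists>a\<in>A2. \<exists>b\<in>B2. ends H2 e = {a, b}))"
    using H(3)
  proof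
    assume "barnette H2"
    then show ?thesis unfolding barnette_def bipartite_def by metis
  next
    assume "closed_curve H2"
    then show ?thesis unfolding closed_curve_def by (intro exI[of _ "{}"]) auto
  qed
  then obtain A2 B2 where 2: "A2 \<union> B2 = verts H2" "A2 \<inter> B2 = {}"
     "\<forall>e\<in>edges H2. ends H2 e = {} \<or> (\<exists>a\<in>A2. \<exists>b\<in>B2. ends H2 e = {a, b})" by blast
  have U: "verts H1 \<inter> verts H2 = {}" "edges ?H = edges H1 \<union> edges H2" "ends H1 = ends ?H" "ends H2 = ends ?H"
    using H(1) unfolding disjoint_union_def by auto
  show thesis
  proof (rule that[of "A1 \<union> A2"])
    fix P s t assume P: "P \<in> edges ?H" "s \<in> ends ?H P" "t \<in> ends ?H P" "s \<noteq> t"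
    then consider "P \<in> edges H1" | "P \<in> edges H2" using U by blast
    then show "s \<in> A1 \<union> A2 \<longleftrightarrow> t \<notin> A1 \<union> A2"
    proof cases
      case 1
      then obtain a b where ab: "a \<in> A1" "b \<in> B1" "ends ?H P = {a, b}" using \<open>\<forall>e\<in>edges H1. _ e\<close> U(3) by metis
      then have "s = a \<and> t = b \<or> s = b \<and> t = a" using P by auto
      then show ?thesis using ab U(1) \<open>A1 \<union> B1 = verts H1\<close> \<open>A1 \<inter> B1 = {}\<close> 2(1) by blast
    next
      case 2
      then obtain a b where ab: "a \<in> A2" "b \<in> B2" "ends ?H P = {a, b}" using \<open>\<forall>e\<in>edges H2. _ e\<close> U(4) P(2) by (metis empty_iff)
      then have "s = a \<and> t = b \<or> s = b \<and> t = a" using P by auto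
      then show ?thesis using ab U(1) 1(1) \<open>A2 \<union> B2 = verts H2\<close> \<open>A2 \<inter> B2 = {}\<close> by blast
    qed
  qed
qed

text \<open>Successive edges of the chain share a vertex of degree 2 and hence fall into one class,
  which is a single edge after suppression and has both ends of the chain as ends.\<close>

lemma suppressed_chain:
  fixes f :: "nat \<Rightarrow> 'e" and v :: "nat \<Rightarrow> 'v"
  assumes "i < j" "\<And>l. i \<le> l \<Longrightarrow> l < j \<Longrightarrow> f l \<in> edges D"
    and "\<And>l. i < l \<Longrightarrow> l < j \<Longrightarrow> v l \<in> verts D \<and> vdegree D (v l) = 2 \<and> v l \<in> ends D (f (l - 1)) \<and> v l \<in> ends D (f l)"
    and "v i \<in> verts D" "v j \<in> verts D" "vdegree D (v i) \<noteq> 2" "vdegree D (v j) \<noteq> 2" "v i \<in> ends D (f i)" "v j \<in> ends D (f (j - 1))"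
  obtains P where "P \<in> edges (suppress D)" "v i \<in> ends (suppress D) P" "v j \<in> ends (suppress D) P"
proof -
  let ?P = "(in_series D)\<^sup>* `` {f i}"
  have "f l \<in> ?P" if "i \<le> l" "l < j" for l
    using that
  proof (induction l rule: dec_induct)
    case (step l)
    then have "(f l, f (Suc l)) \<in> in_series D"
      using assms(2)[of l] assms(2)[of "Suc l"] assms(3)[of "Suc l"] unfolding in_series_def by auto
    then show ?case using step by (auto intro: rtrancl_into_rtrancl)
  qed simp
  then have m: "f i \<in> ?P" "f (j - 1) \<in> ?P" using assms(1) by auto
  show thesis
  proof (rule that[of ?P])
    show "?P \<in> edges (suppress D)" using assms(1,2) unfolding suppress_def by (auto intro!: quotientI)
    show "v i \<in> ends (suppress D) ?P" "v j \<in> ends (suppress D) ?P"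
      using m assms(4-9) unfolding suppress_def by fastforce+
  qed
qed

text \<open>Delete the spokes of annulus \<open>k + 1\<close>. All vertices of the chord keep degree
  3, while the segment from \<open>i\<close> to \<open>j\<close> shrinks to one edge. A 2-colouring
  of the suppressed graph alternates along the chord and differs at its ends, so the chord has an
  even number of vertices. The 2-colouring of \<open>G\<close> carries this over to the
  segment.\<close>

lemma face_parity:
  assumes "face k i j q" "k < n"
  shows "even (length q)" "odd (j - i)"
proof -
  note f = faceD[OF assms(1)]
  let ?N = "annulus_edges G C (Suc k)"
  let ?D = "delete_edges G ?N"
  obtain A where A: "\<And>P s t. P \<in> edges (suppress ?D) \<Longrightarrow> s \<in> ends (suppress ?D) P \<Longrightarrow> t \<in> ends (suppress ?D) P
      \<Longrightarrow> s \<noteq> t \<Longrightarrow> s \<in> A \<longleftrightarrow> t \<notin> A"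
    using suppressed_coloring[OF assms(2)] by blast
  have D: "verts ?D = verts G" "edges ?D = edges G - ?N" "ends ?D = ends G" by (simp_all add: delete_edges_def)
  \<comment> \<open>The vertices all of whose edges survive the deletion and which are therefore not
    suppressed.\<close>
  let ?T = "\<lambda>v. \<exists>t. v \<in> set (C t) \<and> (t < k \<or> t = k \<and> inn k v)"
  have T: "vdegree ?D v = 3" "v \<in> verts G" "\<And>e. v \<in> ends G e \<Longrightarrow> e \<notin> ?N" if Tv: "?T v" for v
  proof -
    obtain t where t: "v \<in> set (C t)" "t < k \<or> t = k \<and> inn k v" using Tv by blast
    then have "t \<le> k" "\<not> (t = k \<and> out k v)" using inn_iff_not_out[of k v] assms(2) by auto
    then show "vdegree ?D v = 3" using vdegree_delete_outer[OF assms(2) t(1)] by auto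
    have "t \<le> n" using \<open>t \<le> k\<close> assms(2) by simp
    then show "v \<in> verts G" using t vertsC by blast
    show "e \<notin> ?N" if "v \<in> ends G e" for e using edge_not_next_annulus[OF that t assms(2)] .
  qed
  have step: "s \<in> A \<longleftrightarrow> t \<notin> A" if st: "?T s" "?T t" "adj G s t" for s t
  proof -
    obtain e where e: "e \<in> edges G" "ends G e = {s, t}" using st unfolding adj_def by blast
    have "e \<in> edges ?D" using e T(3)[OF st(1)] D by auto
    then obtain P where P: "P \<in> edges (suppress ?D)" "s \<in> ends (suppress ?D) P" "t \<in> ends (suppress ?D) P"
      using suppressed_chain[of 0 1 "\<lambda>_. e" ?D "\<lambda>l. if l = 0 then s else t"] T(1,2)[OF st(1)] T(1,2)[OF st(2)] D e by auto
    show ?thesis using A[OF P] adj_neq[OF st(3)] .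
  qed
  let ?q = "c k i # q @ [c k j]"
  have ne: "c k i \<noteq> c k j" using consec_inn(7)[OF f(1)] .
  have gq: "gpath ?q" using chord_gpath[OF f(4,2,3) ne] .
  have Tq: "?T v" if v: "v \<in> set ?q" for v
  proof (cases "v \<in> set q")
    case True
    then show ?thesis using f unfolding arcin_def by (intro exI[of _ "k - 1"]) auto
  next
    case False
    then have "v = c k i \<or> v = c k j" using v by auto
    then show ?thesis using consec_inn(4,5)[OF f(1)] neC[OF f(8)] by (intro exI[of _ k]) auto
  qed
  have "successively (\<lambda>s t. adj G s t \<and> ?T s \<and> ?T t) ?q"
    using gq Tq unfolding gpath_def successively_conv_nth by (meson Suc_lessD nth_mem)
  then have 1: "(c k i \<in> A \<longleftrightarrow> c k j \<in> A) \<longleftrightarrow> odd (length ?q)"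
    using successively_parity[of "\<lambda>s t. adj G s t \<and> ?T s \<and> ?T t" ?q "\<lambda>x. x \<in> A"] step by auto
  have "\<exists>e. e \<in> edges G \<and> ends G e = {c k l, c k (Suc l)}" for l
    using cycle_adj_cyc[OF cycleC[OF f(8)]] unfolding adj_def by blast
  then obtain g where g: "\<And>l. g l \<in> edges G" "\<And>l. ends G (g l) = {c k l, c k (Suc l)}" by metis
  have gD: "g l \<in> edges ?D" for l
  proof -
    have "g l \<notin> ?N"
    proof
      assume e: "g l \<in> ?N"
      have "1 \<le> Suc k" "Suc k \<le> n" using assms(2) by auto
      then obtain u z where uz: "spoke (Suc k) u z" "ends G (g l) = {u, z}" using annulus_edge_spoke[OF e] by metis
      then have "u \<in> set (C k)" using g(2)[of l] neC[OF f(8)] by (metis cyc_in_set insertE insertI1 singletonD)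
      then show False using spokeD(7)[OF uz(1)] by simp
    qed
    then show ?thesis using g D by simp
  qed
  have inC: "c k l \<in> set (C k)" for l using neC[OF f(8)] by simp
  \<comment> \<open>Between consecutive \<open>inn\<close> positions all vertices are
    \<open>out\<close>; they have lost their spoke and have degree 2.\<close>
  obtain P where P: "P \<in> edges (suppress ?D)" "c k i \<in> ends (suppress ?D) P" "c k j \<in> ends (suppress ?D) P"
  proof (rule suppressed_chain[of i j g ?D "c k"])
    show "i < j" by (rule f(5))
    show "g l \<in> edges ?D" for l by (rule gD)
    fix l assume l: "i < l" "l < j"
    have "\<not> inn k (c k l)" using f(1) l unfolding consec_def by blast
    then have "vdegree ?D (c k l) = 2"
      using vdegree_delete_outer[OF assms(2) inC, of l] inn_iff_not_out[OF f(8) inC, of l] by simp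
    moreover have "c k l \<in> verts G" using inC vertsC[OF f(8)] by blast
    moreover have "c k l \<in> ends G (g (l - 1))" using g(2)[of "l - 1"] l by simp
    ultimately show "c k l \<in> verts ?D \<and> vdegree ?D (c k l) = 2 \<and> c k l \<in> ends ?D (g (l - 1)) \<and> c k l \<in> ends ?D (g l)"
      using D g(2)[of l] by simp
  next
    have t: "?T (c k i)" "?T (c k j)" using Tq by auto
    show "c k i \<in> verts ?D" "c k j \<in> verts ?D" "vdegree ?D (c k i) \<noteq> 2" "vdegree ?D (c k j) \<noteq> 2"
      using T(1,2)[OF t(1)] T(1,2)[OF t(2)] D by auto
    show "c k i \<in> ends ?D (g i)" "c k j \<in> ends ?D (g (j - 1))" using D g(2)[of i] g(2)[of "j - 1"] f(5) by auto
  qed (rule that)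
  have "c k i \<in> A \<longleftrightarrow> c k j \<notin> A" using A[OF P ne] .
  then have ev: "even (length ?q)" using 1 by blast
  then show "even (length q)" by simp
  \<comment> \<open>In \<open>G\<close> itself, the segment and the chord join the same two
    vertices, so their lengths have the same parity.\<close>
  obtain B where B: "\<And>u v. adj G u v \<Longrightarrow> u \<in> B \<longleftrightarrow> v \<notin> B" using coloring by blast
  have "(hd ?q \<in> B \<longleftrightarrow> last ?q \<in> B) \<longleftrightarrow> odd (length ?q)"
    using successively_parity[of "adj G" ?q "\<lambda>x. x \<in> B"] B gq unfolding gpath_def by blast
  moreover have "(hd (seg (C k) i j) \<in> B \<longleftrightarrow> last (seg (C k) i j) \<in> B) \<longleftrightarrow> odd (length (seg (C k) i j))"
    using successively_parity[of "adj G" "seg (C k) i j" "\<lambda>x. x \<in> B"] B successively_seg[OF cycleC[OF f(8)]] f(5) by simp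
  ultimately show "odd (j - i)" using ev f(5) by (simp add: Suc_diff_le)
qed

end

section \<open>Extending a cycle through an annulus\<close>

lemma cyc_add_mult [simp]: "cyc vs (i + t * length vs) = cyc vs i"
  by (simp add: cyc_def)

lemma seg_add_mult: "seg vs (i + t * length vs) (j + t * length vs) = seg vs i j"
  by (rule nth_equalityI) (simp_all add: nth_seg, metis add.commute add.left_commute cyc_add_mult)

context annular
begin

text \<open>For \<open>k = n\<close> there are no \<open>out\<close> vertices, so the condition on
  edges is void and what remains is a Hamiltonian cycle.\<close>

definition cover :: "nat \<Rightarrow> 'v list \<Rightarrow> bool" where
  "cover k H \<longleftrightarrow> cycle G H \<and> set H = (\<Union>t\<le>k. set (C t)) \<and>
     (\<forall>u v. {u, v} \<in> cpairs (C k) \<and> out k u \<and> out k v \<longrightarrow> {u, v} \<in> cpairs H)"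

lemma short_face:
  assumes "face k i j q" "length q = 2"
  shows "{hd q, last q} \<in> cpairs (C (k - 1))" "out (k - 1) (hd q)" "out (k - 1) (last q)"
proof -
  note f = faceD[OF assms(1)]
  obtain a b where "q = [a, b]" using assms(2) by (auto simp: length_Suc_conv numeral_2_eq_2)
  then show "{hd q, last q} \<in> cpairs (C (k - 1))" using f(4) unfolding arcin_def by simp
  show "out (k - 1) (hd q)" "out (k - 1) (last q)" using out_of_spoke f(2,3) by blast+
qed

lemma union_le_pred: "1 \<le> k \<Longrightarrow> (\<Union>t\<le>k. set (C t)) = (\<Union>t\<le>k - 1. set (C t)) \<union> set (C k)"
  by (cases k) (auto simp: atMost_Suc)

lemma union_pred_disjoint: "1 \<le> k \<Longrightarrow> k \<le> n \<Longrightarrow> set (C k) \<inter> (\<Union>t\<le>k - 1. set (C t)) = {}"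
proof -
  assume k: "1 \<le> k" "k \<le> n"
  have False if "v \<in> set (C k)" "t \<le> k - 1" "v \<in> set (C t)" for v t
    using disjC[of k t v] that k by linarith
  then show ?thesis by blast
qed

text \<open>The face is a 4-cycle of \<open>G\<close>: one edge of each cycle and two spokes. The
  edge of \<open>C (k - 1)\<close> has two \<open>out\<close> ends and is available; the omitted
  edge of \<open>C k\<close> has two \<open>inn\<close> ends, so the condition on \<open>out\<close>
  edges of \<open>C k\<close> is not affected.\<close>

lemma ring_step:
  assumes "cover (k - 1) H" "face k i (Suc i) q" "length q = 2"
  obtains H' where "cover k H'"
proof -
  note f = faceD[OF assms(2)] and s = short_face[OF assms(2,3)]
  let ?p = "seg (C k) (Suc i) (i + m k)"
  have m3: "m k \<ge> 3" using mC f by blast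
  have H: "cycle G H" "set H = (\<Union>t\<le>k - 1. set (C t))" "{last q, hd q} \<in> cpairs H"
    using assms(1) s unfolding cover_def by (auto simp: insert_commute)
  have p: "gpath ?p" using gpath_seg[OF f(8)] m3 by simp
  have setp: "set ?p = set (C k)"
  proof
    show "set ?p \<subseteq> set (C k)" using set_seg_C f(8) by blast
    show "set (C k) \<subseteq> set ?p"
    proof
      fix v assume "v \<in> set (C k)"
      then obtain l where "Suc i \<le> l" "l < Suc i + m k" "c k l = v" using set_cyc_window[OF neC[OF f(8)]] by metis
      then show "v \<in> set ?p" by (auto simp: set_seg)
    qed
  qed
  have "?p \<noteq> []" "hd ?p = c k (Suc i)" "last ?p = c k i" using m3 by auto
  then obtain H' where H': "cycle G H'" "set H' = set H \<union> set ?p" "cpairs H - {{last q, hd q}} \<subseteq> cpairs H'" "ppairs ?p \<subseteq> cpairs H'"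
    using cycle_insert_path[OF H(1,3), of ?p] p setp union_pred_disjoint[OF f(7,8)] H(2) spokeD(5,6)[OF f(2)] spokeD(5,6)[OF f(3)]
    unfolding gpath_def by auto
  have "cover k H'"
    unfolding cover_def
  proof (intro conjI allI impI)
    show "set H' = (\<Union>t\<le>k. set (C t))" using H'(2) H(2) setp union_le_pred[OF f(7)] by simp
    fix u v assume uv: "{u, v} \<in> cpairs (C k) \<and> out k u \<and> out k v"
    have e: "cpairs (C k) = ppairs (seg (C k) i (Suc i)) \<union> ppairs ?p"
      using cpairs_split[OF neC[OF f(8)], of i "Suc i"] m3 by simp
    have e1: "ppairs (seg (C k) i (Suc i)) = {{c k i, c k (Suc i)}}" unfolding ppairs_seg by (auto simp: less_Suc_eq_le)
    have "{u, v} \<noteq> {c k i, c k (Suc i)}"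
      using uv consec_inn(4,5)[OF f(1)] inn_iff_not_out[OF f(8)] neC[OF f(8)] unfolding doubleton_eq_iff by (metis cyc_in_set)
    moreover have "{u, v} \<in> cpairs (C k)" using uv by simp
    ultimately have "{u, v} \<in> ppairs ?p" unfolding e e1 by simp
    then show "{u, v} \<in> cpairs H'" using H'(4) by (rule subsetD[rotated])
  qed (rule H'(1))
  then show thesis by (rule that)
qed

lemma consec_inn_shift_mult: "consec (innP k) (i + t * m k) (j + t * m k) = consec (innP k) i j"
  by (rule consec_shift) simp

lemma face_shift_mult: "face k (i + t * m k) (j + t * m k) q = face k i j q"
  unfolding face_def consec_inn_shift_mult by simp

text \<open>Positions are natural numbers, so \<open>l\<close> needs a full period to its left for
  an \<open>inn\<close> position to be found there.\<close>

lemma consec_inn_exists: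
  assumes "1 \<le> k" "k \<le> n" "m k \<le> l"
  obtains i j where "consec (innP k) i j" "i \<le> l" "l < j"
proof -
  obtain x where x: "inn k x" using third_inn[OF assms(1,2)] by metis
  obtain a where a: "0 \<le> a" "a < 0 + m k" "c k a = x" using inn_index[OF x] by metis
  obtain b where b: "Suc l \<le> b" "b < Suc l + m k" "c k b = x" using inn_index[OF x] by metis
  have "innP k a" "innP k b" "a \<le> l" "l < b" using x a b assms by auto
  then show thesis using that consec_around[of "innP k" a b l] by metis
qed

lemma consec_inn_from:
  assumes "innP k i"
  obtains j where "consec (innP k) i j"
proof -
  have "innP k (i + m k)" using assms by simp
  moreover have "i < i + m k" using innD[OF assms] neC by auto
  ultimately show thesis using consec_next[of "innP k" i "i + m k"] assms that by blast
qed

text \<open>\<open>R\<close> selects every other face by its starting position, whatever the origin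
  of the selection: the 4-cycle class, or a colouring in the first annulus. At a selected face
  \<open>C (k - 1)\<close> contributes a single edge, which is replaced; an unselected face has no
  vertex of \<open>C k\<close> between its two spokes, so the selected segments cover
  \<open>C k\<close> and contain all its edges with two \<open>out\<close> ends.\<close>

lemma block_step:
  assumes H: "cover (k - 1) H" and k: "1 \<le> k" "k \<le> n"
    and per: "\<And>i. R (i + m k) = R i"
    and alt: "\<And>i j. consec (innP k) i j \<Longrightarrow> R i \<longleftrightarrow> \<not> R j"
    and short: "\<And>i j q. face k i j q \<Longrightarrow> R i \<Longrightarrow> length q = 2"
    and empty: "\<And>i j. consec (innP k) i j \<Longrightarrow> \<not> R i \<Longrightarrow> j = Suc i"
  obtains H' where "cover k H'"
proof -
  have perm: "R (i + t * m k) = R i" for i t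
  proof (induction t)
    case (Suc t)
    have "i + Suc t * m k = i + t * m k + m k" by simp
    then show ?case using Suc per[of "i + t * m k"] by (simp only:)
  qed simp
  let ?X0 = "{i. i < m k \<and> innP k i \<and> R i}"
  have "\<exists>j q. face k i j q" if "innP k i" for i
    using consec_inn_from[OF that] face_exists by metis
  then obtain nx qq where nq: "\<And>i. innP k i \<Longrightarrow> face k i (nx i) (qq i)" by metis
  let ?seg = "\<lambda>i. seg (C k) i (nx i)"
  \<comment> \<open>A selected segment ends at a position outside \<open>R\<close>, hence not where
    another selected segment starts. This is compared on both sides, once around the turn.\<close>
  have dis: "set (?seg i) \<inter> set (?seg i') = {}" if a: "i \<in> ?X0" "i' \<in> ?X0" "i < i'" for i i'
  proof -
    have c: "consec (innP k) i (nx i)" "consec (innP k) i' (nx i')" using faceD(1)[OF nq] a by auto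
    have "\<not> R (nx i)" "\<not> R (nx i')" "R i'" "R (i + m k)" using alt[OF c(1)] alt[OF c(2)] a per by auto
    then have "nx i \<noteq> i'" "nx i' \<noteq> i + m k" by metis+
    moreover have "nx i \<le> i'" using c(1) a unfolding consec_def by (metis (mono_tags, lifting) linorder_not_less mem_Collect_eq)
    moreover have "innP k (i + m k)" "i' < i + m k" using a by auto
    then have "nx i' \<le> i + m k" using c(2) unfolding consec_def by (metis linorder_not_less)
    ultimately have lt: "nx i < i'" "nx i' < i + m k" by auto
    show ?thesis unfolding set_seg by (rule images_disjoint[OF k(2), of _ i]) (use lt a c in \<open>auto simp: consec_def\<close>)
  qed
  then have dis: "set (?seg i) \<inter> set (?seg i') = {}" if a: "i \<in> ?X0" "i' \<in> ?X0" "i \<noteq> i'" for i i'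
    using a by (metis (lifting) Int_commute linorder_neqE_nat)
  have Hc: "cycle G H" "set H = (\<Union>t\<le>k - 1. set (C t))" using H unfolding cover_def by auto
  \<comment> \<open>The faces are treated one at a time. An edge of \<open>C (k - 1)\<close> with
    two \<open>out\<close> ends stays in the cycle until its own face is treated; edges of the
    inserted paths are on \<open>C k\<close> and are never removed.\<close>
  have "\<exists>H'. cycle G H' \<and> set H' = set H \<union> (\<Union>i\<in>X. set (?seg i)) \<and>
     (\<forall>u v. {u, v} \<in> cpairs (C (k - 1)) \<and> out (k - 1) u \<and> out (k - 1) v \<and> (\<forall>i\<in>X. {u, v} \<noteq> {hd (qq i), last (qq i)}) \<longrightarrow> {u, v} \<in> cpairs H') \<and>
     (\<forall>i\<in>X. ppairs (?seg i) \<subseteq> cpairs H')" if "finite X" "X \<subseteq> ?X0" for X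
    using that
  proof (induction X)
    case empty
    then show ?case using H unfolding cover_def by (intro exI[of _ H]) auto
  next
    case (insert i X)
    then obtain H1 where H1: "cycle G H1" "set H1 = set H \<union> (\<Union>i\<in>X. set (?seg i))"
      "\<And>u v. {u, v} \<in> cpairs (C (k - 1)) \<Longrightarrow> out (k - 1) u \<Longrightarrow> out (k - 1) v \<Longrightarrow> (\<forall>i\<in>X. {u, v} \<noteq> {hd (qq i), last (qq i)}) \<Longrightarrow> {u, v} \<in> cpairs H1"
      "\<And>i. i \<in> X \<Longrightarrow> ppairs (?seg i) \<subseteq> cpairs H1" by auto
    have iX: "i \<in> ?X0" using insert.prems by blast
    then have fi: "face k i (nx i) (qq i)" "R i" using nq by auto
    note f = faceD[OF fi(1)] and s = short_face[OF fi(1) short[OF fi]]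
    have mem: "c k i \<in> set (?seg i)" "c k (nx i) \<in> set (?seg i)" if "i \<in> ?X0" for i
    proof -
      have "i < nx i" using faceD(5)[OF nq] that by blast
      then show "c k i \<in> set (?seg i)" "c k (nx i) \<in> set (?seg i)" by (auto simp: set_seg)
    qed
    have "{hd (qq i), last (qq i)} \<noteq> {hd (qq i'), last (qq i')}" if i': "i' \<in> X" for i'
    proof
      assume e: "{hd (qq i), last (qq i)} = {hd (qq i'), last (qq i')}"
      have i'X: "i' \<in> ?X0" "i' \<noteq> i" using i' insert.prems insert.hyps by auto
      then have f': "face k i' (nx i') (qq i')" using nq by auto
      have "hd (qq i) = hd (qq i') \<or> hd (qq i) = last (qq i')" using e by auto
      then have "c k i = c k i' \<or> c k i = c k (nx i')" using spoke_fun2 f(2) faceD(2,3)[OF f'] by metis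
      then show False using dis[OF iX i'X(1)] i'X(2) mem[OF iX] mem[OF i'X(1)] by auto
    qed
    then have zw: "{hd (qq i), last (qq i)} \<in> cpairs H1" using H1(3)[OF s] by blast
    have ij: "i < nx i" "nx i < i + m k" using f by auto
    have p: "gpath (?seg i)" "?seg i \<noteq> []" using gpath_seg[OF k(2) ij(2)] ij by auto
    have sub: "set (?seg i) \<subseteq> set (C k)" using set_seg_C k by blast
    have "set (?seg i) \<inter> set H1 = {}"
    proof -
      have "set (?seg i) \<inter> set H = {}" using sub union_pred_disjoint[OF k] Hc(2) by blast
      moreover have "set (?seg i) \<inter> set (?seg i') = {}" if "i' \<in> X" for i'
      proof -
        have "i' \<in> ?X0" using that insert.prems by blast
        moreover have "i \<noteq> i'" using that insert.hyps by blast
        ultimately show ?thesis by (rule dis[OF iX])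
      qed
      ultimately show ?thesis unfolding H1(2) by blast
    qed
    moreover have "adj G (hd (qq i)) (hd (?seg i))" "adj G (last (?seg i)) (last (qq i))"
      using spokeD(6)[OF f(2)] spokeD(5)[OF f(3)] ij by auto
    ultimately obtain H2 where H2: "cycle G H2" "set H2 = set H1 \<union> set (?seg i)"
      "cpairs H1 - {{hd (qq i), last (qq i)}} \<subseteq> cpairs H2" "ppairs (?seg i) \<subseteq> cpairs H2"
      using cycle_insert_path[OF H1(1) zw, of "?seg i"] p unfolding gpath_def by blast
    show ?case
    proof (intro exI[of _ H2] conjI allI impI ballI)
      show "set H2 = set H \<union> (\<Union>i\<in>insert i X. set (?seg i))" using H2(2) H1(2) by auto
      fix u v assume "{u, v} \<in> cpairs (C (k - 1)) \<and> out (k - 1) u \<and> out (k - 1) v \<and> (\<forall>i\<in>insert i X. {u, v} \<noteq> {hd (qq i), last (qq i)})"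
      then show "{u, v} \<in> cpairs H2" using H1(3)[of u v] H2(3) by blast
    next
      fix i' assume i': "i' \<in> insert i X"
      show "ppairs (?seg i') \<subseteq> cpairs H2"
      proof (cases "i' = i")
        case True then show ?thesis using H2(4) by simp
      next
        case False
        have "{hd (qq i), last (qq i)} \<notin> ppairs (?seg i')"
        proof
          assume "{hd (qq i), last (qq i)} \<in> ppairs (?seg i')"
          then have "hd (qq i) \<in> set (C k)" using ppairs_subset_set set_seg_C[OF k(2)] by blast
          then show False using spokeD(8)[OF f(2)] by simp
        qed
        then show ?thesis using H1(4)[of i'] i' False H2(3) by blast
      qed
    qed (rule H2(1))
  qed
  from this[of ?X0] obtain H' where H': "cycle G H'" "set H' = set H \<union> (\<Union>i\<in>?X0. set (?seg i))"
    "\<And>i. i \<in> ?X0 \<Longrightarrow> ppairs (?seg i) \<subseteq> cpairs H'" by auto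
  \<comment> \<open>Reduction modulo the period: every selected segment equals one that starts in
    the first period.\<close>
  have rep: "\<exists>i\<in>?X0. seg (C k) a b = ?seg i" if ab: "consec (innP k) a b" "R a" for a b
  proof -
    let ?t = "a div m k" and ?i = "a mod m k"
    have a: "a = ?i + ?t * m k" by simp
    have mk: "m k > 0" using mC[OF k(2)] by linarith
    have "a < b" using ab unfolding consec_def by blast
    define j where "j = b - ?t * m k"
    have b: "b = j + ?t * m k" using \<open>a < b\<close> unfolding j_def by (metis a le_add2 le_trans less_imp_le_nat le_add_diff_inverse2)
    have cj: "consec (innP k) ?i j" using ab(1) consec_inn_shift_mult[of k ?i ?t j] a b by simp
    then have iX: "?i \<in> ?X0" using ab(2) perm[of ?i ?t] mk a unfolding consec_def by auto
    have "consec (innP k) ?i (nx ?i)" using faceD(1)[OF nq] iX by blast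
    then have "nx ?i = j" using cj consec_unique by blast
    moreover have "seg (C k) a b = seg (C k) ?i j" using seg_add_mult[of "C k" ?i ?t j] a b by simp
    ultimately show ?thesis using iX by metis
  qed
  have "cover k H'"
    unfolding cover_def
  proof (intro conjI allI impI)
    have "set (C k) \<subseteq> (\<Union>i\<in>?X0. set (?seg i))"
    proof
      fix v assume "v \<in> set (C k)"
      \<comment> \<open>Taken far enough to the right for earlier \<open>inn\<close> positions to
        exist.\<close>
      then obtain l where l: "2 * m k \<le> l" "l < 2 * m k + m k" "c k l = v" using set_cyc_window[OF neC[OF k(2)]] by metis
      have "m k \<le> l - m k" using l by simp
      obtain a b where ab: "consec (innP k) a b" "a \<le> l" "l < b" using consec_inn_exists[OF k, of l] l by auto
      show "v \<in> (\<Union>i\<in>?X0. set (?seg i))"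
      proof (cases "R a")
        case True
        have "v \<in> set (seg (C k) a b)" using ab l unfolding set_seg by auto
        moreover obtain i where "i \<in> ?X0" "seg (C k) a b = ?seg i" using rep[OF ab(1) True] by (elim bexE)
        ultimately show ?thesis by (intro UN_I[of i]) simp_all
      next
        case False
        then have "a = l" using empty[OF ab(1)] ab by simp
        obtain x where x: "inn k x" using third_inn[OF k] by metis
        obtain a0 where a0: "0 \<le> a0" "a0 < 0 + m k" "c k a0 = x" using inn_index[OF x] by metis
        have "innP k a0" "innP k a" "a0 < a" using a0 x ab(1) l \<open>a = l\<close> unfolding consec_def by auto
        then obtain a' where a': "consec (innP k) a' a" using consec_prev[of "innP k" a0 a] by blast
        then have "R a'" using alt[OF a'] False by blast
        moreover have "v \<in> set (seg (C k) a' a)" using a' l \<open>a = l\<close> unfolding set_seg consec_def by auto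
        moreover obtain i where "i \<in> ?X0" "seg (C k) a' a = ?seg i" using rep[OF a' \<open>R a'\<close>] by (elim bexE)
        ultimately show ?thesis by (intro UN_I[of i]) simp_all
      qed
    qed
    moreover have "set (?seg i) \<subseteq> set (C k)" for i using set_seg_C k by blast
    ultimately show "set H' = (\<Union>t\<le>k. set (C t))" unfolding H'(2) Hc(2) union_le_pred[OF k(1)] by blast
    fix u v assume uv: "{u, v} \<in> cpairs (C k) \<and> out k u \<and> out k v"
    then obtain l0 where l0: "{u, v} = {c k l0, c k (Suc l0)}" using cpairs_cyc[OF neC[OF k(2)]] by blast
    define l where "l = l0 + m k"
    have l: "{u, v} = {c k l, c k (Suc l)}" "m k \<le> l" using l0 cyc_add_length[of "C k" "Suc l0"] unfolding l_def by auto
    obtain a b where ab: "consec (innP k) a b" "a \<le> l" "l < b" using consec_inn_exists[OF k l(2)] by blast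
    have o: "out k (c k l)" "out k (c k (Suc l))" using uv l(1) unfolding doubleton_eq_iff by metis+
    have ni: "\<not> inn k (c k l)" "\<not> inn k (c k (Suc l))" using o inn_iff_not_out[OF k(2)] neC[OF k(2)] by auto
    then have "a \<noteq> l" "b \<noteq> Suc l" using ab(1) unfolding consec_def by metis+
    then have lt: "a < l" "Suc l < b" using ab by auto
    then have "R a" using empty[OF ab(1)] by auto
    then obtain i where i: "i \<in> ?X0" "seg (C k) a b = ?seg i" using rep[OF ab(1) \<open>R a\<close>] by (elim bexE)
    have "{u, v} \<in> ppairs (seg (C k) a b)" unfolding ppairs_seg l(1) using lt by auto
    then show "{u, v} \<in> cpairs H'" using H'(3)[OF i(1)] i(2) by auto
  qed (rule H'(1))
  then show thesis by (rule that)
qed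

text \<open>\<open>attached\<close> is a relation, but it determines the face of a spoke whose inner
  end lies strictly between \<open>i\<close> and \<open>j\<close>: that end is on the frontier of
  the face, and \<open>face_unique\<close> applies.\<close>

lemma attached_region:
  assumes "face k i j q" "k < n" "i < l" "l < j" "e \<in> annulus_edges G C (Suc k)" "c k l \<in> ends G e" "attached G crv C (Suc k) e F"
  shows "F = region k i j q"
proof -
  note f = faceD[OF assms(1)]
  have k': "1 \<le> Suc k" "Suc k \<le> n" using assms(2) by auto
  obtain u z where uz: "spoke (Suc k) u z" "ends G e = {u, z}" "e \<in> edges G" using annulus_edge_spoke[OF assms(5) k'] by metis
  have cl: "c k l \<in> set (C k)" using neC[OF f(8)] by simp
  have u: "u \<notin> set (C k)" using spokeD(7)[OF uz(1)] by simp
  then have z: "z = c k l" using assms(6) uz(2) cl by auto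
  obtain v P where vP: "v \<in> ends G e" "v \<in> set (C k)" "P \<subseteq> cycle_edges G (C k)" "v \<in> \<Union> (ends G ` P)"
    "drawing crv P \<subseteq> frontier F" and F: "F \<in> outer_faces G crv C k"
    using assms(7) unfolding attached_def by auto
  have v: "v = c k l" using vP(1,2) uz(2) u z by auto
  obtain e1 where e1: "e1 \<in> P" "v \<in> ends G e1" using vP(4) by blast
  then have "e1 \<in> edges G" using vP(3) unfolding cycle_edges_def by blast
  then have "pos (c k l) \<in> frontier F" using pos_ends_in_crv[of e1 v] e1 v vP(5) unfolding drawing_def by blast
  then show ?thesis using face_unique[OF assms(1) F] assms(3,4) by blast
qed

lemma segment_spoke:
  assumes "face k i j q" "k < n" "j \<noteq> Suc i"
  obtains e where "e \<in> annulus_edges G C (Suc k)" "c k (Suc i) \<in> ends G e" "Suc i < j"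
proof -
  note f = faceD[OF assms(1)]
  have lt: "Suc i < j" using assms f by simp
  then have "\<not> inn k (c k (Suc i))" using f(1) unfolding consec_def by simp
  then have "out k (c k (Suc i))" using inn_iff_not_out[OF f(8)] neC[OF f(8)] by simp
  then obtain u where u: "spoke (Suc k) u (c k (Suc i))" unfolding out_def by blast
  obtain e where e: "e \<in> annulus_edges G C (Suc k)" "ends G e = {u, c k (Suc i)}" using spoke_edge[OF u] by metis
  show thesis by (rule that[OF e(1) _ lt]) (simp add: e(2))
qed

text \<open>An unselected face with a vertex of \<open>C k\<close> between its spokes would carry a
  spoke of annulus \<open>k + 1\<close>, and that spoke could be attached to this face only. For
  \<open>2 \<le> k\<close> the maximum in \<open>block_annulus\<close> is
  \<open>Suc k\<close>.\<close>

lemma block_class: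
  assumes "block_annulus G crv C (Suc k)" "2 \<le> k" "k < n"
  obtains S where "four_cycle_class G crv C k S" "\<And>i j q. face k i j q \<Longrightarrow> region k i j q \<notin> S \<Longrightarrow> j = Suc i"
proof -
  have mx: "max (Suc k) 3 = Suc k" using assms(2) by simp
  obtain S where S: "four_cycle_class G crv C k S"
    "\<forall>e\<in>annulus_edges G C (Suc k). \<exists>f\<in>S. attached G crv C (Suc k) e f"
    using assms(1) unfolding block_annulus_def Let_def mx by auto
  have "j = Suc i" if f: "face k i j q" "region k i j q \<notin> S" for i j q
  proof (rule ccontr)
    assume "j \<noteq> Suc i"
    then obtain e where e: "e \<in> annulus_edges G C (Suc k)" "c k (Suc i) \<in> ends G e" "Suc i < j"
      using segment_spoke[OF f(1) assms(3)] by blast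
    then obtain F where "F \<in> S" "attached G crv C (Suc k) e F" using S(2) by blast
    then show False using attached_region[OF f(1) assms(3), of "Suc i" e F] e f(2) by simp
  qed
  then show thesis using that S(1) by blast
qed

lemma ring_class:
  assumes "ring_annulus G crv C (Suc k)" "2 \<le> k" "k < n"
  obtains S where "four_cycle_class G crv C k S" "\<And>i j q. face k i j q \<Longrightarrow> region k i j q \<in> S \<Longrightarrow> j = Suc i"
proof -
  have mx: "max (Suc k) 3 = Suc k" using assms(2) by simp
  obtain S where S: "four_cycle_class G crv C k S"
    "\<forall>e\<in>annulus_edges G C (Suc k). \<exists>f. f \<notin> S \<and> attached G crv C (Suc k) e f"
    using assms(1) unfolding ring_annulus_def Let_def mx by auto
  have "j = Suc i" if f: "face k i j q" "region k i j q \<in> S" for i j q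
  proof (rule ccontr)
    assume "j \<noteq> Suc i"
    then obtain e where e: "e \<in> annulus_edges G C (Suc k)" "c k (Suc i) \<in> ends G e" "Suc i < j"
      using segment_spoke[OF f(1) assms(3)] by blast
    then obtain F where "F \<notin> S" "attached G crv C (Suc k) e F" using S(2) by blast
    then show False using attached_region[OF f(1) assms(3), of "Suc i" e F] e f(2) by simp
  qed
  then show thesis using that S(1) by blast
qed

text \<open>Turns a set of faces into a predicate on starting positions, the form in which
  \<open>block_step\<close> expects its selection.\<close>

definition in_class :: "nat \<Rightarrow> complex set set \<Rightarrow> nat \<Rightarrow> bool" where
  "in_class k S i \<longleftrightarrow> (\<exists>j q. face k i j q \<and> region k i j q \<in> S)"

lemma next_face:
  assumes "face k i j q"
  obtains j' q' where "face k j j' q'"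
proof -
  have "innP k j" using consec_inn(5)[OF faceD(1)[OF assms]] .
  then show ?thesis using consec_inn_from face_exists that by metis
qed

text \<open>Two faces with the same start have the same end \<open>j\<close>, but possibly different
  arcs \<open>q\<close>. Both are adjacent to the next face, and alternation then gives them the
  same class.\<close>

lemma in_class_iff:
  assumes "four_cycle_class G crv C k S" "face k i j q"
  shows "in_class k S i \<longleftrightarrow> region k i j q \<in> S"
proof
  assume "in_class k S i"
  then obtain j1 q1 where f1: "face k i j1 q1" "region k i j1 q1 \<in> S" unfolding in_class_def by blast
  have "j1 = j" using consec_unique faceD(1)[OF assms(2)] faceD(1)[OF f1(1)] by blast
  obtain j' q' where f': "face k j j' q'" using next_face[OF assms(2)] by blast
  show "region k i j q \<in> S"
    using class_alternates[OF assms f'] class_alternates[OF assms(1) f1(1), of j' q'] f1(2) f' \<open>j1 = j\<close> by blast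
qed (use assms in \<open>auto simp: in_class_def\<close>)

lemma in_class_shift:
  assumes "four_cycle_class G crv C k S"
  shows "in_class k S (i + t * m k) = in_class k S i"
proof (cases "innP k i")
  case True
  then obtain j q where f: "face k i j q" using consec_inn_from face_exists by metis
  have "region k (i + t * m k) (j + t * m k) q = region k i j q"
    unfolding region_def by (simp add: seg_add_mult)
  moreover have "face k (i + t * m k) (j + t * m k) q" using f face_shift_mult by simp
  ultimately show ?thesis using in_class_iff[OF assms] f by simp
next
  case False
  then show ?thesis unfolding in_class_def by (metis consec_inn(4) cyc_add_mult faceD(1))
qed

lemma in_class_alternates:
  assumes "four_cycle_class G crv C k S" "consec (innP k) i j"
  shows "in_class k S i \<longleftrightarrow> \<not> in_class k S j"
proof -
  obtain q where f: "face k i j q" using face_exists[OF assms(2)] by blast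
  obtain j' q' where f': "face k j j' q'" using next_face[OF f] by blast
  show ?thesis using class_alternates[OF assms(1) f f'] in_class_iff[OF assms(1)] f f' by simp
qed

end

section \<open>Block and ring annuli\<close>

context annular
begin

lemma cover_0: "cover 0 (C 0)"
  unfolding cover_def using cycleC by auto

lemma coloring_cyc:
  assumes "\<And>u v. adj G u v \<Longrightarrow> u \<in> A \<longleftrightarrow> v \<notin> A" "k \<le> n"
  shows "(c k l \<in> A \<longleftrightarrow> c k (l + d) \<in> A) \<longleftrightarrow> even d"
proof (induction d)
  case (Suc d)
  have "adj G (c k (l + d)) (c k (Suc (l + d)))" using cycle_adj_cyc[OF cycleC[OF assms(2)]] .
  then have "c k (l + d) \<in> A \<longleftrightarrow> c k (Suc (l + d)) \<notin> A" by (rule assms(1))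
  then show ?case using Suc by auto
qed simp

lemma block_step_class:
  assumes "block_annulus G crv C (Suc k)" "2 \<le> k" "k < n" "cover (k - 1) H"
  obtains H' where "cover k H'"
proof -
  obtain S where S: "four_cycle_class G crv C k S" "\<And>i j q. face k i j q \<Longrightarrow> region k i j q \<notin> S \<Longrightarrow> j = Suc i"
    using block_class[OF assms(1-3)] by metis
  define R where "R = in_class k S"
  note R = in_class_shift[OF S(1), folded R_def] in_class_alternates[OF S(1), folded R_def] in_class_iff[OF S(1), folded R_def]
  show thesis
  proof (rule block_step[OF assms(4), of R])
    show "R (i + m k) = R i" for i using R(1)[of i 1] by simp
    show "R i \<longleftrightarrow> \<not> R j" if "consec (innP k) i j" for i j using R(2)[OF that] .
    show "length q = 2" if "face k i j q" "R i" for i j q using class_length[OF S(1) that(1)] R(3)[OF that(1)] that(2) by blast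
    show "j = Suc i" if ij: "consec (innP k) i j" "\<not> R i" for i j
    proof -
      obtain q where q: "face k i j q" using face_exists[OF ij(1)] by blast
      then show ?thesis using S(2)[OF q] R(3)[OF q] ij(2) by blast
    qed
  qed (use assms that in auto)
qed

text \<open>One of two neighbouring faces is in the 4-cycle class. No spoke of the next ring annulus
  is attached there, so this face has four vertices in \<open>G\<close> itself and not only after
  suppression.\<close>

lemma ring_step_class:
  assumes "ring_annulus G crv C (Suc k)" "2 \<le> k" "k < n" "cover (k - 1) H"
  obtains H' where "cover k H'"
proof -
  obtain S where S: "four_cycle_class G crv C k S" "\<And>i j q. face k i j q \<Longrightarrow> region k i j q \<in> S \<Longrightarrow> j = Suc i"
    using ring_class[OF assms(1-3)] by metis
  have k: "1 \<le> k" "k \<le> n" using assms by auto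
  obtain i j where ij: "consec (innP k) i j" using consec_inn_exists[OF k order_refl] by metis
  obtain j' where j': "consec (innP k) j j'" using consec_inn_from[OF consec_inn(5)[OF ij]] by metis
  obtain q where q: "face k i j q" using face_exists[OF ij] by blast
  obtain q' where q': "face k j j' q'" using face_exists[OF j'] by blast
  have "\<exists>i q. face k i (Suc i) q \<and> length q = 2"
  proof (cases "region k i j q \<in> S")
    case True
    then show ?thesis using S(2)[OF q True] class_length[OF S(1) q True] q by blast
  next
    case False
    then have "region k j j' q' \<in> S" using class_alternates[OF S(1) q q'] by blast
    then show ?thesis using S(2)[OF q'] class_length[OF S(1) q'] q' by blast
  qed
  then show thesis using ring_step[OF assms(4)] that by blast
qed

text \<open>The two hypotheses may come with different classes \<open>S\<close> and
  \<open>S'\<close> of annulus 2. A face that carries a spoke of annulus 3 is in \<open>S\<close>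
  and not in \<open>S'\<close>; by alternation each face of annulus 2 is in exactly one of them. So
  each is a 4-cycle face with only one edge on \<open>C 1\<close>, although \<open>C 1\<close> has
  \<open>inn\<close> vertices, which lie strictly between consecutive \<open>out\<close>
  vertices.\<close>

lemma block_ring_exclusive:
  assumes "block_annulus G crv C 3" "ring_annulus G crv C 3" "2 < n"
  shows False
proof -
  have 3: "3 = Suc 2" by simp
  have n2: "1 \<le> (2 :: nat)" "2 \<le> n" "2 \<le> (2 :: nat)" using assms(3) by auto
  obtain S where S: "four_cycle_class G crv C 2 S" "\<And>i j q. face 2 i j q \<Longrightarrow> region 2 i j q \<notin> S \<Longrightarrow> j = Suc i"
    using block_class[OF assms(1)[unfolded 3] n2(3) assms(3)] by metis
  obtain S' where S': "four_cycle_class G crv C 2 S'" "\<And>i j q. face 2 i j q \<Longrightarrow> region 2 i j q \<in> S' \<Longrightarrow> j = Suc i"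
    using ring_class[OF assms(2)[unfolded 3] n2(3) assms(3)] by metis
  define R where "R = in_class 2 S"
  note R = in_class_shift[OF S(1), folded R_def] in_class_alternates[OF S(1), folded R_def] in_class_iff[OF S(1), folded R_def]
  define R' where "R' = in_class 2 S'"
  note R' = in_class_shift[OF S'(1), folded R'_def] in_class_alternates[OF S'(1), folded R'_def] in_class_iff[OF S'(1), folded R'_def]
  obtain z where z: "out 2 z" using third_out[OF assms(3)] by metis
  obtain l where l: "m 2 \<le> l" "c 2 l = z" using out_index[OF z] by metis
  obtain i0 j0 where i0: "consec (innP 2) i0 j0" "i0 \<le> l" "l < j0" using consec_inn_exists[OF n2(1,2) l(1)] by metis
  obtain q0 where q0: "face 2 i0 j0 q0" using face_exists[OF i0(1)] by metis
  have "\<not> inn 2 z" using z inn_iff_not_out[of 2 z] outD[OF z] by auto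
  then have "i0 \<noteq> l" using i0(1) l unfolding consec_def by auto
  then have "j0 \<noteq> Suc i0" using i0 by auto
  then have base: "R i0 \<longleftrightarrow> \<not> R' i0" using S(2)[OF q0] S'(2)[OF q0] R(3)[OF q0] R'(3)[OF q0] by blast
  have step: "R i \<longleftrightarrow> \<not> R' i" if "i0 \<le> i" "innP 2 i" for i
    using that
  proof (induction i rule: less_induct)
    case (less i)
    show ?case
    proof (cases "i = i0")
      case False
      have "innP 2 i0" using i0(1) unfolding consec_def by simp
      then obtain j where j: "consec (innP 2) j i" "i0 \<le> j" using consec_prev[of "innP 2" i0 i] less.prems False by auto
      then have "R j \<longleftrightarrow> \<not> R' j" using less.IH[of j] unfolding consec_def by simp
      then show ?thesis using R(2)[OF j(1)] R'(2)[OF j(1)] by blast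
    qed (use base in simp)
  qed
  have full: "length q = 2" if f: "face 2 i j q" for i j q
  proof -
    \<comment> \<open>The comparison of \<open>R\<close> with \<open>R'\<close> runs to the right of
      \<open>i0\<close>, so the position is first moved there by a multiple of the period.\<close>
    have "m 2 \<ge> 1" using mC[of 2] assms(3) by simp
    then have "i0 * 1 \<le> i0 * m 2" by (intro mult_le_mono2)
    then have "i0 \<le> i + i0 * m 2" unfolding mult_1_right by (rule trans_le_add2)
    moreover have "innP 2 (i + i0 * m 2)" using consec_inn(4)[OF faceD(1)[OF f]] by simp
    ultimately have "R i \<longleftrightarrow> \<not> R' i" using step R(1) R'(1) by metis
    then have "region 2 i j q \<in> S \<or> region 2 i j q \<in> S'" using R(3)[OF f] R'(3)[OF f] by blast
    then show ?thesis using class_length S(1) S'(1) f by blast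
  qed
  have n1: "1 \<le> (1 :: nat)" "1 \<le> n" "1 < n" using assms(3) by auto
  obtain v where v: "inn 1 v" using third_inn[OF n1(1,2)] by metis
  obtain y where y: "out 1 y" using third_out[OF n1(3)] by metis
  obtain a where a: "0 \<le> a" "a < 0 + m 1" "c 1 a = y" using out_index[OF y] by metis
  obtain g where g: "m 1 \<le> g" "c 1 g = v" using inn_index[OF v] by metis
  obtain b where b: "Suc g \<le> b" "c 1 b = y" using out_index[OF y] by metis
  have "outP 1 a" "outP 1 b" "a \<le> g" "g < b" using a b y g by auto
  then obtain a' b' where ab: "consec (outP 1) a' b'" "a' \<le> g" "g < b'" using consec_around[of "outP 1" a b g] by metis
  have "\<not> out 1 v" using v inn_iff_not_out[of 1 v] innD[OF v] by auto
  then have "a' \<noteq> g" using ab(1) g unfolding consec_def by auto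
  obtain i j q where q: "face (Suc 1) i j q" "q = seg (C 1) a' b' \<or> q = rev (seg (C 1) a' b')"
    using face_exists_out[OF ab(1)] by metis
  have "Suc 1 = 2" by simp
  then have "length q = 2" using full[of i j q] q(1) by (simp only:)
  then show False using q(2) ab \<open>a' \<noteq> g\<close> by auto
qed

end

context annular_ac
begin

text \<open>On \<open>C 1\<close> both the runs of \<open>out\<close> vertices and the runs of
  \<open>inn\<close> vertices have even length, by the parities for annuli 1 and 2. Hence all runs
  of \<open>out\<close> vertices start in the same colour, and the colour of an \<open>inn\<close>
  vertex selects every other face such that unselected faces carry no \<open>out\<close>
  vertex.\<close>

lemma first_step:
  assumes "2 < n"
  obtains H where "cover 1 H"
proof -
  obtain A where A: "\<And>u v. adj G u v \<Longrightarrow> u \<in> A \<longleftrightarrow> v \<notin> A" using coloring by blast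
  have n1: "1 \<le> (1 :: nat)" "1 \<le> n" "1 < n" using assms by auto
  note col = coloring_cyc[OF A n1(2)]
  let ?K = "\<lambda>l. c 1 l \<in> A"
  have par: "?K i \<longleftrightarrow> \<not> ?K j" "odd (j - i)" if ij: "consec (innP 1) i j" for i j
  proof -
    obtain q where q: "face 1 i j q" using face_exists[OF ij] by blast
    show "odd (j - i)" using face_parity(2)[OF q n1(3)] .
    then show "?K i \<longleftrightarrow> \<not> ?K j" using col[of i "j - i"] faceD(5)[OF q] by simp
  qed
  have opar: "?K a \<longleftrightarrow> \<not> ?K b" if ab: "consec (outP 1) a b" for a b
  proof -
    obtain i j q where q: "face (Suc 1) i j q" "q = seg (C 1) a b \<or> q = rev (seg (C 1) a b)"
      using face_exists_out[OF ab] by metis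
    have "even (length q)" using face_parity(1)[OF q(1)] assms by simp
    moreover have "length q = Suc b - a" using q(2) by auto
    moreover have "a < b" using ab unfolding consec_def by simp
    ultimately have "odd (b - a)" by (simp add: Suc_diff_le)
    then show ?thesis using col[of a "b - a"] \<open>a < b\<close> by simp
  qed
  have io: "inn 1 (c 1 l) \<longleftrightarrow> \<not> out 1 (c 1 l)" for l using inn_iff_not_out[OF n1(2)] neC[OF n1(2)] by simp
  obtain y where y: "out 1 y" using third_out[OF n1(3)] by metis
  obtain l0 where l0: "m 1 \<le> l0" "c 1 l0 = y" using out_index[OF y] by metis
  obtain i0 j0 where i0: "consec (innP 1) i0 j0" "i0 \<le> l0" "l0 < j0" using consec_inn_exists[OF n1(1,2) l0(1)] by metis
  have "i0 \<noteq> l0" using i0(1) l0 y io unfolding consec_def by metis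
  then have lt0: "Suc i0 < j0" using i0 by simp
  then have o0: "outP 1 (Suc i0)" using i0(1) io unfolding consec_def by auto
  \<comment> \<open>From the start of a run of \<open>out\<close> vertices to its end the colour
    changes, and it changes back from there to the next \<open>out\<close> vertex, which starts the
    following run.\<close>
  have starts: "?K l \<longleftrightarrow> ?K (Suc i0)" if "Suc i0 \<le> l" "outP 1 l" "innP 1 (l - 1)" for l
    using that
  proof (induction l rule: less_induct)
    case (less l)
    show ?case
    proof (cases "l = Suc i0")
      case False
      then obtain a where a: "consec (outP 1) a l" "Suc i0 \<le> a"
        using consec_prev[of "outP 1" "Suc i0" l] o0 less.prems by auto
      have "a < l" "outP 1 a" using a(1) unfolding consec_def by auto
      have "a \<noteq> l - 1" using less.prems(3) \<open>outP 1 a\<close> io by metis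
      then have al: "a < l - 1" using \<open>a < l\<close> by simp
      have "innP 1 i0" using i0(1) unfolding consec_def by simp
      then obtain i j where ij: "consec (innP 1) i j" "i0 \<le> i" "i \<le> a" "a < j" "j \<le> l - 1"
        using consec_around[of "innP 1" i0 "l - 1" a] less.prems(3) a(2) al by auto
      have "i \<noteq> a" using ij(1) \<open>outP 1 a\<close> io unfolding consec_def by metis
      then have ia: "i < a" using ij by simp
      have "\<not> outP 1 (Suc a)" using a(1) al unfolding consec_def by auto
      then have "innP 1 (Suc a)" using io by simp
      then have j: "j = Suc a" using ij(1,4) ia unfolding consec_def by (metis Suc_lessI less_SucI)
      have si: "outP 1 (Suc i)" "innP 1 i" using ij(1) ia j io unfolding consec_def by auto
      have "Suc i < l" using ia \<open>a < l\<close> by simp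
      then have "?K (Suc i) \<longleftrightarrow> ?K (Suc i0)" using less.IH[of "Suc i"] si ij(2) by simp
      moreover have "odd (a - Suc i)" using par(2)[OF ij(1)] j ia by (simp add: Suc_diff_le)
      then have "?K (Suc i) \<longleftrightarrow> \<not> ?K a" using col[of "Suc i" "a - Suc i"] ia by simp
      ultimately show ?thesis using opar[OF a(1)] by blast
    qed simp
  qed
  \<comment> \<open>A nonempty run of \<open>out\<close> vertices starts right after an
    \<open>inn\<close> vertex of the opposite colour; these are the positions to be
    selected.\<close>
  define R where "R i \<longleftrightarrow> (?K i \<longleftrightarrow> \<not> ?K (Suc i0))" for i
  have c0: "cover (1 - 1) (C 0)" using cover_0 by simp
  show thesis
  proof (rule block_step[OF c0, of R])
    show "R (i + m 1) = R i" for i unfolding R_def by simp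
    show "R i \<longleftrightarrow> \<not> R j" if "consec (innP 1) i j" for i j using par(1)[OF that] unfolding R_def by blast
    show "length q = 2" if f: "face 1 i j q" "R i" for i j q
    proof -
      obtain a b where ab: "consec (outP 0) a b" "q = seg (C 0) a b \<or> q = rev (seg (C 0) a b)"
        using f(1) unfolding face_def by auto
      \<comment> \<open>There is no annulus inside \<open>C 0\<close>, so all its vertices are
        \<open>out\<close> and consecutive ones are adjacent.\<close>
      have "\<not> inn 0 (c 0 (Suc a))" using innD by fastforce
      then have "outP 0 (Suc a)" using inn_iff_not_out[of 0] neC[of 0] by simp
      then have "b = Suc a" using ab(1) unfolding consec_def by (metis Suc_lessI lessI)
      then show ?thesis using ab(2) by auto
    qed
    show "j = Suc i" if ij: "consec (innP 1) i j" "\<not> R i" for i j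
    proof (rule ccontr)
      assume "j \<noteq> Suc i"
      then have "Suc i < j" using ij(1) unfolding consec_def by simp
      then have o: "outP 1 (Suc i)" "innP 1 i" using ij(1) io unfolding consec_def by auto
      \<comment> \<open>Moved by a multiple of the period beyond \<open>Suc i0\<close>, where
        \<open>starts\<close> applies.\<close>
      let ?l = "Suc i + Suc i0 * m 1"
      have "m 1 \<ge> 1" using mC[OF n1(2)] by simp
      then have "Suc i0 * 1 \<le> Suc i0 * m 1" by (intro mult_le_mono2)
      then have "Suc i0 \<le> ?l" unfolding mult_1_right by (rule trans_le_add2)
      moreover have "outP 1 ?l" using o(1) by (simp only: cyc_add_mult)
      moreover have "?l - 1 = i + Suc i0 * m 1" by simp
      then have "innP 1 (?l - 1)" using o(2) by (simp only: cyc_add_mult)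
      ultimately have "?K ?l \<longleftrightarrow> ?K (Suc i0)" by (rule starts)
      then have "?K (Suc i) \<longleftrightarrow> ?K (Suc i0)" by (simp only: cyc_add_mult)
      moreover have "?K i \<longleftrightarrow> \<not> ?K (Suc i)" using col[of i 1] by simp
      ultimately show False using ij(2) unfolding R_def by blast
    qed
  qed (use n1 that in auto)
qed

text \<open>Runs of \<open>out\<close> vertices on \<open>C (n - 1)\<close> have even length, so a
  nonempty run contains two adjacent vertices. The face of the last annulus at this edge is a
  4-cycle of \<open>G\<close>, because \<open>C n\<close> has no \<open>out\<close> vertices to
  separate the two spokes.\<close>

lemma last_step:
  assumes "2 \<le> n" "cover (n - 1) H"
  obtains H' where "cover n H'"
proof -
  define k where "k = n - 1"
  have k: "1 \<le> k" "k \<le> n" "k < n" "Suc k = n" using assms(1) unfolding k_def by auto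
  have io: "inn k (c k l) \<longleftrightarrow> \<not> out k (c k l)" for l using inn_iff_not_out[OF k(2)] neC[OF k(2)] by simp
  obtain y where y: "out k y" using third_out[OF k(3)] by metis
  obtain l where l: "m k \<le> l" "c k l = y" using out_index[OF y] by metis
  obtain i j where ij: "consec (innP k) i j" "i \<le> l" "l < j" using consec_inn_exists[OF k(1,2) l(1)] by metis
  obtain q where q: "face k i j q" using face_exists[OF ij(1)] by blast
  have "i \<noteq> l" using ij(1) l y io unfolding consec_def by metis
  \<comment> \<open>A single \<open>out\<close> vertex between \<open>i\<close> and \<open>j\<close>
    would contradict that \<open>j - i\<close> is odd.\<close>
  have "j - i \<noteq> 2"
  proof
    assume "j - i = 2"
    then show False using face_parity(2)[OF q k(3)] by (simp only: even_numeral simp_thms)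
  qed
  then have "Suc (Suc i) < j" using \<open>i \<noteq> l\<close> ij(2,3) by linarith
  then have "\<not> innP k (Suc i)" "\<not> innP k (Suc (Suc i))" using ij(1) unfolding consec_def by auto
  then have "outP k (Suc i)" "outP k (Suc (Suc i))" using io[of "Suc i"] io[of "Suc (Suc i)"] by blast+
  then have "consec (outP k) (Suc i) (Suc (Suc i))" unfolding consec_def by (auto simp del: not_less_eq)
  then obtain i' j' q' where f': "face (Suc k) i' j' q'"
      "q' = seg (C k) (Suc i) (Suc (Suc i)) \<or> q' = rev (seg (C k) (Suc i) (Suc (Suc i)))"
    by (rule face_exists_out)
  then have f: "face n i' j' q'" "length q' = 2" using k(4) by auto
  have "j' = Suc i'"
  proof (rule ccontr)
    assume "j' \<noteq> Suc i'"
    then have "\<not> innP n (Suc i')" using faceD(1)[OF f(1)] unfolding consec_def by auto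
    then have "out n (c n (Suc i'))" using inn_iff_not_out[of n] neC[of n] by simp
    then show False using outD by blast
  qed
  then show thesis using ring_step[OF assms(2)] f that by blast
qed

lemma hamiltonian_block_ring:
  assumes "n = x + y" "x \<ge> 1" "y \<ge> 1"
    and block: "\<forall>k\<in>{1..x}. block_annulus G crv C k"
    and ring: "\<forall>k\<in>{x+1..x+y}. ring_annulus G crv C k"
  shows "hamiltonian G"
proof -
  have n: "2 < n" using ac unfolding adb_ac_def by blast
  \<comment> \<open>By convention the first three annuli share their type. For smaller
    \<open>x\<close>, annulus 1 would make annulus 3 a block annulus and annulus
    \<open>x + 1\<close> would make it a ring annulus.\<close>
  have "x \<ge> 3"
  proof (rule ccontr)
    assume "\<not> x \<ge> 3"
    then have mx: "max 1 3 = max (3 :: nat) 3" "max (x + 1) 3 = max 3 3" by auto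
    have "block_annulus G crv C 1" "ring_annulus G crv C (x + 1)" using block ring assms(2,3) by auto
    then have "block_annulus G crv C 3" "ring_annulus G crv C 3"
      unfolding block_annulus_def ring_annulus_def mx by auto
    then show False using block_ring_exclusive n by blast
  qed
  have "\<exists>H. cover k H" if "k \<le> n" for k
    using that
  proof (induction k)
    case 0
    then show ?case using cover_0 by blast
  next
    case (Suc k)
    then obtain H where H: "cover (Suc k - 1) H" by auto
    \<comment> \<open>The insertion of \<open>C (Suc k)\<close> depends on the type of annulus
      \<open>Suc (Suc k)\<close>. Therefore the block step stops before \<open>Suc k = x\<close>:
      the successor of the last block annulus is a ring annulus.\<close>
    consider "k = 0" | "1 \<le> k" "Suc k < x" | "x \<le> Suc k" "1 \<le> k" "Suc k < n" | "Suc k = n" using Suc.prems by linarith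
    then show ?case
    proof cases
      case 1
      then show ?thesis using first_step[OF n] by auto
    next
      case 2
      then have "block_annulus G crv C (Suc (Suc k))" "2 \<le> Suc k" "Suc k < n" using block assms(1) by auto
      then show ?thesis using block_step_class H by blast
    next
      case 3
      then have "ring_annulus G crv C (Suc (Suc k))" "2 \<le> Suc k" using ring assms(1) by auto
      then show ?thesis using ring_step_class H 3(3) by blast
    next
      case 4
      have "2 \<le> n" "cover (n - 1) H" using H 4 n by auto
      then show ?thesis using last_step 4 by metis
    qed
  qed
  then obtain H where "cover n H" by blast
  then show ?thesis unfolding cover_def hamiltonian_def verts_eq by blast
qed

end

theorem theorem3p3:
  fixes G :: "('v, 'e) mgraph"
    and pos :: "'v \<Rightarrow> complex"
    and crv :: "'e \<Rightarrow> real \<Rightarrow> complex"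
    and C :: "nat \<Rightarrow> 'v list"
    and x y :: nat
  assumes "adb_ac G pos crv C (x + y)"
    and "x \<ge> 1" and "y \<ge> 1"
    and "\<forall>k\<in>{1..x}. block_annulus G crv C k"
    and "\<forall>k\<in>{x+1..x+y}. ring_annulus G crv C k"
  shows "hamiltonian G"
proof -
  interpret annular_ac G pos crv C "x + y"
    using assms(1) by unfold_locales (simp_all add: adb_ac_def)
  show ?thesis using hamiltonian_block_ring[OF refl] assms(2-5) by blast
qed

end
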